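(* Let $X=\widetilde{\bigvee}_{j\in\mathbb{N}}X_j$ be a shrinking wedge of CW-complexes and $n\geq 2$. The subgroup $\mathcal{W}_{2n-1}(X)$ of $\pi_{2n-1}(X)$ is closed under infinite sums. Moreover, \[\mathcal{W}_{2n-1}(X)=cl_{\Sigma}\left(\{[\alpha,\beta]\in \pi_{2n-1}(X)\mid (\alpha,\beta)\in \pi_{n}(X)^2\text{ is wedge-disjoint}\}\right).\]
   Context: All spaces are Hausdorff and maps are continuous and based; $\mathbb{N}=\{1,2,3,\dots\}$. Loops and infinite sums. $\Omega^m(X)=\Omega^m(X,x_0)$ is the set of maps $(I^m,\partial I^m)\to (X,x_0)$, $I=[0,1]$, identified with based maps $S^m\to X$ via a fixed homeomorphism $I^m/\partial I^m\cong S^m$; $[f]\in\pi_m(X)$ is the class of $f\in\Omega^m(X)$. $\Omega^m_{\mathbb{N}}(X,x_0)$ is the set of sequences $\{f_j\}_{j\in\mathbb{N}}$ in $\Omega^m(X,x_0)$ that converge to $x_0$: for every neighborhood $U$ of $x_0$, $\operatorname{Im}(f_j)\subseteq U$ for all but finitely many $j$. For such a sequence, $\sum_{j=1}^\infty f_j\in\Omega^m(X,x_0)$ is the map that is $f_j$ (affinely rescaled) on $\left[\frac{j-1}{j},\frac{j}{j+1}\right]\times I^{m-1}$ for each $j$ and sends $\{1\}\times I^{m-1}$ to $x_0$. Closures ($m\ge2$). A subset $S\subseteq\pi_m(X,x_0)$ is closed under infinite sums if $\left[\sum_{j=1}^\infty f_j\right]\in S$ whenever $\{f_j\}_{j\in\mathbb{N}}\in\Omega^m_{\mathbb{N}}(X,x_0)$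 and $[f_j]\in S$ for all $j$. $cl_\Sigma(S)$ is the smallest subgroup of $\pi_m(X,x_0)$ that contains $S$ and is closed under infinite sums (the intersection of all such subgroups). $\llbracket S\rrbracket$ is the set (in fact subgroup) of all classes $\left[\sum_{j=1}^\infty f_j\right]$ with $\{f_j\}_{j\in\mathbb{N}}\in\Omega^m_{\mathbb{N}}(X,x_0)$ and each $[f_j]$ in the subgroup $\langle S\rangle$ generated by $S$. Whitehead products. $a_{p,q}:S^{p+q-1}\to S^p\vee S^q$ is the standard attaching map of the $(p+q)$-cell of $S^p\times S^q$. For $f\in\Omega^p(X)$, $g\in\Omega^q(X)$, $[f,g]=(f\vee g)\circ a_{p,q}\in\Omega^{p+q-1}(X)$; on homotopy classes, $[[f],[g]]$ is the class of $[f,g]$. Shrinking wedges. $\widetilde{\bigvee}_{j\in \mathbb{N}}X_j$ is the one-point union of based spaces (basepoints identified to $x_0$) where $U$ is open iff $U\cap X_j$ is open in $X_j$ for all $j$ and, if $x_0\in U$, then $X_j\subseteq U$ for all but finitely many $j$. The group $\mathcal{W}_{2n-1}(X)$. A pair $(f,g)\in\Omega^n(X)^2$ is wedge-disjoint if there are disjoint $F,G\subseteq\mathbb{N}$ with $\operatorname{Im}(f)\subseteq\bigcup_{j\in F}X_j$ and $\operatorname{Im}(g)\subseteq\bigcup_{j\in G}X_j$. A pair $(\alpha,\beta)\in\pi_n(X)^2$ is wedge-disjoint if $\alpha=[f]$, $\beta=[g]$ for some wedge-disjoint pair $(f,g)$. $\mathcal{W}_{2n-1}(X)=\llbracket\{[\alpha,\beta]\in\pi_{2n-1}(X)\mid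 (\alpha,\beta)\in\pi_n(X)^2\text{ is wedge-disjoint}\}\rrbracket$. *)

theory Defs
  imports "HOL-Analysis.Analysis" "HOL-Algebra.Generated_Groups"
begin

section \<open>CW-complexes\<close>

definition unit_disc :: "nat \<Rightarrow> (nat \<Rightarrow> real) topology" where
  "unit_disc n = subtopology (Euclidean_space n) {x. (\<Sum>i<n. (x i)\<^sup>2) \<le> 1}"

definition unit_disc_interior :: "nat \<Rightarrow> (nat \<Rightarrow> real) set" where
  "unit_disc_interior n = {x \<in> topspace (unit_disc n). (\<Sum>i<n. (x i)\<^sup>2) < 1}"

definition unit_disc_sphere :: "nat \<Rightarrow> (nat \<Rightarrow> real) set" where
  "unit_disc_sphere n = {x \<in> topspace (unit_disc n). (\<Sum>i<n. (x i)\<^sup>2) = 1}"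

text \<open>A cell is given by its dimension and its characteristic map; the open cell is the image
  of the open disc.  The last two conditions are closure-finiteness and the weak topology.\<close>

definition CW_structure :: "'a topology \<Rightarrow> (nat \<times> ((nat \<Rightarrow> real) \<Rightarrow> 'a)) set \<Rightarrow> bool" where
  "CW_structure X C \<longleftrightarrow>
     (\<forall>(n, \<phi>) \<in> C. continuous_map (unit_disc n) X \<phi> \<and>
        homeomorphic_map (subtopology (unit_disc n) (unit_disc_interior n))
          (subtopology X (\<phi> ` unit_disc_interior n)) \<phi>) \<and>
     (\<forall>(n, \<phi>) \<in> C. \<forall>(k, \<psi>) \<in> C. (n, \<phi>) \<noteq> (k, \<psi>) \<longrightarrow>
        disjnt (\<phi> ` unit_disc_interior n) (\<psi> ` unit_disc_interior k)) \<and>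
     (\<Union>(n, \<phi>) \<in> C. \<phi> ` unit_disc_interior n) = topspace X \<and>
     (\<forall>(n, \<phi>) \<in> C. \<exists>F \<subseteq> C. finite F \<and> (\<forall>(k, \<psi>) \<in> F. k < n) \<and>
        \<phi> ` unit_disc_sphere n \<subseteq> (\<Union>(k, \<psi>) \<in> F. \<psi> ` unit_disc_interior k)) \<and>
     (\<forall>A \<subseteq> topspace X.
        closedin X A \<longleftrightarrow> (\<forall>(n, \<phi>) \<in> C. closedin X (A \<inter> \<phi> ` topspace (unit_disc n))))"

definition CW_complex :: "'a topology \<Rightarrow> bool" where
  "CW_complex X \<longleftrightarrow> Hausdorff_space X \<and> (\<exists>C. CW_structure X C)"


section \<open>Shrinking wedges\<close>

text \<open>The points of the wedge are \<open>None\<close>, the common basepoint, and \<open>Some (j, y)\<close> for a point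
  \<open>y\<close> of the \<open>j\<close>-th summand other than its basepoint.\<close>

definition wedge_in :: "('i \<Rightarrow> 'a) \<Rightarrow> 'i \<Rightarrow> 'a \<Rightarrow> ('i \<times> 'a) option" where
  "wedge_in b j y = (if y = b j then None else Some (j, y))"

definition wedge_summand ::
    "('i \<Rightarrow> 'a topology) \<Rightarrow> ('i \<Rightarrow> 'a) \<Rightarrow> 'i \<Rightarrow> ('i \<times> 'a) option set" where
  "wedge_summand X b j = wedge_in b j ` topspace (X j)"

definition shrinking_wedge ::
    "'i set \<Rightarrow> ('i \<Rightarrow> 'a topology) \<Rightarrow> ('i \<Rightarrow> 'a) \<Rightarrow> ('i \<times> 'a) option topology" where
  "shrinking_wedge J X b = topology (\<lambda>U.
     U \<subseteq> (\<Union>j\<in>J. wedge_summand X b j) \<and>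
     (\<forall>j\<in>J. openin (X j) {y \<in> topspace (X j). wedge_in b j y \<in> U}) \<and>
     (None \<in> U \<longrightarrow> finite {j \<in> J. \<not> wedge_summand X b j \<subseteq> U}))"

lemma openin_shrinking_wedge:
  "openin (shrinking_wedge J X b) U \<longleftrightarrow>
     U \<subseteq> (\<Union>j\<in>J. wedge_summand X b j) \<and>
     (\<forall>j\<in>J. openin (X j) {y \<in> topspace (X j). wedge_in b j y \<in> U}) \<and>
     (None \<in> U \<longrightarrow> finite {j \<in> J. \<not> wedge_summand X b j \<subseteq> U})"
proof -
  let ?P = "\<lambda>U. U \<subseteq> (\<Union>j\<in>J. wedge_summand X b j) \<and>
     (\<forall>j\<in>J. openin (X j) {y \<in> topspace (X j). wedge_in b j y \<in> U}) \<and>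
     (None \<in> U \<longrightarrow> finite {j \<in> J. \<not> wedge_summand X b j \<subseteq> U})"
  have "istopology ?P"
    unfolding istopology_def
  proof (intro conjI allI impI)
    fix S T assume S: "?P S" and T: "?P T"
    have "openin (X j) {y \<in> topspace (X j). wedge_in b j y \<in> S \<inter> T}" if "j \<in> J" for j
    proof -
      have "{y \<in> topspace (X j). wedge_in b j y \<in> S \<inter> T} =
        {y \<in> topspace (X j). wedge_in b j y \<in> S} \<inter> {y \<in> topspace (X j). wedge_in b j y \<in> T}"
        by auto
      then show ?thesis using S T that by auto
    qed
    moreover have "finite {j \<in> J. \<not> wedge_summand X b j \<subseteq> S \<inter> T}" if "None \<in> S \<inter> T"
    proof (rule finite_subset)
      show "{j \<in> J. \<not> wedge_summand X b j \<subseteq> S \<inter> T} \<subseteq>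
        {j \<in> J. \<not> wedge_summand X b j \<subseteq> S} \<union> {j \<in> J. \<not> wedge_summand X b j \<subseteq> T}"
        by auto
      show "finite ({j \<in> J. \<not> wedge_summand X b j \<subseteq> S} \<union> {j \<in> J. \<not> wedge_summand X b j \<subseteq> T})"
        using S T that by auto
    qed
    ultimately show "S \<inter> T \<subseteq> (\<Union>j\<in>J. wedge_summand X b j)"
      "\<forall>j\<in>J. openin (X j) {y \<in> topspace (X j). wedge_in b j y \<in> S \<inter> T}"
      "None \<in> S \<inter> T \<Longrightarrow> finite {j \<in> J. \<not> wedge_summand X b j \<subseteq> S \<inter> T}"
      using S by blast+
  next
    fix \<K> assume K: "\<forall>K\<in>\<K>. ?P K"
    show "\<Union>\<K> \<subseteq> (\<Union>j\<in>J. wedge_summand X b j)" using K by blast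
    show "\<forall>j\<in>J. openin (X j) {y \<in> topspace (X j). wedge_in b j y \<in> \<Union>\<K>}"
    proof
      fix j assume "j \<in> J"
      have "{y \<in> topspace (X j). wedge_in b j y \<in> \<Union>\<K>} =
        (\<Union>K\<in>\<K>. {y \<in> topspace (X j). wedge_in b j y \<in> K})" by auto
      then show "openin (X j) {y \<in> topspace (X j). wedge_in b j y \<in> \<Union>\<K>}"
        using K \<open>j \<in> J\<close> by auto
    qed
    assume "None \<in> \<Union>\<K>"
    then obtain K where "K \<in> \<K>" "None \<in> K" by auto
    then have "finite {j \<in> J. \<not> wedge_summand X b j \<subseteq> K}" using K by auto
    then show "finite {j \<in> J. \<not> wedge_summand X b j \<subseteq> \<Union>\<K>}"
      by (rule rev_finite_subset) (use \<open>K \<in> \<K>\<close> in auto)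
  qed
  then show ?thesis by (simp add: shrinking_wedge_def)
qed


section \<open>Homotopy groups and infinite sums\<close>

definition cube :: "nat \<Rightarrow> (nat \<Rightarrow> real) topology" where
  "cube m = product_topology (\<lambda>_. top_of_set {0..1}) {..<m}"

definition cube_boundary :: "nat \<Rightarrow> (nat \<Rightarrow> real) set" where
  "cube_boundary m = {x \<in> topspace (cube m). \<exists>i<m. x i = 0 \<or> x i = 1}"

text \<open>Values of a map outside the cube are unconstrained; homotopy classes do not see them.\<close>

definition loops :: "nat \<Rightarrow> 'a topology \<Rightarrow> 'a \<Rightarrow> ((nat \<Rightarrow> real) \<Rightarrow> 'a) set" where
  "loops m X x0 = {f. continuous_map (cube m) X f \<and> f ` cube_boundary m \<subseteq> {x0}}"

definition loop_homotopy ::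
    "nat \<Rightarrow> 'a topology \<Rightarrow> 'a \<Rightarrow> (((nat \<Rightarrow> real) \<Rightarrow> 'a) \<times> ((nat \<Rightarrow> real) \<Rightarrow> 'a)) set" where
  "loop_homotopy m X x0 = {(f, g). f \<in> loops m X x0 \<and> g \<in> loops m X x0 \<and>
     homotopic_with (\<lambda>h. h ` cube_boundary m \<subseteq> {x0}) (cube m) X f g}"

definition loop_class ::
    "nat \<Rightarrow> 'a topology \<Rightarrow> 'a \<Rightarrow> ((nat \<Rightarrow> real) \<Rightarrow> 'a) \<Rightarrow> ((nat \<Rightarrow> real) \<Rightarrow> 'a) set" where
  "loop_class m X x0 f = loop_homotopy m X x0 `` {f}"

definition loop_add ::
    "((nat \<Rightarrow> real) \<Rightarrow> 'a) \<Rightarrow> ((nat \<Rightarrow> real) \<Rightarrow> 'a) \<Rightarrow> (nat \<Rightarrow> real) \<Rightarrow> 'a" where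
  "loop_add f g x = (if x 0 \<le> 1/2 then f (x(0 := 2 * x 0)) else g (x(0 := 2 * x 0 - 1)))"

text \<open>The group \<open>\<pi>\<^sub>m(X, x0)\<close>, \<open>m \<ge> 1\<close>, written multiplicatively.  Operations on classes are
  given by the union over all representatives, all of which give the same class.\<close>

definition homotopy_group ::
    "nat \<Rightarrow> 'a topology \<Rightarrow> 'a \<Rightarrow> ((nat \<Rightarrow> real) \<Rightarrow> 'a) set monoid" where
  "homotopy_group m X x0 =
     \<lparr>carrier = loops m X x0 // loop_homotopy m X x0,
      mult = (\<lambda>\<alpha> \<beta>. \<Union>f\<in>\<alpha>. \<Union>g\<in>\<beta>. loop_class m X x0 (loop_add f g)),
      one = loop_class m X x0 (\<lambda>_. x0)\<rparr>"

text \<open>Sequences are indexed by \<open>{1..}\<close>; the value at index \<open>0\<close> is never used.\<close>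

definition null_sequences :: "nat \<Rightarrow> 'a topology \<Rightarrow> 'a \<Rightarrow> (nat \<Rightarrow> (nat \<Rightarrow> real) \<Rightarrow> 'a) set" where
  "null_sequences m X x0 = {f. (\<forall>j\<ge>1. f j \<in> loops m X x0) \<and>
     (\<forall>U. openin X U \<and> x0 \<in> U \<longrightarrow> finite {j. 1 \<le> j \<and> \<not> f j ` topspace (cube m) \<subseteq> U})}"

text \<open>For \<open>x 0 < 1\<close>, the first coordinate lies in the \<open>j\<close>-th interval
  \<open>[(j-1)/j, j/(j+1)]\<close>, of length \<open>1/(j(j+1))\<close>, for the least \<open>j\<close> chosen below.\<close>

definition infinite_sum ::
    "'a \<Rightarrow> (nat \<Rightarrow> (nat \<Rightarrow> real) \<Rightarrow> 'a) \<Rightarrow> (nat \<Rightarrow> real) \<Rightarrow> 'a" where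
  "infinite_sum x0 f x =
     (if x 0 < 1 then
        let j = (LEAST j::nat. 1 \<le> j \<and> x 0 \<le> real j / (real j + 1))
        in f j (x(0 := (x 0 - (real j - 1) / real j) * (real j * (real j + 1))))
      else x0)"

definition closed_under_infinite_sums ::
    "nat \<Rightarrow> 'a topology \<Rightarrow> 'a \<Rightarrow> ((nat \<Rightarrow> real) \<Rightarrow> 'a) set set \<Rightarrow> bool" where
  "closed_under_infinite_sums m X x0 S \<longleftrightarrow>
     (\<forall>f \<in> null_sequences m X x0. (\<forall>j\<ge>1. loop_class m X x0 (f j) \<in> S) \<longrightarrow>
        loop_class m X x0 (infinite_sum x0 f) \<in> S)"

definition cl_Sigma :: "nat \<Rightarrow> 'a topology \<Rightarrow> 'a \<Rightarrow>
    ((nat \<Rightarrow> real) \<Rightarrow> 'a) set set \<Rightarrow> ((nat \<Rightarrow> real) \<Rightarrow> 'a) set set" where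
  "cl_Sigma m X x0 S = \<Inter>{H. subgroup H (homotopy_group m X x0) \<and> S \<subseteq> H \<and>
     closed_under_infinite_sums m X x0 H}"

definition infinite_sum_span :: "nat \<Rightarrow> 'a topology \<Rightarrow> 'a \<Rightarrow>
    ((nat \<Rightarrow> real) \<Rightarrow> 'a) set set \<Rightarrow> ((nat \<Rightarrow> real) \<Rightarrow> 'a) set set" where
  "infinite_sum_span m X x0 S = {loop_class m X x0 (infinite_sum x0 f) | f.
     f \<in> null_sequences m X x0 \<and>
     (\<forall>j\<ge>1. loop_class m X x0 (f j) \<in> generate (homotopy_group m X x0) S)}"


section \<open>Whitehead products\<close>

text \<open>The identification of the sphere \<open>I\<^sup>m/\<partial>I\<^sup>m\<close> with \<open>\<partial>I\<^sup>m\<^sup>+\<^sup>1\<close>, the boundary of the top cell of a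
  product of spheres.  With \<open>u = 2x - 1\<close>, extended by \<open>u m = 0\<close>, and \<open>r\<close> its
  maximum norm, the part \<open>r \<le> 1/2\<close> goes homeomorphically onto the faces through the vertex
  \<open>(1,\<dots>,1)\<close>; the collar \<open>r \<ge> 1/2\<close> goes onto the faces through the origin, with \<open>r = 1\<close>
  (that is, \<open>\<partial>I\<^sup>m\<close>) collapsed to the origin.  At \<open>u = 0\<close> the quotient is \<open>0/0 = 0\<close>.\<close>

definition cube_collapse :: "nat \<Rightarrow> (nat \<Rightarrow> real) \<Rightarrow> (nat \<Rightarrow> real)" where
  "cube_collapse m x =
     (let u = (\<lambda>i. if i < m then 2 * x i - 1 else 0);
          r = Max ((\<lambda>i. \<bar>u i\<bar>) ` {..m});
          M = Max (u ` {..m});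
          L = Min (u ` {..m})
      in (\<lambda>i\<in>{..m}. min 1 (2 - 2 * r) * (1 + min 1 (2 * r) * ((u i - M) / (M - L)))))"

definition cube_fst :: "nat \<Rightarrow> (nat \<Rightarrow> real) \<Rightarrow> (nat \<Rightarrow> real)" where
  "cube_fst p y = (\<lambda>i\<in>{..<p}. y i)"

definition cube_snd :: "nat \<Rightarrow> nat \<Rightarrow> (nat \<Rightarrow> real) \<Rightarrow> (nat \<Rightarrow> real)" where
  "cube_snd p q y = (\<lambda>i\<in>{..<q}. y (p + i))"

text \<open>The characteristic map of the top cell of \<open>S\<^sup>p \<times> S\<^sup>q\<close> is the quotient map
  \<open>I\<^sup>p \<times> I\<^sup>q \<rightarrow> (I\<^sup>p/\<partial>I\<^sup>p) \<times> (I\<^sup>q/\<partial>I\<^sup>q)\<close>.  So \<open>(f \<or> g) \<circ> a\<close> sends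
  a point \<open>(s, t)\<close> of \<open>\<partial>(I\<^sup>p \<times> I\<^sup>q)\<close> to \<open>f s\<close> if \<open>t \<in> \<partial>I\<^sup>q\<close> and to \<open>g t\<close> if \<open>s \<in> \<partial>I\<^sup>p\<close>.\<close>

definition whitehead :: "nat \<Rightarrow> nat \<Rightarrow>
    ((nat \<Rightarrow> real) \<Rightarrow> 'a) \<Rightarrow> ((nat \<Rightarrow> real) \<Rightarrow> 'a) \<Rightarrow> (nat \<Rightarrow> real) \<Rightarrow> 'a" where
  "whitehead p q f g x =
     (let y = cube_collapse (p + q - 1) x
      in if cube_snd p q y \<in> cube_boundary q then f (cube_fst p y) else g (cube_snd p q y))"

definition whitehead_class :: "nat \<Rightarrow> nat \<Rightarrow> 'a topology \<Rightarrow> 'a \<Rightarrow>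
    ((nat \<Rightarrow> real) \<Rightarrow> 'a) set \<Rightarrow> ((nat \<Rightarrow> real) \<Rightarrow> 'a) set \<Rightarrow> ((nat \<Rightarrow> real) \<Rightarrow> 'a) set" where
  "whitehead_class p q X x0 \<alpha> \<beta> =
     (\<Union>f\<in>\<alpha>. \<Union>g\<in>\<beta>. loop_class (p + q - 1) X x0 (whitehead p q f g))"


section \<open>Wedge-disjoint pairs in a shrinking wedge indexed by \<open>{1, 2, 3, \<dots>}\<close>\<close>

definition wedge_disjoint_maps :: "nat \<Rightarrow> (nat \<Rightarrow> 'a topology) \<Rightarrow> (nat \<Rightarrow> 'a) \<Rightarrow>
    ((nat \<Rightarrow> real) \<Rightarrow> (nat \<times> 'a) option) \<Rightarrow> ((nat \<Rightarrow> real) \<Rightarrow> (nat \<times> 'a) option) \<Rightarrow> bool" where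
  "wedge_disjoint_maps n X b f g \<longleftrightarrow>
     f \<in> loops n (shrinking_wedge {1..} X b) None \<and>
     g \<in> loops n (shrinking_wedge {1..} X b) None \<and>
     (\<exists>F G. F \<subseteq> {1..} \<and> G \<subseteq> {1..} \<and> F \<inter> G = {} \<and>
        f ` topspace (cube n) \<subseteq> (\<Union>j\<in>F. wedge_summand X b j) \<and>
        g ` topspace (cube n) \<subseteq> (\<Union>j\<in>G. wedge_summand X b j))"

definition wedge_disjoint :: "nat \<Rightarrow> (nat \<Rightarrow> 'a topology) \<Rightarrow> (nat \<Rightarrow> 'a) \<Rightarrow>
    ((nat \<Rightarrow> real) \<Rightarrow> (nat \<times> 'a) option) set \<Rightarrow>
    ((nat \<Rightarrow> real) \<Rightarrow> (nat \<times> 'a) option) set \<Rightarrow> bool" where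
  "wedge_disjoint n X b \<alpha> \<beta> \<longleftrightarrow>
     (\<exists>f g. wedge_disjoint_maps n X b f g \<and>
        \<alpha> = loop_class n (shrinking_wedge {1..} X b) None f \<and>
        \<beta> = loop_class n (shrinking_wedge {1..} X b) None g)"

definition wedge_disjoint_products :: "nat \<Rightarrow> (nat \<Rightarrow> 'a topology) \<Rightarrow> (nat \<Rightarrow> 'a) \<Rightarrow>
    ((nat \<Rightarrow> real) \<Rightarrow> (nat \<times> 'a) option) set set" where
  "wedge_disjoint_products n X b =
     {whitehead_class n n (shrinking_wedge {1..} X b) None \<alpha> \<beta> | \<alpha> \<beta>.
        \<alpha> \<in> carrier (homotopy_group n (shrinking_wedge {1..} X b) None) \<and>
        \<beta> \<in> carrier (homotopy_group n (shrinking_wedge {1..} X b) None) \<and>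
        wedge_disjoint n X b \<alpha> \<beta>}"

text \<open>\<open>whitehead_span n X b\<close> is the group \<open>\<W>\<^bsub>2n-1\<^esub>\<close> of the shrinking wedge of the \<open>X j\<close>.\<close>

definition whitehead_span :: "nat \<Rightarrow> (nat \<Rightarrow> 'a topology) \<Rightarrow> (nat \<Rightarrow> 'a) \<Rightarrow>
    ((nat \<Rightarrow> real) \<Rightarrow> (nat \<times> 'a) option) set set" where
  "whitehead_span n X b =
     infinite_sum_span (2 * n - 1) (shrinking_wedge {1..} X b) None
       (wedge_disjoint_products n X b)"

end

(* Sums can be infinite in one cube coordinate and in another.  By an infinite version of the
   Eckmann--Hilton argument the two kinds of infinite sum agree up to homotopy, so a double sum over
   a null array may be interchanged, and the span of S is a subgroup.  Cutting an array along its
   diagonal and interchanging one of the halves shows that a double sum of elements of <S> over a null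
   array lies in the span.

   Closure under infinite sums therefore only requires the expansions of the terms f_j to form a
   null array.  A CW-complex has a self-homotopy fixing the basepoint and ending with a map that
   collapses a neighbourhood of it; on the wedge, these homotopies push f_j into tails of the wedge that
   shrink as j grows.  Collapsing the rest of the wedge onto the basepoint then leaves f_j alone,
   preserves wedge-disjoint Whitehead products, and makes the expansion of f_j small. *)

theory Submission
  imports Defs
begin

section \<open>Loops and homotopies on cubes\<close>

text \<open>Homotopies between the j-th terms, one for every \<open>j\<close>, need not add up to a
  homotopy of the infinite sums: their tracks must shrink too. Loops and homotopies are therefore
  placed in \<open>subtopology X (A j)\<close>, with sets \<open>A j\<close> that shrink to the
  basepoint, and the lemmas on sums carry this control.

  The obstacle in the closure statement is that the expansion of \<open>f j\<close> supplied by the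
  span, and the homotopy onto it, may run through large parts of the wedge however small
  \<open>f j\<close> is; nothing ties these choices together for different \<open>j\<close>. A small
  \<open>f j\<close> may still meet every summand, so before the deformation no proper collapse need
  fix it.

  The deformation has to be one continuous map on the product of the interval with the wedge, while
  infinitely many cells may meet at a basepoint. Continuity on such products is tested by compact
  sets of times, as for maps into a path space; only open sets of the complex or of the wedge then
  have to be examined.

  Finite addition is treated as an infinite sum padded with constants, so that even associativity
  comes from the interchange.\<close>

abbreviation unit_interval :: "real topology" where
  "unit_interval \<equiv> top_of_set {0..1}"

abbreviation cylinder :: "'a topology \<Rightarrow> (real \<times> 'a) topology" where
  "cylinder Y \<equiv> prod_topology unit_interval Y"

lemma topspace_cube: "topspace (cube m) = {..<m} \<rightarrow>\<^sub>E {0..1}"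
  by (simp add: cube_def)

lemma continuous_map_into_cube:
  "continuous_map Z (cube m) f \<longleftrightarrow>
     f \<in> topspace Z \<rightarrow> extensional {..<m} \<and> (\<forall>i<m. continuous_map Z unit_interval (\<lambda>z. f z i))"
  by (auto simp: cube_def continuous_map_componentwise)

lemma continuous_map_cube_coordinate:
  "i < m \<Longrightarrow> continuous_map (cube m) unit_interval (\<lambda>x. x i)"
  unfolding cube_def by (rule continuous_map_product_coordinates) simp

lemma cube_boundary_subset: "cube_boundary m \<subseteq> topspace (cube m)"
  by (auto simp: cube_boundary_def)

lemma loop_homotopyI:
  assumes "continuous_map (cylinder (cube m)) Y h"
    and "\<And>x. x \<in> topspace (cube m) \<Longrightarrow> h (0, x) = f x"
    and "\<And>x. x \<in> topspace (cube m) \<Longrightarrow> h (1, x) = g x"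
    and "\<And>t x. t \<in> {0..1} \<Longrightarrow> x \<in> cube_boundary m \<Longrightarrow> h (t, x) = x0"
  shows "(f, g) \<in> loop_homotopy m Y x0"
proof -
  let ?P = "\<lambda>h. h ` cube_boundary m \<subseteq> {x0}"
  \<comment> \<open>\<open>homotopic_with\<close> has its pointwise description only for predicates
    blind to values off the cube.\<close>
  have P: "?P h \<longleftrightarrow> ?P k" if "\<And>x. x \<in> topspace (cube m) \<Longrightarrow> h x = k x" for h k :: "_ \<Rightarrow> 'a"
    using that cube_boundary_subset[of m] by (simp add: image_subset_iff subset_iff)
  have "homotopic_with ?P (cube m) Y f g \<longleftrightarrow>
      (\<exists>h. continuous_map (cylinder (cube m)) Y h \<and>
        (\<forall>x \<in> topspace (cube m). h (0, x) = f x) \<and> (\<forall>x \<in> topspace (cube m). h (1, x) = g x) \<and>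
        (\<forall>t \<in> {0..1}. ?P (\<lambda>x. h (t, x))))"
    by (rule homotopic_with) (rule P)
  moreover have "\<forall>t \<in> {0..1}. ?P (\<lambda>x. h (t, x))"
    using assms(4) by blast
  ultimately have "homotopic_with ?P (cube m) Y f g"
    using assms(1-3) by blast
  then show ?thesis
    using homotopic_with_imp_continuous_maps[of ?P "cube m" Y f g]
      homotopic_with_imp_property[of ?P "cube m" Y f g]
    unfolding loop_homotopy_def loops_def by blast
qed

lemma loop_homotopyE:
  assumes "(f, g) \<in> loop_homotopy m Y x0"
  obtains h where "continuous_map (cylinder (cube m)) Y h"
    "\<And>x. h (0, x) = f x" "\<And>x. h (1, x) = g x"
    "\<And>t x. t \<in> {0..1} \<Longrightarrow> x \<in> cube_boundary m \<Longrightarrow> h (t, x) = x0"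
  using assms by (fastforce simp: loop_homotopy_def homotopic_with_def image_subset_iff)

lemma loop_homotopy_imp_loops:
  "(f, g) \<in> loop_homotopy m Y x0 \<Longrightarrow> f \<in> loops m Y x0 \<and> g \<in> loops m Y x0"
  by (simp add: loop_homotopy_def)

lemma loop_homotopy_eq_on_cube:
  assumes "f \<in> loops m Y x0" "\<And>x. x \<in> topspace (cube m) \<Longrightarrow> f x = g x"
  shows "(f, g) \<in> loop_homotopy m Y x0"
proof (rule loop_homotopyI[where h = "f \<circ> snd"])
  show "continuous_map (cylinder (cube m)) Y (f \<circ> snd)"
    using assms(1) by (auto simp: loops_def continuous_map_of_snd)
qed (use assms in \<open>auto simp: loops_def\<close>)

lemma loop_homotopy_refl: "f \<in> loops m Y x0 \<Longrightarrow> (f, f) \<in> loop_homotopy m Y x0"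
  by (rule loop_homotopy_eq_on_cube) auto

lemma loop_homotopy_sym:
  "(f, g) \<in> loop_homotopy m Y x0 \<Longrightarrow> (g, f) \<in> loop_homotopy m Y x0"
  by (auto simp: loop_homotopy_def intro: homotopic_with_symD)

lemma loop_homotopy_trans [trans]:
  "(f, g) \<in> loop_homotopy m Y x0 \<Longrightarrow> (g, h) \<in> loop_homotopy m Y x0 \<Longrightarrow>
    (f, h) \<in> loop_homotopy m Y x0"
  by (auto simp: loop_homotopy_def intro: homotopic_with_trans)

lemma equiv_loop_homotopy: "equiv (loops m Y x0) (loop_homotopy m Y x0)"
  by (rule equivI)
    (auto simp: refl_on_def intro: symI transI loop_homotopy_refl loop_homotopy_sym
      loop_homotopy_trans dest: loop_homotopy_imp_loops)

text \<open>Loops and homotopies in a subtopology carry a bound on where they run; here that bound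
  is weakened.\<close>

lemma loop_homotopy_mono:
  assumes "(f, g) \<in> loop_homotopy m (subtopology X A) x0" "A \<subseteq> B"
  shows "(f, g) \<in> loop_homotopy m (subtopology X B) x0"
proof -
  obtain h where h: "continuous_map (cylinder (cube m)) (subtopology X A) h"
    "\<And>x. h (0, x) = f x" "\<And>x. h (1, x) = g x"
    "\<And>t x. t \<in> {0..1} \<Longrightarrow> x \<in> cube_boundary m \<Longrightarrow> h (t, x) = x0"
    using loop_homotopyE[OF assms(1)] by metis
  have "continuous_map (cylinder (cube m)) (subtopology X B) h"
    using h(1) assms(2) unfolding continuous_map_in_subtopology by blast
  then show ?thesis
    using h(2-4) by (rule loop_homotopyI)
qed

lemma loop_homotopy_full:
  "(f, g) \<in> loop_homotopy m (subtopology X A) x0 \<Longrightarrow> (f, g) \<in> loop_homotopy m X x0"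
  by (drule loop_homotopy_mono[OF _ subset_UNIV]) simp

text \<open>Taking both maps equal turns each closure property of \<open>loop_homotopy\<close> into
  one of \<open>loops\<close>.\<close>

lemma loops_iff_homotopy: "f \<in> loops m Y x0 \<longleftrightarrow> (f, f) \<in> loop_homotopy m Y x0"
  by (metis loop_homotopy_refl loop_homotopy_imp_loops)

lemma loops_mono:
  "f \<in> loops m (subtopology X A) x0 \<Longrightarrow> A \<subseteq> B \<Longrightarrow> f \<in> loops m (subtopology X B) x0"
  unfolding loops_iff_homotopy by (rule loop_homotopy_mono)

lemma loops_full: "f \<in> loops m (subtopology X A) x0 \<Longrightarrow> f \<in> loops m X x0"
  unfolding loops_iff_homotopy by (rule loop_homotopy_full)

lemma loops_subtopology:
  "f \<in> loops m (subtopology X A) x0 \<longleftrightarrow> f \<in> loops m X x0 \<and> f ` topspace (cube m) \<subseteq> A"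
  by (auto simp: loops_def continuous_map_in_subtopology)

lemma loops_value_boundary: "f \<in> loops m Y x0 \<Longrightarrow> x \<in> cube_boundary m \<Longrightarrow> f x = x0"
  by (auto simp: loops_def)

lemma loop_homotopy_postcompose:
  assumes "(f, g) \<in> loop_homotopy m Y y0" "continuous_map Y Z r" "r y0 = z0"
  shows "(\<lambda>x. r (f x), \<lambda>x. r (g x)) \<in> loop_homotopy m Z z0"
proof -
  obtain h where h: "continuous_map (cylinder (cube m)) Y h"
    "\<And>x. h (0, x) = f x" "\<And>x. h (1, x) = g x"
    "\<And>t x. t \<in> {0..1} \<Longrightarrow> x \<in> cube_boundary m \<Longrightarrow> h (t, x) = y0"
    using loop_homotopyE[OF assms(1)] by metis
  show ?thesis
    by (rule loop_homotopyI[where h = "r \<circ> h"])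
      (use h assms continuous_map_compose in auto)
qed

lemma loops_postcompose:
  "f \<in> loops m Y y0 \<Longrightarrow> continuous_map Y Z r \<Longrightarrow> r y0 = z0 \<Longrightarrow> (\<lambda>x. r (f x)) \<in> loops m Z z0"
  unfolding loops_iff_homotopy by (rule loop_homotopy_postcompose)

lemma loop_homotopy_precompose:
  assumes "(f, g) \<in> loop_homotopy m Y y0" "continuous_map (cube k) (cube m) a"
    "\<And>x. x \<in> cube_boundary k \<Longrightarrow> a x \<in> cube_boundary m"
  shows "(\<lambda>x. f (a x), \<lambda>x. g (a x)) \<in> loop_homotopy k Y y0"
proof -
  obtain h where h: "continuous_map (cylinder (cube m)) Y h"
    "\<And>x. h (0, x) = f x" "\<And>x. h (1, x) = g x"
    "\<And>t x. t \<in> {0..1} \<Longrightarrow> x \<in> cube_boundary m \<Longrightarrow> h (t, x) = y0"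
    using loop_homotopyE[OF assms(1)] by metis
  have "continuous_map (cylinder (cube k)) (cylinder (cube m))
      (\<lambda>(t, x). (t, a x))"
    using assms(2) by (subst continuous_map_prod_top) (auto simp: continuous_map_id[unfolded id_def])
  from continuous_map_compose[OF this h(1)] show ?thesis
    by (rule loop_homotopyI) (use h assms in auto)
qed

section \<open>The infinitely many intervals of a sum, and pasting over them\<close>

lemma infinite_sum_index:
  assumes "u < 1"
  obtains j :: nat where "1 \<le> j" "u \<le> real j / (real j + 1)"
    "\<And>N. 1 \<le> N \<Longrightarrow> u \<le> real N / (real N + 1) \<Longrightarrow> j \<le> N"
    "j = (LEAST j::nat. 1 \<le> j \<and> u \<le> real j / (real j + 1))"
proof -
  obtain k :: nat where "real k > 1 / (1 - u)"
    using reals_Archimedean2 by blast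
  then have k: "real k * (1 - u) > 1"
    using assms by (simp add: field_simps)
  then have "real k / (real k + 1) \<ge> u"
    using assms by (simp add: field_simps)
  moreover have "k \<ge> 1"
    using k by (cases k) auto
  ultimately have ex: "1 \<le> k \<and> u \<le> real k / (real k + 1)" by auto
  let ?Q = "\<lambda>j. 1 \<le> j \<and> u \<le> real j / (real j + 1)"
  have "?Q (LEAST j. ?Q j)" by (rule LeastI[of ?Q, OF ex])
  moreover have "(LEAST j. ?Q j) \<le> N" if "?Q N" for N by (rule Least_le[of ?Q, OF that])
  ultimately show ?thesis using that by blast
qed

text \<open>Minimality excludes \<open>j - 1\<close>, whose interval ends where the
  \<open>j\<close>-th one begins; for \<open>j = 1\<close> the lower bound is
  \<open>0 \<le> u\<close>.\<close>

lemma infinite_sum_piece: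
  assumes "u < 1" "0 \<le> u"
  obtains j :: nat where "1 \<le> j" "(real j - 1) / real j \<le> u" "u \<le> real j / (real j + 1)"
    "\<And>N. 1 \<le> N \<Longrightarrow> u \<le> real N / (real N + 1) \<Longrightarrow> j \<le> N"
proof -
  obtain j :: nat where j: "1 \<le> j" "u \<le> real j / (real j + 1)"
    "\<And>N. 1 \<le> N \<Longrightarrow> u \<le> real N / (real N + 1) \<Longrightarrow> j \<le> N"
    using infinite_sum_index[OF assms(1)] by metis
  have "(real j - 1) / real j \<le> u"
    using j(3)[of "j - 1"] j(1,2) assms(2) by (cases "j = 1") (force simp: of_nat_diff)+
  with j that show ?thesis by blast
qed

lemma infinite_sum_cong:
  assumes "\<And>j. 1 \<le> j \<Longrightarrow> f j = g j"
  shows "infinite_sum x0 f = infinite_sum x0 g"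
proof
  fix x :: "nat \<Rightarrow> real"
  show "infinite_sum x0 f x = infinite_sum x0 g x"
  proof (cases "x 0 < 1")
    case True
    then have "1 \<le> (LEAST j::nat. 1 \<le> j \<and> x 0 \<le> real j / (real j + 1))"
      using infinite_sum_index[of "x 0"] by metis
    then show ?thesis using assms by (simp add: infinite_sum_def Let_def)
  qed (simp add: infinite_sum_def)
qed

text \<open>Every topology on the parameter space is allowed so that the same lemma serves for sums of
  loops and for sums of homotopies.\<close>

lemma continuous_map_infinite_pieces:
  fixes Z :: "'z topology" and u :: "'z \<Rightarrow> real" and F :: "'z \<Rightarrow> 'y"
  defines "P \<equiv> \<lambda>j. {z \<in> topspace Z. (real j - 1) / real j \<le> u z \<and> u z \<le> real j / (real j + 1)}"
  assumes u: "continuous_map Z unit_interval u"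
    and F: "\<And>j. j \<ge> 1 \<Longrightarrow> continuous_map (subtopology Z (P j)) Y F"
    and final: "\<And>z. z \<in> topspace Z \<Longrightarrow> u z = 1 \<Longrightarrow> F z = y0"
    and y0: "y0 \<in> topspace Y"
    and null: "\<And>U. openin Y U \<Longrightarrow> y0 \<in> U \<Longrightarrow> finite {j. 1 \<le> j \<and> \<not> F ` P j \<subseteq> U}"
  shows "continuous_map Z Y F"
proof -
  have u': "continuous_map Z euclideanreal u"
    using u continuous_map_into_fulltopology by blast
  have cl: "closedin Z (P j)" for j
  proof -
    have "closedin Z {z \<in> topspace Z. u z \<in> {(real j - 1) / real j..real j / (real j + 1)}}"
      by (rule closedin_continuous_map_preimage[OF u']) auto
    then show ?thesis by (simp add: P_def)
  qed
  have cover: "\<exists>j\<ge>1. z \<in> P j \<and> (\<forall>N\<ge>1. u z \<le> real N / (real N + 1) \<longrightarrow> j \<le> N)"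
    if z: "z \<in> topspace Z" "u z < 1" for z
  proof -
    have "0 \<le> u z"
      using continuous_map_image_subset_topspace[OF u] z by auto
    then show ?thesis
      using infinite_sum_piece[OF z(2)] z(1) unfolding P_def by (metis (mono_tags, lifting) mem_Collect_eq)
  qed
  \<comment> \<open>Away from \<open>u = 1\<close> only finitely many closed pieces matter, so
    closed pasting applies.\<close>
  have contN: "continuous_map (subtopology Z {z \<in> topspace Z. u z \<le> real N / (real N + 1)}) Y F"
    if "N \<ge> 1" for N :: nat
  proof (rule pasting_lemma_closed[where I = "{1..N}" and T = P and f = "\<lambda>_. F"])
    let ?S = "{z \<in> topspace Z. u z \<le> real N / (real N + 1)}"
    have sub: "P i \<subseteq> ?S" if "i \<in> {1..N}" for i
    proof -
      have "real i / (real i + 1) \<le> real N / (real N + 1)"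
        using that by (simp add: field_simps)
      then show ?thesis by (auto simp: P_def)
    qed
    show "closedin (subtopology Z ?S) (P i)" if "i \<in> {1..N}" for i
      using cl[of i] sub[OF that] by (simp add: closedin_subset_topspace)
    show "continuous_map (subtopology (subtopology Z ?S) (P i)) Y F" if "i \<in> {1..N}" for i
      using F[of i] sub[OF that] that by (simp add: subtopology_subtopology inf.absorb2)
    show "\<exists>j. j \<in> {1..N} \<and> x \<in> P j \<and> F x = F x" if x: "x \<in> topspace (subtopology Z ?S)" for x
    proof -
      have x: "x \<in> topspace Z" "u x \<le> real N / (real N + 1)" using x by auto
      moreover have "real N / (real N + 1) < 1" by (simp add: field_simps)
      ultimately show ?thesis using cover[of x] \<open>N \<ge> 1\<close> by fastforce
    qed
  qed auto
  have FY: "F z \<in> topspace Y" if z: "z \<in> topspace Z" for z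
  proof (cases "u z < 1")
    case True
    then obtain j where "j \<ge> 1" "z \<in> P j" using cover z by blast
    then show ?thesis
      using continuous_map_image_subset_topspace[OF F[of j]] z by auto
  next
    case False
    then have "u z = 1" using continuous_map_image_subset_topspace[OF u] z by fastforce
    then show ?thesis using final y0 z by simp
  qed
  show ?thesis
    unfolding continuous_map
  proof (intro conjI allI impI)
    show "F ` topspace Z \<subseteq> topspace Y" using FY by auto
    fix U assume U: "openin Y U"
    have "\<exists>T. openin Z T \<and> z \<in> T \<and> T \<subseteq> {x \<in> topspace Z. F x \<in> U}"
      if z: "z \<in> topspace Z" "F z \<in> U" for z
    proof (cases "u z < 1")
      case True
      then obtain j where j: "j \<ge> 1" "z \<in> P j" using cover z by blast
      \<comment> \<open>One index further, so that \<open>u z\<close> lies strictly below the right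
        end and \<open>contN\<close> covers a whole neighbourhood of \<open>z\<close>.\<close>
      define N where "N = j + 1"
      have "real j / (real j + 1) < real N / (real N + 1)"
        by (simp add: N_def field_simps)
      then have uz: "u z < real N / (real N + 1)" using j by (auto simp: P_def)
      let ?S = "{z \<in> topspace Z. u z \<le> real N / (real N + 1)}"
      have "openin (subtopology Z ?S) {x \<in> topspace (subtopology Z ?S). F x \<in> U}"
        using contN[of N] U by (intro openin_continuous_map_preimage) (auto simp: N_def)
      then obtain T where T: "openin Z T" "{x \<in> topspace (subtopology Z ?S). F x \<in> U} = T \<inter> ?S"
        by (auto simp: openin_subtopology)
      have "openin Z {x \<in> topspace Z. u x \<in> {..<real N / (real N + 1)}}"
        by (rule openin_continuous_map_preimage[OF u']) auto
      then have "openin Z (T \<inter> {x \<in> topspace Z. u x \<in> {..<real N / (real N + 1)}})"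
        using T(1) by blast
      moreover have "z \<in> T" using T(2) z uz by fastforce
      moreover have "T \<inter> {x \<in> topspace Z. u x \<in> {..<real N / (real N + 1)}} \<subseteq>
          {x \<in> topspace Z. F x \<in> U}"
        using T(2) by fastforce
      ultimately show ?thesis using z uz by blast
    next
      case False
      then have uz: "u z = 1" using continuous_map_image_subset_topspace[OF u] z by fastforce
      then have "y0 \<in> U" using final z by simp
      \<comment> \<open>Infinitely many pieces may accumulate at a point with \<open>u = 1\<close>;
        continuity there rests on the null condition.\<close>
      then have "finite {j. 1 \<le> j \<and> \<not> F ` P j \<subseteq> U}" using null U by blast
      then obtain N where N: "\<And>j. 1 \<le> j \<Longrightarrow> \<not> F ` P j \<subseteq> U \<Longrightarrow> j \<le> N"
        unfolding finite_nat_set_iff_bounded_le by blast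
      let ?T = "{x \<in> topspace Z. u x \<in> {real N / (real N + 1)<..}}"
      have "openin Z ?T"
        by (rule openin_continuous_map_preimage[OF u']) auto
      moreover have "z \<in> ?T" using uz z by (simp add: field_simps)
      moreover have "F x \<in> U" if x: "x \<in> topspace Z" "u x > real N / (real N + 1)" for x
      proof (cases "u x < 1")
        case True
        then obtain j where j: "j \<ge> 1" "x \<in> P j" using cover x by blast
        then have "real N / (real N + 1) < real j / (real j + 1)"
          using x by (auto simp: P_def)
        then have "N < j" by (simp add: field_simps)
        then show ?thesis using N[of j] j by (metis image_subset_iff not_le)
      next
        case False
        then have "u x = 1" using continuous_map_image_subset_topspace[OF u] x by fastforce
        then show ?thesis using final x \<open>y0 \<in> U\<close> by simp
      qed
      ultimately show ?thesis by blast
    qed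
    then show "openin Z {x \<in> topspace Z. F x \<in> U}"
      by (subst openin_subopen) blast
  qed
qed

section \<open>Changing one coordinate of the cube\<close>

lemma continuous_map_cube_update:
  assumes "continuous_map Z (cube m) c" "continuous_map Z unit_interval s" "i < m"
  shows "continuous_map Z (cube m) (\<lambda>z. (c z)(i := s z))"
proof -
  have "continuous_map Z unit_interval (\<lambda>z. ((c z)(i := s z)) k)" if "k < m" for k
    using assms that by (cases "k = i") (auto simp: continuous_map_into_cube)
  then show ?thesis
    using assms by (auto simp: continuous_map_into_cube extensional_def Pi_iff)
qed

lemma cube_update: "x \<in> topspace (cube m) \<Longrightarrow> s \<in> {0..1} \<Longrightarrow> i < m \<Longrightarrow> x(i := s) \<in> topspace (cube m)"
  unfolding topspace_cube by (auto simp: PiE_iff extensional_def)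

lemma cube_boundary_update:
  "x \<in> topspace (cube m) \<Longrightarrow> s \<in> {0, 1} \<Longrightarrow> i < m \<Longrightarrow> x(i := s) \<in> cube_boundary m"
  unfolding cube_boundary_def using cube_update[of x m s i] by (auto intro: exI[of _ i])

lemma cube_boundary_update_other:
  assumes "x \<in> cube_boundary m" "s \<in> {0..1}" "i < m" "x i \<in> {0, 1} \<Longrightarrow> s \<in> {0, 1}"
  shows "x(i := s) \<in> cube_boundary m"
proof -
  obtain k where k: "k < m" "x k \<in> {0, 1}" and x: "x \<in> topspace (cube m)"
    using assms(1) unfolding cube_boundary_def by blast
  have "(x(i := s)) k \<in> {0, 1}"
    using k assms(4) by auto
  then show ?thesis
    using cube_update[OF x assms(2,3)] k(1) unfolding cube_boundary_def by blast
qed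

lemma cube_coordinate: "x \<in> topspace (cube m) \<Longrightarrow> i < m \<Longrightarrow> 0 \<le> x i \<and> x i \<le> 1"
  using PiE_mem[of x "{..<m}" "\<lambda>_. {0..1}" i] by (simp add: topspace_cube)

text \<open>The straight-line homotopy from \<open>a\<close> to \<open>c\<close> stays in
  \<open>{0..1}\<close> by convexity. As \<open>a\<close> and \<open>c\<close> agree at the ends,
  with values \<open>0\<close> or \<open>1\<close> there, it keeps the boundary of the cube inside
  the boundary.\<close>

lemma loop_homotopy_reparametrize:
  assumes f: "f \<in> loops m Y x0" and m: "m \<ge> 1"
    and a: "continuous_on {0..1} a" "a ` {0..1} \<subseteq> {0..1::real}"
    and c: "continuous_on {0..1} c" "c ` {0..1} \<subseteq> {0..1::real}"
    and ends: "a 0 = c 0" "a 1 = c 1" "c 0 \<in> {0, 1}" "c 1 \<in> {0, 1}"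
  shows "(\<lambda>x. f (x(0 := a (x 0))), \<lambda>x. f (x(0 := c (x 0)))) \<in> loop_homotopy m Y x0"
proof -
  let ?s = "\<lambda>(t, x). (1 - t) * a (x 0) + t * c (x 0)"
  let ?Z = "cylinder (cube m)"
  have bnd: "(1 - t) * a u + t * c u \<in> {0..1}" if "t \<in> {0..1}" "u \<in> {0..1}" for t u
  proof -
    have "a u \<in> {0..1}" "c u \<in> {0..1}" using a(2) c(2) that by blast+
    moreover have "convex {0..1::real}" by simp
    ultimately show ?thesis
      using that convexD_alt[of "{0..1::real}" "a u" "c u" t] by auto
  qed
  have co: "continuous_map ?Z unit_interval (\<lambda>z. snd z 0)"
    using continuous_map_compose[OF continuous_map_snd continuous_map_cube_coordinate[of 0 m]] m
    by (simp add: o_def)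
  have ca: "continuous_map ?Z euclideanreal (\<lambda>z. d (snd z 0))" if "continuous_on {0..1} d" for d
    using continuous_map_compose[OF co, of euclideanreal d] that by (simp add: o_def)
  have t: "continuous_map ?Z euclideanreal fst"
    using continuous_map_fst continuous_map_into_fulltopology by blast
  have "continuous_map ?Z unit_interval ?s"
    unfolding continuous_map_in_subtopology case_prod_unfold
  proof
    show "continuous_map ?Z euclideanreal (\<lambda>z. (1 - fst z) * a (snd z 0) + fst z * c (snd z 0))"
      by (intro continuous_intros ca a c t) simp
    show "(\<lambda>z. (1 - fst z) * a (snd z 0) + fst z * c (snd z 0)) \<in> topspace ?Z \<rightarrow> {0..1}"
      using bnd cube_coordinate[of _ m 0] m by fastforce
  qed
  from continuous_map_cube_update[OF continuous_map_snd this, of 0] m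
  have "continuous_map ?Z (cube m) (\<lambda>z. (snd z)(0 := ?s z))" by auto
  from continuous_map_compose[OF this, of Y f] f
  have "continuous_map ?Z Y (\<lambda>z. f ((snd z)(0 := ?s z)))" by (simp add: loops_def o_def)
  then show ?thesis
  proof (rule loop_homotopyI)
    fix t :: real and x assume t: "t \<in> {0..1}" and x: "x \<in> cube_boundary m"
    have x0: "x 0 \<in> {0..1}"
      using x m cube_boundary_subset[of m] cube_coordinate[of x m 0] by auto
    have "x(0 := ?s (t, x)) \<in> cube_boundary m"
    proof (rule cube_boundary_update_other[OF x])
      show "?s (t, x) \<in> {0..1}" using bnd[OF t x0] by simp
      assume "x 0 \<in> {0, 1}"
      then have "?s (t, x) = c (x 0)" "c (x 0) \<in> {0, 1}"
        using ends by (auto simp: algebra_simps)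
      then show "?s (t, x) \<in> {0, 1}" by simp
    qed (use m in auto)
    then show "f ((snd (t, x))(0 := ?s (t, x))) = x0"
      using loops_value_boundary[OF f] by simp
  qed auto
qed

lemma loops_reparametrize:
  assumes "f \<in> loops m Y x0" "m \<ge> 1"
    and "continuous_on {0..1} a" "a ` {0..1} \<subseteq> {0..1::real}" "a 0 \<in> {0, 1}" "a 1 \<in> {0, 1}"
  shows "(\<lambda>x. f (x(0 := a (x 0)))) \<in> loops m Y x0"
  using loop_homotopy_reparametrize[OF assms(1-4) assms(3,4)] assms(5,6)
  by (simp add: loops_iff_homotopy)


section \<open>Infinite sums\<close>

text \<open>The null condition is put on sets rather than on maps, so that it can bound the tracks
  of homotopies as well as the images of loops.\<close>

definition shrinking_sets :: "'a topology \<Rightarrow> 'a \<Rightarrow> (nat \<Rightarrow> 'a set) \<Rightarrow> bool" where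
  "shrinking_sets X x0 A \<longleftrightarrow> (\<forall>U. openin X U \<and> x0 \<in> U \<longrightarrow> finite {j. 1 \<le> j \<and> \<not> A j \<subseteq> U})"

lemma unit_parameter: "(r / (r + 1) - (r - 1) / r) * (r * (r + 1)) = 1" if "r > 0" for r :: real
proof -
  have "r / (r + 1) * (r * (r + 1)) = r * r" "(r - 1) / r * (r * (r + 1)) = (r - 1) * (r + 1)"
    using that by simp_all
  then show ?thesis by (simp add: left_diff_distrib algebra_simps)
qed

text \<open>At a common end of two intervals \<open>LEAST\<close> selects the earlier one. Both
  formulas give \<open>x0\<close> there, so any closed interval containing \<open>x 0\<close> may be
  used.\<close>

lemma infinite_sum_eq:
  assumes j: "1 \<le> j" "(real j - 1) / real j \<le> x 0" "x 0 \<le> real j / (real j + 1)"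
    and ends: "f j (x(0 := 0)) = x0" "\<And>i. 1 \<le> i \<Longrightarrow> f i (x(0 := 1)) = x0"
  shows "infinite_sum x0 f x =
    f j (x(0 := (x 0 - (real j - 1) / real j) * (real j * (real j + 1))))"
proof -
  let ?Q = "\<lambda>j. 1 \<le> j \<and> x 0 \<le> real j / (real j + 1)"
  have "real j / (real j + 1) < 1" by simp
  then have lt: "x 0 < 1" using j by linarith
  \<comment> \<open>Every admissible index is at least \<open>j - 1\<close>, so the least one is
    \<open>j\<close> or \<open>j - 1\<close>.\<close>
  have le: "j - 1 \<le> k" if "?Q k" for k
  proof -
    have "(real j - 1) / real j \<le> real k / (real k + 1)" using that j by linarith
    then have "(real j - 1) * (real k + 1) \<le> real k * real j"
      using j by (simp add: divide_simps)
    then show ?thesis by (simp add: algebra_simps)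
  qed
  define l where "l = (LEAST j. ?Q j)"
  have l: "?Q l" unfolding l_def by (rule LeastI[of ?Q j]) (use j in auto)
  have "l \<le> j" unfolding l_def by (rule Least_le) (use j in auto)
  have sum: "infinite_sum x0 f x =
    f l (x(0 := (x 0 - (real l - 1) / real l) * (real l * (real l + 1))))"
    using lt by (simp add: infinite_sum_def Let_def l_def)
  show ?thesis
  proof (cases "l = j")
    case False
    then have lj: "j = l + 1" using le[OF l] \<open>l \<le> j\<close> by auto
    then have u: "x 0 = real l / (real l + 1)"
      using j(2) l by (simp add: add.commute)
    have "(x 0 - (real l - 1) / real l) * (real l * (real l + 1)) = 1"
      using l unit_parameter[of "real l"] unfolding u by simp
    moreover have "(x 0 - (real j - 1) / real j) * (real j * (real j + 1)) = 0"
      unfolding u lj by simp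
    ultimately show ?thesis
      using sum ends l by (simp only:)
  qed (use sum in simp)
qed

lemma infinite_sum_end: "x 0 \<ge> 1 \<Longrightarrow> infinite_sum x0 f x = x0"
  by (simp add: infinite_sum_def)

lemma infinite_sum_parameter:
  assumes "(real j - 1) / real j \<le> u" "u \<le> real j / (real j + 1)" "1 \<le> j"
  shows "(u - (real j - 1) / real j) * (real j * (real j + 1)) \<in> {0..1}"
proof -
  have "(u - (real j - 1) / real j) * (real j * (real j + 1)) \<le>
      (real j / (real j + 1) - (real j - 1) / real j) * (real j * (real j + 1))"
    using assms by (intro mult_right_mono) auto
  also have "\<dots> = 1"
    using assms(3) by (intro unit_parameter) simp
  finally show ?thesis using assms by auto
qed

text \<open>The homotopies are summed at each time separately. The critical points are those with
  first coordinate \<open>1\<close>, where the tracks and not only the two end maps have to shrink;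
  the sets \<open>A j\<close> guarantee this.\<close>

lemma loop_homotopy_infinite_sum:
  assumes m: "m \<ge> 1" and x0: "x0 \<in> topspace X" "x0 \<in> B"
    and hom: "\<And>j. 1 \<le> j \<Longrightarrow> (f j, g j) \<in> loop_homotopy m (subtopology X (A j)) x0"
    and null: "shrinking_sets X x0 A" and AB: "\<And>j. 1 \<le> j \<Longrightarrow> A j \<subseteq> B"
  shows "(infinite_sum x0 f, infinite_sum x0 g) \<in> loop_homotopy m (subtopology X B) x0"
proof -
  let ?Z = "cylinder (cube m)"
  have "\<exists>h. continuous_map ?Z (subtopology X (A j)) h \<and> (\<forall>x. h (0, x) = f j x) \<and>
    (\<forall>x. h (1, x) = g j x) \<and> (\<forall>t \<in> {0..1}. \<forall>x \<in> cube_boundary m. h (t, x) = x0)" if "1 \<le> j" for j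
    using loop_homotopyE[OF hom[OF that]] by metis
  then obtain h where h: "\<And>j. 1 \<le> j \<Longrightarrow> continuous_map ?Z (subtopology X (A j)) (h j)"
    "\<And>j x. 1 \<le> j \<Longrightarrow> h j (0, x) = f j x" "\<And>j x. 1 \<le> j \<Longrightarrow> h j (1, x) = g j x"
    "\<And>j t x. 1 \<le> j \<Longrightarrow> t \<in> {0..1} \<Longrightarrow> x \<in> cube_boundary m \<Longrightarrow> h j (t, x) = x0"
    by metis
  define a where "a = (\<lambda>j u. (u - (real j - 1) / real j) * (real j * (real j + 1)))"
  define H where "H = (\<lambda>(t, x). infinite_sum x0 (\<lambda>j y. h j (t, y)) x)"
  define P where "P = (\<lambda>j. {z \<in> topspace ?Z. (real j - 1) / real j \<le> snd z 0 \<and>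
      snd z 0 \<le> real j / (real j + 1)})"
  have a01: "a j (snd z 0) \<in> {0..1}" if "z \<in> P j" "1 \<le> j" for j z
    using infinite_sum_parameter[of j "snd z 0"] that by (auto simp: P_def a_def)
  have HP: "H z = h j (fst z, (snd z)(0 := a j (snd z 0)))" if "z \<in> P j" "1 \<le> j" for j z
    unfolding H_def case_prod_unfold a_def
    by (rule infinite_sum_eq) (use that h(4) m in \<open>auto simp: P_def intro!: h(4) cube_boundary_update\<close>)
  have u: "continuous_map ?Z unit_interval (\<lambda>z. snd z 0)"
    using continuous_map_compose[OF continuous_map_snd continuous_map_cube_coordinate[of 0 m]] m
    by (simp add: o_def)
  then have u': "continuous_map ?Z euclideanreal (\<lambda>z. snd z 0)"
    using continuous_map_into_fulltopology by blast
  have zP: "(fst z, (snd z)(0 := a j (snd z 0))) \<in> topspace ?Z" if "z \<in> P j" "1 \<le> j" for j z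
    using a01[OF that] cube_update[of "snd z" m "a j (snd z 0)" 0] that m by (auto simp: P_def)
  have HA: "H z \<in> A j" if "z \<in> P j" "1 \<le> j" for j z
    using continuous_map_image_subset_topspace[OF h(1)[OF that(2)]] zP[OF that] HP[OF that] by auto
  have cont: "continuous_map ?Z (subtopology X B) H"
  proof (rule continuous_map_infinite_pieces[where u = "\<lambda>z. snd z 0" and ?y0.0 = x0])
    fix j :: nat assume j: "1 \<le> j"
    have "continuous_map (subtopology ?Z (P j)) unit_interval (\<lambda>z. a j (snd z 0))"
      unfolding continuous_map_in_subtopology a_def
    proof (intro conjI continuous_map_real_mult_right continuous_map_diff
        continuous_map_from_subtopology[OF u'])
      show "(\<lambda>z. (snd z 0 - (real j - 1) / real j) * (real j * (real j + 1)))
        \<in> topspace (subtopology ?Z (P j)) \<rightarrow> {0..1}"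
        using a01[OF _ j] by (auto simp: a_def)
    qed simp
    then have "continuous_map (subtopology ?Z (P j)) ?Z (\<lambda>z. (fst z, (snd z)(0 := a j (snd z 0))))"
      using m by (intro continuous_map_pairedI continuous_map_cube_update
        continuous_map_from_subtopology[OF continuous_map_fst]
        continuous_map_from_subtopology[OF continuous_map_snd]) auto
    from continuous_map_compose[OF this h(1)[OF j]]
    have "continuous_map (subtopology ?Z (P j)) X H"
      by (rule continuous_map_eq[OF continuous_map_into_fulltopology]) (use HP j in auto)
    moreover have "H \<in> topspace (subtopology ?Z (P j)) \<rightarrow> B"
      using HA[OF _ j] AB[OF j] by auto
    ultimately show "continuous_map (subtopology ?Z {z \<in> topspace ?Z. (real j - 1) / real j \<le> snd z 0
       \<and> snd z 0 \<le> real j / (real j + 1)}) (subtopology X B) H"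
      unfolding P_def continuous_map_in_subtopology by blast
  next
    fix U assume U: "openin (subtopology X B) U" "x0 \<in> U"
    then obtain V where V: "openin X V" "U = V \<inter> B" by (auto simp: openin_subtopology)
    have "{j. 1 \<le> j \<and> \<not> H ` P j \<subseteq> U} \<subseteq> {j. 1 \<le> j \<and> \<not> A j \<subseteq> V}"
      using HA AB unfolding V(2) by fastforce
    then show "finite {j. 1 \<le> j \<and> \<not> H ` {z \<in> topspace ?Z. (real j - 1) / real j \<le> snd z 0
       \<and> snd z 0 \<le> real j / (real j + 1)} \<subseteq> U}"
      using null V U unfolding P_def shrinking_sets_def by (blast intro: finite_subset)
  qed (use u x0 in \<open>auto simp: H_def infinite_sum_end\<close>)
  from cont show ?thesis
  proof (rule loop_homotopyI)
    fix t :: real and x assume t: "t \<in> {0..1}" and x: "x \<in> cube_boundary m"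
    have xc: "x \<in> topspace (cube m)" using x cube_boundary_subset by blast
    show "H (t, x) = x0"
    proof (cases "x 0 < 1")
      case True
      moreover have "0 \<le> x 0" using cube_coordinate[OF xc, of 0] m by simp
      ultimately obtain j :: nat
        where j: "1 \<le> j" "(real j - 1) / real j \<le> x 0" "x 0 \<le> real j / (real j + 1)"
        by (rule infinite_sum_piece)
      then have P: "(t, x) \<in> P j" using t xc by (auto simp: P_def)
      have "x(0 := a j (x 0)) \<in> cube_boundary m"
      proof (rule cube_boundary_update_other[OF x])
        show "a j (x 0) \<in> {0..1}" using a01[OF P j(1)] by simp
        assume "x 0 \<in> {0, 1}"
        \<comment> \<open>Of the two end values only \<open>0\<close> is possible here; it lies in
          the first interval, whose parameter starts at \<open>0\<close>.\<close>
        then have "x 0 = 0" using True by auto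
        then have "j = 1" using j by (simp add: field_simps)
        then show "a j (x 0) \<in> {0, 1}" using \<open>x 0 = 0\<close> by (simp add: a_def)
      qed (use m in auto)
      then show ?thesis using HP[OF P j(1)] h(4)[OF j(1) t] by simp
    qed (simp add: H_def infinite_sum_end)
  next
    fix x assume "x \<in> topspace (cube m)"
    then show "H (0, x) = infinite_sum x0 f x" "H (1, x) = infinite_sum x0 g x"
      unfolding H_def prod.case using h by (auto intro!: fun_cong[OF infinite_sum_cong])
  qed
qed

lemma shrinking_sets_mono:
  "shrinking_sets X x0 A \<Longrightarrow> (\<And>j. 1 \<le> j \<Longrightarrow> A' j \<subseteq> A j) \<Longrightarrow> shrinking_sets X x0 A'"
  unfolding shrinking_sets_def
proof (elim all_forward imp_forward)
  fix U assume "\<And>j. 1 \<le> j \<Longrightarrow> A' j \<subseteq> A j" "finite {j. 1 \<le> j \<and> \<not> A j \<subseteq> U}"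
  then show "finite {j. 1 \<le> j \<and> \<not> A' j \<subseteq> U}"
    by (elim rev_finite_subset) blast
qed

lemma loops_basepoint:
  assumes "f \<in> loops m Y x0" "m \<ge> 1"
  shows "x0 \<in> topspace Y"
proof -
  have "(\<lambda>i\<in>{..<m}. 0) \<in> topspace (cube m)" by (auto simp: topspace_cube)
  moreover have "(\<lambda>i\<in>{..<m}. 0) 0 \<in> {0, 1::real}" using assms(2) by simp
  ultimately have b: "(\<lambda>i\<in>{..<m}. 0) \<in> cube_boundary m"
    using assms(2) unfolding cube_boundary_def by (auto intro!: exI[of _ 0])
  then have "f (\<lambda>i\<in>{..<m}. 0) = x0" using loops_value_boundary assms(1) by metis
  moreover have "f (\<lambda>i\<in>{..<m}. 0) \<in> topspace Y"
    using assms(1) continuous_map_image_subset_topspace[of "cube m" Y f] b cube_boundary_subset[of m]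
    by (auto simp: loops_def)
  ultimately show ?thesis by simp
qed

lemma const_loop: "x0 \<in> topspace Y \<Longrightarrow> (\<lambda>_. x0) \<in> loops m Y x0"
  by (auto simp: loops_def)

lemma loops_infinite_sum:
  assumes "m \<ge> 1" "x0 \<in> topspace X" "x0 \<in> B"
    and "\<And>j. 1 \<le> j \<Longrightarrow> f j \<in> loops m (subtopology X (A j)) x0"
    and "shrinking_sets X x0 A" "\<And>j. 1 \<le> j \<Longrightarrow> A j \<subseteq> B"
  shows "infinite_sum x0 f \<in> loops m (subtopology X B) x0"
  unfolding loops_iff_homotopy
  by (rule loop_homotopy_infinite_sum[where A = A])
    (use assms in \<open>auto simp: loops_iff_homotopy\<close>)

lemma infinite_sum_const [simp]: "infinite_sum x0 (\<lambda>_ _. x0) = (\<lambda>_. x0)"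
  by (auto simp: infinite_sum_def Let_def)

text \<open>The sum is \<open>f\<close> run with the affine parameter of the \<open>k\<close>-th
  interval, clamped to \<open>{0..1}\<close>: off that interval the clamped value is an end, where
  \<open>f\<close> is \<open>x0\<close>. A reparametrization that fixes both ends does not change
  the homotopy class.\<close>

lemma infinite_sum_single:
  assumes f: "f \<in> loops m Y x0" and m: "m \<ge> 1" and k: "k \<ge> 1"
  shows "(infinite_sum x0 (\<lambda>j. if j = k then f else (\<lambda>_. x0)), f) \<in> loop_homotopy m Y x0"
proof -
  define a where "a = (\<lambda>u. (u - (real k - 1) / real k) * (real k * (real k + 1)))"
  define c where "c = (\<lambda>u. max 0 (min 1 (a u)))"
  have amono: "a u \<le> a v" if "u \<le> v" for u v
    using that k unfolding a_def by (intro mult_right_mono) auto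
  have a0: "a ((real k - 1) / real k) = 0" by (simp add: a_def)
  have a1: "a (real k / (real k + 1)) = 1"
    using unit_parameter[of "real k"] k by (simp add: a_def)
  have "(\<lambda>x. f (x(0 := c (x 0))), \<lambda>x. f (x(0 := id (x 0)))) \<in> loop_homotopy m Y x0"
  proof (rule loop_homotopy_reparametrize[OF f m])
    show "continuous_on {0..1} c" unfolding c_def a_def by (intro continuous_intros)
    have "a 0 \<le> 0" using amono[of 0 "(real k - 1) / real k"] a0 k by simp
    then show "c 0 = id 0" by (simp add: c_def)
    have "a 1 \<ge> 1" using amono[of "real k / (real k + 1)" 1] a1 by simp
    then show "c 1 = id 1" by (simp add: c_def)
  qed (auto simp: c_def)
  then have hom: "(\<lambda>x. f (x(0 := c (x 0))), f) \<in> loop_homotopy m Y x0" by simp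
  have eq: "f (x(0 := c (x 0))) = infinite_sum x0 (\<lambda>j. if j = k then f else (\<lambda>_. x0)) x"
    if x: "x \<in> topspace (cube m)" for x
  proof -
    have fb: "f (x(0 := s)) = x0" if "s \<in> {0, 1}" for s
      using loops_value_boundary[OF f cube_boundary_update[OF x that]] m by simp
    show ?thesis
    proof (cases "x 0 < 1")
      case True
      then obtain j :: nat where j: "1 \<le> j" "(real j - 1) / real j \<le> x 0" "x 0 \<le> real j / (real j + 1)"
        using infinite_sum_piece[of "x 0"] cube_coordinate[OF x, of 0] m by (metis less_eq_Suc_le One_nat_def)
      have s: "infinite_sum x0 (\<lambda>j. if j = k then f else (\<lambda>_. x0)) x =
        (if j = k then f else (\<lambda>_. x0)) (x(0 := (x 0 - (real j - 1) / real j) * (real j * (real j + 1))))"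
        by (rule infinite_sum_eq) (use j fb in auto)
      consider "j = k" | "j < k" | "k < j" by linarith
      then show ?thesis
      proof cases
        case 1
        then have "a (x 0) \<in> {0..1}" using infinite_sum_parameter[OF j(2,3,1)] by (simp add: a_def)
        then have "c (x 0) = a (x 0)" by (simp add: c_def)
        then show ?thesis using s 1 by (simp add: a_def)
      next
        case 2
        have "real j / (real j + 1) \<le> (real k - 1) / real k"
          using 2 by (simp add: divide_simps) (simp add: algebra_simps)
        then have "a (x 0) \<le> 0" using amono[of "x 0" "(real k - 1) / real k"] a0 j by simp
        then have "c (x 0) = 0" by (simp add: c_def)
        then show ?thesis using s 2 fb by simp
      next
        case 3
        have "(real j - 1) / real j \<ge> real k / (real k + 1)"
          using 3 by (simp add: divide_simps) (simp add: algebra_simps)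
        then have "a (x 0) \<ge> 1" using amono[of "real k / (real k + 1)" "x 0"] a1 j by simp
        then have "c (x 0) = 1" by (simp add: c_def)
        then show ?thesis using s 3 fb by simp
      qed
    next
      case False
      moreover have "real k / (real k + 1) \<le> 1" by simp
      ultimately have "a (x 0) \<ge> 1" using amono[of "real k / (real k + 1)" "x 0"] a1 by linarith
      then have "c (x 0) = 1" by (simp add: c_def)
      then show ?thesis using False fb by (simp add: infinite_sum_end)
    qed
  qed
  have "(\<lambda>x. f (x(0 := c (x 0))), infinite_sum x0 (\<lambda>j. if j = k then f else (\<lambda>_. x0)))
      \<in> loop_homotopy m Y x0"
    using loop_homotopy_imp_loops[OF hom] eq by (intro loop_homotopy_eq_on_cube) auto
  from loop_homotopy_sym[OF this] hom show ?thesis by (rule loop_homotopy_trans)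
qed


section \<open>The infinite Eckmann--Hilton argument\<close>

definition coordinate_swap :: "(nat \<Rightarrow> real) \<Rightarrow> (nat \<Rightarrow> real)" where
  "coordinate_swap x = x(0 := x 1, 1 := x 0)"

lemma coordinate_swap_swap [simp]: "coordinate_swap (coordinate_swap x) = x"
  by (auto simp: coordinate_swap_def)

lemma continuous_map_coordinate_swap:
  assumes "m \<ge> 2" shows "continuous_map (cube m) (cube m) coordinate_swap"
  unfolding coordinate_swap_def
  by (intro continuous_map_cube_update continuous_map_cube_coordinate continuous_map_id[unfolded id_def])
    (use assms in auto)

lemma coordinate_swap_boundary:
  assumes "m \<ge> 2" "x \<in> cube_boundary m" shows "coordinate_swap x \<in> cube_boundary m"
proof -
  obtain k where k: "k < m" "x k = 0 \<or> x k = 1" and x: "x \<in> topspace (cube m)"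
    using assms(2) unfolding cube_boundary_def by blast
  have "coordinate_swap x \<in> topspace (cube m)"
    using continuous_map_image_subset_topspace[OF continuous_map_coordinate_swap[OF assms(1)]] x by blast
  moreover have "\<exists>i<m. coordinate_swap x i = 0 \<or> coordinate_swap x i = 1"
    by (rule exI[of _ "if k = 0 then 1 else if k = 1 then 0 else k"])
      (use k assms(1) in \<open>auto simp: coordinate_swap_def\<close>)
  ultimately show ?thesis by (simp add: cube_boundary_def)
qed

lemma loop_homotopy_swap:
  assumes "m \<ge> 2" "(f, g) \<in> loop_homotopy m Y x0"
  shows "(\<lambda>x. f (coordinate_swap x), \<lambda>x. g (coordinate_swap x)) \<in> loop_homotopy m Y x0"
  by (rule loop_homotopy_precompose[OF assms(2)])
    (use assms continuous_map_coordinate_swap coordinate_swap_boundary in auto)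

lemma loops_swap:
  "m \<ge> 2 \<Longrightarrow> f \<in> loops m Y x0 \<Longrightarrow> (\<lambda>x. f (coordinate_swap x)) \<in> loops m Y x0"
  unfolding loops_iff_homotopy by (rule loop_homotopy_swap)

text \<open>Summation along coordinate 1. Conjugation with \<open>coordinate_swap\<close> lets the
  lemmas on \<open>infinite_sum\<close> carry over.\<close>

definition infinite_sum_snd ::
    "'a \<Rightarrow> (nat \<Rightarrow> (nat \<Rightarrow> real) \<Rightarrow> 'a) \<Rightarrow> (nat \<Rightarrow> real) \<Rightarrow> 'a" where
  "infinite_sum_snd x0 f x = infinite_sum x0 (\<lambda>j y. f j (coordinate_swap y)) (coordinate_swap x)"

lemma loop_homotopy_infinite_sum_snd:
  assumes m: "m \<ge> 2" and x0: "x0 \<in> topspace X" "x0 \<in> B"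
    and hom: "\<And>j. 1 \<le> j \<Longrightarrow> (f j, g j) \<in> loop_homotopy m (subtopology X (A j)) x0"
    and "shrinking_sets X x0 A" "\<And>j. 1 \<le> j \<Longrightarrow> A j \<subseteq> B"
  shows "(infinite_sum_snd x0 f, infinite_sum_snd x0 g) \<in> loop_homotopy m (subtopology X B) x0"
  unfolding infinite_sum_snd_def
proof (rule loop_homotopy_swap[OF m], rule loop_homotopy_infinite_sum[where A = A])
  show "(\<lambda>y. f j (coordinate_swap y), \<lambda>y. g j (coordinate_swap y))
      \<in> loop_homotopy m (subtopology X (A j)) x0" if "1 \<le> j" for j
    by (rule loop_homotopy_swap[OF m hom[OF that]])
qed (use assms in auto)

lemma infinite_sum_snd_single:
  assumes f: "f \<in> loops m Y x0" and m: "m \<ge> 2" and k: "k \<ge> 1"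
  shows "(infinite_sum_snd x0 (\<lambda>j. if j = k then f else (\<lambda>_. x0)), f) \<in> loop_homotopy m Y x0"
proof -
  have "(infinite_sum x0 (\<lambda>j. if j = k then (\<lambda>x. f (coordinate_swap x)) else (\<lambda>_. x0)),
      \<lambda>x. f (coordinate_swap x)) \<in> loop_homotopy m Y x0"
    by (rule infinite_sum_single) (use assms loops_swap in auto)
  moreover have "(\<lambda>j. if j = k then (\<lambda>x. f (coordinate_swap x)) else (\<lambda>_. x0)) =
      (\<lambda>j y. (if j = k then f else (\<lambda>_. x0)) (coordinate_swap y))" by auto
  ultimately show ?thesis
    using loop_homotopy_swap[OF m, of "infinite_sum x0 (\<lambda>j. if j = k then (\<lambda>x. f (coordinate_swap x)) else (\<lambda>_. x0))"
      "\<lambda>x. f (coordinate_swap x)" Y x0]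
    by (simp add: infinite_sum_snd_def[abs_def])
qed

text \<open>This is an equality of functions, for arbitrary \<open>g\<close>: \<open>x 0\<close>
  selects \<open>j\<close> and \<open>x 1\<close> selects \<open>i\<close>, independently of each
  other. The second direction of summation is introduced for the sake of this strict
  exchange.\<close>

lemma infinite_sum_interchange_eq:
  "infinite_sum x0 (\<lambda>j. infinite_sum_snd x0 (g j)) = infinite_sum_snd x0 (\<lambda>i. infinite_sum x0 (\<lambda>j. g j i))"
  by (auto simp: fun_eq_iff infinite_sum_def infinite_sum_snd_def coordinate_swap_def Let_def fun_upd_twist)

text \<open>Put the \<open>f j\<close> on the diagonal of an array and constants elsewhere. Each row
  and each column has one nontrivial entry and sums to it up to homotopy. Summing by columns thus
  yields \<open>infinite_sum_snd x0 f\<close>, by rows \<open>infinite_sum x0 f\<close>, and the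
  strict exchange identifies the two double sums.\<close>

lemma infinite_sum_snd_homotopic:
  assumes m: "m \<ge> 2" and x0: "x0 \<in> topspace X" "x0 \<in> B"
    and f: "\<And>j. 1 \<le> j \<Longrightarrow> f j \<in> loops m (subtopology X (A j)) x0"
    and null: "shrinking_sets X x0 A" and AB: "\<And>j. 1 \<le> j \<Longrightarrow> A j \<subseteq> B"
  shows "(infinite_sum_snd x0 f, infinite_sum x0 f) \<in> loop_homotopy m (subtopology X B) x0"
proof -
  let ?e = "\<lambda>j i. if j = i then f i else (\<lambda>_. x0)"
  have "(infinite_sum_snd x0 f, infinite_sum_snd x0 (\<lambda>i. infinite_sum x0 (\<lambda>j. ?e j i)))
      \<in> loop_homotopy m (subtopology X B) x0"
  proof (rule loop_homotopy_infinite_sum_snd[OF m x0 _ null AB])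
    show "(f i, infinite_sum x0 (\<lambda>j. ?e j i)) \<in> loop_homotopy m (subtopology X (A i)) x0"
      if "1 \<le> i" for i
      using loop_homotopy_sym[OF infinite_sum_single[OF f[OF that] _ that]] m by simp
  qed
  moreover have "(infinite_sum x0 (\<lambda>j. infinite_sum_snd x0 (?e j)), infinite_sum x0 f)
      \<in> loop_homotopy m (subtopology X B) x0"
  proof (rule loop_homotopy_infinite_sum[OF _ x0 _ null AB])
    fix j :: nat assume j: "1 \<le> j"
    have "?e j = (\<lambda>i. if i = j then f j else (\<lambda>_. x0))" by auto
    then show "(infinite_sum_snd x0 (?e j), f j) \<in> loop_homotopy m (subtopology X (A j)) x0"
      using infinite_sum_snd_single[OF f[OF j] m j] by simp
  qed (use m in auto)
  ultimately show ?thesis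
    unfolding infinite_sum_interchange_eq by (rule loop_homotopy_trans)
qed

text \<open>Nullity is joint in both indices: null rows alone would not make the sums of the rows a
  null sequence.\<close>

definition shrinking_array :: "'a topology \<Rightarrow> 'a \<Rightarrow> (nat \<Rightarrow> nat \<Rightarrow> 'a set) \<Rightarrow> bool" where
  "shrinking_array X x0 A \<longleftrightarrow> (\<forall>U. openin X U \<and> x0 \<in> U \<longrightarrow>
     finite {(j, i). 1 \<le> j \<and> 1 \<le> i \<and> \<not> A j i \<subseteq> U})"

lemma shrinking_array_transpose: "shrinking_array X x0 A \<Longrightarrow> shrinking_array X x0 (\<lambda>i j. A j i)"
proof -
  assume "shrinking_array X x0 A"
  then show ?thesis
    unfolding shrinking_array_def
  proof (elim all_forward imp_forward)
    fix U assume "finite {(j, i). 1 \<le> j \<and> 1 \<le> i \<and> \<not> A j i \<subseteq> U}"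
    then have "finite (prod.swap ` {(j, i). 1 \<le> j \<and> 1 \<le> i \<and> \<not> A j i \<subseteq> U})" by simp
    then show "finite {(i, j). 1 \<le> i \<and> 1 \<le> j \<and> \<not> A j i \<subseteq> U}"
      by (rule rev_finite_subset) force
  qed
qed

lemma shrinking_array_row: "shrinking_array X x0 A \<Longrightarrow> 1 \<le> j \<Longrightarrow> shrinking_sets X x0 (A j)"
proof -
  assume a: "shrinking_array X x0 A" "1 \<le> j"
  from a(1) show ?thesis
    unfolding shrinking_array_def shrinking_sets_def
  proof (elim all_forward imp_forward)
    fix U assume "finite {(j, i). 1 \<le> j \<and> 1 \<le> i \<and> \<not> A j i \<subseteq> U}"
    then have "finite (snd ` {(j, i). 1 \<le> j \<and> 1 \<le> i \<and> \<not> A j i \<subseteq> U})" by simp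
    then show "finite {i. 1 \<le> i \<and> \<not> A j i \<subseteq> U}"
      by (rule rev_finite_subset) (use a(2) in force)
  qed
qed

lemma shrinking_array_union: "shrinking_array X x0 A \<Longrightarrow> shrinking_sets X x0 (\<lambda>j. \<Union>i\<in>{1..}. A j i)"
proof -
  assume "shrinking_array X x0 A"
  then show ?thesis
    unfolding shrinking_array_def shrinking_sets_def
  proof (elim all_forward imp_forward)
    fix U assume "finite {(j, i). 1 \<le> j \<and> 1 \<le> i \<and> \<not> A j i \<subseteq> U}"
    then have "finite (fst ` {(j, i). 1 \<le> j \<and> 1 \<le> i \<and> \<not> A j i \<subseteq> U})" by simp
    then show "finite {j. 1 \<le> j \<and> \<not> (\<Union>i\<in>{1..}. A j i) \<subseteq> U}"
      by (rule rev_finite_subset) force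
  qed
qed

text \<open>The inner sums are moved to coordinate 1, the strict exchange is applied, and the sum
  along coordinate 1, now the outer one, is moved back to coordinate 0. Joint nullity makes the
  unions over rows and over columns shrink.\<close>

lemma infinite_sum_interchange:
  assumes m: "m \<ge> 2" and x0: "x0 \<in> topspace X" "x0 \<in> B"
    and g: "\<And>j i. 1 \<le> j \<Longrightarrow> 1 \<le> i \<Longrightarrow> g j i \<in> loops m (subtopology X (A j i)) x0"
    and null: "shrinking_array X x0 A" and AB: "\<And>j i. 1 \<le> j \<Longrightarrow> 1 \<le> i \<Longrightarrow> A j i \<subseteq> B"
  shows "(infinite_sum x0 (\<lambda>j. infinite_sum x0 (g j)), infinite_sum x0 (\<lambda>i. infinite_sum x0 (\<lambda>j. g j i)))
     \<in> loop_homotopy m (subtopology X B) x0"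
proof -
  have m1: "m \<ge> 1" using m by simp
  have x0A: "x0 \<in> A j i" if "1 \<le> j" "1 \<le> i" for j i
    using loops_basepoint[OF g[OF that] m1] by simp
  let ?R = "\<lambda>j. \<Union>i\<in>{1..}. A j i" and ?C = "\<lambda>i. \<Union>j\<in>{1..}. A j i"
  have "(infinite_sum x0 (\<lambda>j. infinite_sum x0 (g j)), infinite_sum x0 (\<lambda>j. infinite_sum_snd x0 (g j)))
     \<in> loop_homotopy m (subtopology X B) x0"
  proof (rule loop_homotopy_infinite_sum[OF m1 x0 _ shrinking_array_union[OF null]])
    fix j :: nat assume j: "1 \<le> j"
    have "x0 \<in> ?R j" using x0A[OF j] by auto
    then show "(infinite_sum x0 (g j), infinite_sum_snd x0 (g j)) \<in> loop_homotopy m (subtopology X (?R j)) x0"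
      by (intro loop_homotopy_sym[OF infinite_sum_snd_homotopic[OF m x0(1) _ g[OF j] shrinking_array_row[OF null j]]]) auto
    show "?R j \<subseteq> B" using AB j by auto
  qed
  moreover have "(infinite_sum_snd x0 (\<lambda>i. infinite_sum x0 (\<lambda>j. g j i)),
      infinite_sum x0 (\<lambda>i. infinite_sum x0 (\<lambda>j. g j i))) \<in> loop_homotopy m (subtopology X B) x0"
  proof (rule infinite_sum_snd_homotopic[OF m x0 _ shrinking_array_union[OF shrinking_array_transpose[OF null]]])
    fix i :: nat assume i: "1 \<le> i"
    have "x0 \<in> ?C i" using x0A[OF _ i] by auto
    then show "infinite_sum x0 (\<lambda>j. g j i) \<in> loops m (subtopology X (?C i)) x0"
      by (intro loops_infinite_sum[OF m1 x0(1) _ g[OF _ i] shrinking_array_row[OF shrinking_array_transpose[OF null] i]]) auto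
    show "?C i \<subseteq> B" using AB i by auto
  qed
  ultimately show ?thesis
    unfolding infinite_sum_interchange_eq by (rule loop_homotopy_trans)
qed

section \<open>The homotopy group\<close>

text \<open>A sum of two loops is padded with constants, so that results on infinite sums apply to
  \<open>loop_add\<close>.\<close>

definition loop_pair ::
    "'a \<Rightarrow> ((nat \<Rightarrow> real) \<Rightarrow> 'a) \<Rightarrow> ((nat \<Rightarrow> real) \<Rightarrow> 'a) \<Rightarrow> nat \<Rightarrow> (nat \<Rightarrow> real) \<Rightarrow> 'a" where
  "loop_pair x0 f g j = (if j = 1 then f else if j = 2 then g else (\<lambda>_. x0))"

lemma shrinking_sets_two: "shrinking_sets X x0 (\<lambda>j. if j \<le> 2 then A else {x0})"
  unfolding shrinking_sets_def
proof (intro allI impI)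
  fix U assume "openin X U \<and> x0 \<in> U"
  then have "{j. 1 \<le> j \<and> \<not> (if j \<le> 2 then A else {x0}) \<subseteq> U} \<subseteq> {1, 2::nat}" by auto
  then show "finite {j::nat. 1 \<le> j \<and> \<not> (if j \<le> 2 then A else {x0}) \<subseteq> U}"
    by (rule finite_subset) simp
qed

lemma loop_pair_homotopy:
  assumes "m \<ge> 1" "(f, f') \<in> loop_homotopy m Y x0" "(g, g') \<in> loop_homotopy m Y x0"
  shows "(infinite_sum x0 (loop_pair x0 f g), infinite_sum x0 (loop_pair x0 f' g')) \<in> loop_homotopy m Y x0"
proof -
  have x0: "x0 \<in> topspace Y"
    using loops_basepoint loop_homotopy_imp_loops assms by metis
  have c: "((\<lambda>_. x0), (\<lambda>_. x0)) \<in> loop_homotopy m (subtopology Y {x0}) x0"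
    using x0 by (intro loop_homotopy_refl const_loop) auto
  have "(infinite_sum x0 (loop_pair x0 f g), infinite_sum x0 (loop_pair x0 f' g'))
      \<in> loop_homotopy m (subtopology Y (topspace Y)) x0"
  proof (rule loop_homotopy_infinite_sum[OF _ x0 x0 _ shrinking_sets_two[of _ _ "topspace Y"]])
    fix j :: nat assume "1 \<le> j"
    then show "(loop_pair x0 f g j, loop_pair x0 f' g' j)
        \<in> loop_homotopy m (subtopology Y (if j \<le> 2 then topspace Y else {x0})) x0"
      using assms c by (auto simp: loop_pair_def)
  qed (use assms x0 in auto)
  then show ?thesis by simp
qed

text \<open>The padded sum has \<open>g\<close> on \<open>[1/2, 2/3]\<close>, whereas
  \<open>loop_add\<close> has it on \<open>[1/2, 1]\<close>; the map \<open>1/3 + u/3\<close> takes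
  the second interval onto the first.\<close>

lemma loop_add_eq_infinite_sum:
  assumes f: "f \<in> loops m Y x0" and g: "g \<in> loops m Y x0" and m: "m \<ge> 1"
    and x: "x \<in> topspace (cube m)"
  shows "loop_add f g x =
    infinite_sum x0 (loop_pair x0 f g) (x(0 := if x 0 \<le> 1 / 2 then x 0 else 1 / 3 + x 0 / 3))"
proof -
  have b: "loop_pair x0 f g i (x(0 := s)) = x0" if "s \<in> {0, 1}" for i s
    using loops_value_boundary[OF f cube_boundary_update[OF x that, of 0]]
        loops_value_boundary[OF g cube_boundary_update[OF x that, of 0]] m
    by (auto simp: loop_pair_def)
  have u: "0 \<le> x 0" "x 0 \<le> 1" using cube_coordinate[OF x, of 0] m by auto
  show ?thesis
  proof (cases "x 0 \<le> 1 / 2")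
    case True
    have "infinite_sum x0 (loop_pair x0 f g) x =
      loop_pair x0 f g 1 (x(0 := (x 0 - (real 1 - 1) / real 1) * (real 1 * (real 1 + 1))))"
      by (rule infinite_sum_eq) (use True u b in auto)
    then show ?thesis using True by (simp add: loop_add_def loop_pair_def mult.commute)
  next
    case False
    let ?y = "x(0 := 1 / 3 + x 0 / 3)"
    have p2: "loop_pair x0 f g 2 = g" by (simp add: loop_pair_def)
    have "infinite_sum x0 (loop_pair x0 f g) ?y =
      loop_pair x0 f g 2 (?y(0 := (?y 0 - (real 2 - 1) / real 2) * (real 2 * (real 2 + 1))))"
      by (rule infinite_sum_eq) (use False u b in auto)
    also have "(?y 0 - (real 2 - 1) / real 2) * (real 2 * (real 2 + 1)) = 2 * x 0 - 1"
      by (simp add: algebra_simps)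
    finally have "infinite_sum x0 (loop_pair x0 f g) ?y = g (x(0 := 2 * x 0 - 1))"
      unfolding fun_upd_upd p2 .
    then show ?thesis using False by (simp add: loop_add_def)
  qed
qed

text \<open>Continuity at the seam \<open>1/2\<close> is inherited from the padded infinite
  sum.\<close>

lemma loops_loop_add:
  assumes f: "f \<in> loops m Y x0" and g: "g \<in> loops m Y x0" and m: "m \<ge> 1"
  shows "loop_add f g \<in> loops m Y x0"
proof -
  have S: "infinite_sum x0 (loop_pair x0 f g) \<in> loops m Y x0"
    using loop_pair_homotopy[OF m loop_homotopy_refl[OF f] loop_homotopy_refl[OF g]]
    by (simp add: loops_iff_homotopy)
  let ?a = "\<lambda>u::real. if u \<le> 1 / 2 then u else 1 / 3 + u / 3"
  have "continuous_on {0..1} ?a"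
  proof -
    \<comment> \<open>The two branches cross exactly at \<open>1/2\<close>, so the case distinction
      is a minimum.\<close>
    have "?a = (\<lambda>u. min u (1 / 3 + u / 3))" by auto
    moreover have "continuous_on {0..1} (\<lambda>u::real. min u (1 / 3 + u / 3))"
      by (intro continuous_intros) simp
    ultimately show ?thesis by (simp only:)
  qed
  then have "continuous_map (cube m) unit_interval (\<lambda>x. ?a (x 0))"
    using continuous_map_compose[OF continuous_map_cube_coordinate[of 0 m], of unit_interval ?a] m
    by (auto simp: o_def continuous_map_in_subtopology)
  then have "continuous_map (cube m) (cube m) (\<lambda>x. x(0 := ?a (x 0)))"
    using m by (intro continuous_map_cube_update continuous_map_id[unfolded id_def]) auto
  from continuous_map_compose[OF this, of Y "infinite_sum x0 (loop_pair x0 f g)"] S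
  have "continuous_map (cube m) Y (\<lambda>x. infinite_sum x0 (loop_pair x0 f g) (x(0 := ?a (x 0))))"
    by (simp add: loops_def o_def)
  then have "continuous_map (cube m) Y (loop_add f g)"
    by (rule continuous_map_eq) (use loop_add_eq_infinite_sum[OF f g m] in simp)
  moreover have "loop_add f g x = x0" if x: "x \<in> cube_boundary m" for x
  proof -
    have xc: "x \<in> topspace (cube m)" using x cube_boundary_subset by blast
    have u: "0 \<le> x 0" "x 0 \<le> 1" using cube_coordinate[OF xc, of 0] m by auto
    have "x(0 := 2 * x 0) \<in> cube_boundary m" if "x 0 \<le> 1 / 2"
      by (rule cube_boundary_update_other[OF x]) (use that u m in auto)
    moreover have "x(0 := 2 * x 0 - 1) \<in> cube_boundary m" if "\<not> x 0 \<le> 1 / 2"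
      by (rule cube_boundary_update_other[OF x]) (use that u m in auto)
    ultimately show ?thesis
      using loops_value_boundary f g by (auto simp: loop_add_def)
  qed
  ultimately show ?thesis by (auto simp: loops_def)
qed

text \<open>Stretching \<open>[1/2, 2/3]\<close> to \<open>[1/2, 1]\<close> and then resting at
  \<open>1\<close> turns \<open>loop_add f g\<close> into the padded sum, which is constant from
  \<open>2/3\<close> on.\<close>

lemma loop_add_homotopic_infinite_sum:
  assumes f: "f \<in> loops m Y x0" and g: "g \<in> loops m Y x0" and m: "m \<ge> 1"
  shows "(loop_add f g, infinite_sum x0 (loop_pair x0 f g)) \<in> loop_homotopy m Y x0"
proof -
  define S where "S = infinite_sum x0 (loop_pair x0 f g)"
  have S: "S \<in> loops m Y x0"
    using loop_pair_homotopy[OF m loop_homotopy_refl[OF f] loop_homotopy_refl[OF g]]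
    by (simp add: loops_iff_homotopy S_def)
  define a where "a = (\<lambda>u::real. if u \<le> 1 / 2 then u else min 1 (3 * u - 1))"
  \<comment> \<open>\<open>c\<close> is the rescaling that expresses \<open>loop_add\<close> by the
    padded sum. On \<open>{0..1}\<close>, \<open>c\<close> after \<open>a\<close> is the identity up
    to \<open>2/3\<close> and has the value \<open>2/3\<close> beyond.\<close>
  define c where "c = (\<lambda>u::real. if u \<le> 1 / 2 then u else 1 / 3 + u / 3)"
  have L: "loop_add f g \<in> loops m Y x0" by (rule loops_loop_add[OF f g m])
  have "(\<lambda>x. loop_add f g (x(0 := a (x 0))), \<lambda>x. loop_add f g (x(0 := id (x 0)))) \<in> loop_homotopy m Y x0"
  proof (rule loop_homotopy_reparametrize[OF L m])
    have "continuous_on ({..1/2} \<union> {1/2..}) a" unfolding a_def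
      by (rule continuous_on_cases) (auto intro!: continuous_intros)
    then show "continuous_on {0..1} a" by (rule continuous_on_subset) auto
  qed (auto simp: a_def)
  then have hom: "(\<lambda>x. loop_add f g (x(0 := a (x 0))), loop_add f g) \<in> loop_homotopy m Y x0" by simp
  have eq: "loop_add f g (x(0 := a (x 0))) = S x" if x: "x \<in> topspace (cube m)" for x
  proof -
    have u: "0 \<le> x 0" "x 0 \<le> 1" using cube_coordinate[OF x, of 0] m by auto
    have b: "loop_pair x0 f g i (x(0 := s)) = x0" if "s \<in> {0, 1}" for i s
      using loops_value_boundary[OF f cube_boundary_update[OF x that, of 0]]
        loops_value_boundary[OF g cube_boundary_update[OF x that, of 0]] m
      by (auto simp: loop_pair_def)
    have xa: "x(0 := a (x 0)) \<in> topspace (cube m)"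
      using u m by (intro cube_update[OF x]) (auto simp: a_def)
    have "loop_add f g (x(0 := a (x 0))) = S (x(0 := c (a (x 0))))"
      using loop_add_eq_infinite_sum[OF f g m xa] by (simp add: S_def c_def)
    moreover have "S (x(0 := c (a (x 0)))) = S x"
    proof (cases "x 0 \<le> 2 / 3")
      case True
      then have "c (a (x 0)) = x 0" using u by (auto simp: a_def c_def min_def diff_divide_distrib)
      then show ?thesis by simp
    next
      case False
      then have c: "c (a (x 0)) = 2 / 3" by (simp add: a_def c_def)
      have "S (x(0 := 2 / 3)) = loop_pair x0 f g 2 ((x(0 := 2 / 3))(0 := ((x(0 := 2 / 3)) 0 - (real 2 - 1) / real 2) * (real 2 * (real 2 + 1))))"
        unfolding S_def by (rule infinite_sum_eq) (use b in auto)
      then have "S (x(0 := 2 / 3)) = x0" using b[of 1 2] by simp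
      moreover have "S x = x0"
      proof (cases "x 0 < 1")
        case True
        then obtain j :: nat where j: "1 \<le> j" "(real j - 1) / real j \<le> x 0" "x 0 \<le> real j / (real j + 1)"
          using u(1) by (rule infinite_sum_piece)
        have "j \<noteq> 1" "j \<noteq> 2" using j False by auto
        have "S x = loop_pair x0 f g j (x(0 := (x 0 - (real j - 1) / real j) * (real j * (real j + 1))))"
          unfolding S_def by (rule infinite_sum_eq) (use b j in auto)
        then show ?thesis using \<open>j \<noteq> 1\<close> \<open>j \<noteq> 2\<close> by (simp add: loop_pair_def)
      qed (simp add: S_def infinite_sum_end)
      ultimately show ?thesis by (simp only: c)
    qed
    ultimately show ?thesis by simp
  qed
  have "(\<lambda>x. loop_add f g (x(0 := a (x 0))), S) \<in> loop_homotopy m Y x0"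
    using loop_homotopy_imp_loops[OF hom] eq by (intro loop_homotopy_eq_on_cube) auto
  from loop_homotopy_trans[OF loop_homotopy_sym[OF hom] this] show ?thesis by (simp add: S_def)
qed

lemma loop_homotopy_add:
  assumes m: "m \<ge> 1" and f: "(f, f') \<in> loop_homotopy m Y x0" and g: "(g, g') \<in> loop_homotopy m Y x0"
  shows "(loop_add f g, loop_add f' g') \<in> loop_homotopy m Y x0"
proof -
  have l: "f \<in> loops m Y x0" "f' \<in> loops m Y x0" "g \<in> loops m Y x0" "g' \<in> loops m Y x0"
    using f g loop_homotopy_imp_loops by metis+
  show ?thesis
    by (rule loop_homotopy_trans[OF loop_add_homotopic_infinite_sum[OF l(1,3) m]
          loop_homotopy_trans[OF loop_pair_homotopy[OF m f g]
            loop_homotopy_sym[OF loop_add_homotopic_infinite_sum[OF l(2,4) m]]]])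
qed

text \<open>Interchange in an array with first row \<open>f\<close>, second row \<open>g\<close> and
  constants below: the row sums give the sum of the two infinite sums, the column sums give the
  termwise sums.\<close>

lemma infinite_sum_add:
  assumes m: "m \<ge> 2" and x0: "x0 \<in> topspace X" "x0 \<in> B"
    and f: "\<And>j. 1 \<le> j \<Longrightarrow> f j \<in> loops m (subtopology X (A j)) x0"
    and g: "\<And>j. 1 \<le> j \<Longrightarrow> g j \<in> loops m (subtopology X (A j)) x0"
    and null: "shrinking_sets X x0 A" and AB: "\<And>j. 1 \<le> j \<Longrightarrow> A j \<subseteq> B"
  shows "(loop_add (infinite_sum x0 f) (infinite_sum x0 g), infinite_sum x0 (\<lambda>j. loop_add (f j) (g j)))
    \<in> loop_homotopy m (subtopology X B) x0"
proof -
  have m1: "m \<ge> 1" using m by simp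
  have S: "infinite_sum x0 f \<in> loops m (subtopology X B) x0" "infinite_sum x0 g \<in> loops m (subtopology X B) x0"
    using loops_infinite_sum[OF m1 x0 _ null AB] f g by metis+
  \<comment> \<open>This is strict, since an infinite sum of constants is constant.\<close>
  have eq: "loop_pair x0 (infinite_sum x0 f) (infinite_sum x0 g) =
      (\<lambda>i. infinite_sum x0 (\<lambda>j. loop_pair x0 (f j) (g j) i))"
    by (auto simp: loop_pair_def)
  let ?A = "\<lambda>i j. if i \<le> (2::nat) then A j else {x0}"
  have "(infinite_sum x0 (\<lambda>i. infinite_sum x0 (\<lambda>j. loop_pair x0 (f j) (g j) i)),
      infinite_sum x0 (\<lambda>j. infinite_sum x0 (\<lambda>i. loop_pair x0 (f j) (g j) i)))
      \<in> loop_homotopy m (subtopology X B) x0"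
  proof (rule infinite_sum_interchange[OF m x0])
    show "loop_pair x0 (f j) (g j) i \<in> loops m (subtopology X (?A i j)) x0"
      if "1 \<le> i" "1 \<le> j" for i j
      using f g that x0 by (auto simp: loop_pair_def intro!: const_loop)
    show "shrinking_array X x0 ?A"
      unfolding shrinking_array_def
    proof (intro allI impI)
      fix U assume U: "openin X U \<and> x0 \<in> U"
      then have "finite ({1, 2::nat} \<times> {j. 1 \<le> j \<and> \<not> A j \<subseteq> U})"
        using null by (simp add: shrinking_sets_def)
      then show "finite {(i, j). 1 \<le> i \<and> 1 \<le> j \<and> \<not> ?A i j \<subseteq> U}"
        by (rule rev_finite_subset) (use U in \<open>auto split: if_splits\<close>)
    qed
  qed (use AB x0 in auto)
  moreover have "(infinite_sum x0 (\<lambda>j. infinite_sum x0 (loop_pair x0 (f j) (g j))),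
      infinite_sum x0 (\<lambda>j. loop_add (f j) (g j))) \<in> loop_homotopy m (subtopology X B) x0"
    by (rule loop_homotopy_infinite_sum[OF m1 x0
          loop_homotopy_sym[OF loop_add_homotopic_infinite_sum[OF f g m1]] null AB])
  ultimately have "(infinite_sum x0 (loop_pair x0 (infinite_sum x0 f) (infinite_sum x0 g)),
      infinite_sum x0 (\<lambda>j. loop_add (f j) (g j))) \<in> loop_homotopy m (subtopology X B) x0"
    unfolding eq by (rule loop_homotopy_trans)
  with loop_add_homotopic_infinite_sum[OF S m1] show ?thesis
    by (rule loop_homotopy_trans)
qed

section \<open>Inverses, units and associativity\<close>

definition loop_inverse :: "((nat \<Rightarrow> real) \<Rightarrow> 'a) \<Rightarrow> (nat \<Rightarrow> real) \<Rightarrow> 'a" where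
  "loop_inverse f x = f (x(0 := 1 - x 0))"

lemma loop_inverse_inverse [simp]: "loop_inverse (loop_inverse f) = f"
  by (auto simp: loop_inverse_def)

lemma loop_homotopy_reparametrize_eq:
  assumes f: "f \<in> loops m Y x0" and m: "m \<ge> 1"
    and a: "continuous_on {0..1} a" "a ` {0..1} \<subseteq> {0..1::real}"
    and c: "continuous_on {0..1} c" "c ` {0..1} \<subseteq> {0..1::real}"
    and ends: "a 0 = c 0" "a 1 = c 1" "c 0 \<in> {0, 1}" "c 1 \<in> {0, 1}"
    and g: "\<And>x. x \<in> topspace (cube m) \<Longrightarrow> g x = f (x(0 := a (x 0)))"
    and h: "\<And>x. x \<in> topspace (cube m) \<Longrightarrow> h x = f (x(0 := c (x 0)))"
  shows "(g, h) \<in> loop_homotopy m Y x0"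
proof -
  have l: "(\<lambda>x. f (x(0 := a (x 0))), \<lambda>x. f (x(0 := c (x 0)))) \<in> loop_homotopy m Y x0"
    by (rule loop_homotopy_reparametrize) fact+
  have "(\<lambda>x. f (x(0 := a (x 0))), g) \<in> loop_homotopy m Y x0"
    using loop_homotopy_imp_loops[OF l] g by (intro loop_homotopy_eq_on_cube) auto
  from loop_homotopy_sym[OF this] l have "(g, \<lambda>x. f (x(0 := c (x 0)))) \<in> loop_homotopy m Y x0"
    by (rule loop_homotopy_trans)
  also have "(\<lambda>x. f (x(0 := c (x 0))), h) \<in> loop_homotopy m Y x0"
    using loop_homotopy_imp_loops[OF l] h by (intro loop_homotopy_eq_on_cube) auto
  finally show ?thesis .
qed

context
  fixes m :: nat and Y :: "'a topology" and x0 :: 'a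
  assumes m: "m \<ge> 1"
begin

lemma loop_add_const_right:
  assumes f: "f \<in> loops m Y x0"
  shows "(loop_add f (\<lambda>_. x0), f) \<in> loop_homotopy m Y x0"
proof (rule loop_homotopy_reparametrize_eq[OF f m, where a = "\<lambda>u. min 1 (2 * u)" and c = id])
  fix x :: "nat \<Rightarrow> real" assume x: "x \<in> topspace (cube m)"
  have "min 1 (2 * x 0) = (if x 0 \<le> 1 / 2 then 2 * x 0 else 1)" by auto
  then show "loop_add f (\<lambda>_. x0) x = f (x(0 := min 1 (2 * x 0)))"
    using loops_value_boundary[OF f cube_boundary_update[OF x, of 1 0]] m
    by (auto simp: loop_add_def)
qed (auto intro!: continuous_intros simp: id_def)

lemma loop_add_const_left:
  assumes f: "f \<in> loops m Y x0"
  shows "(loop_add (\<lambda>_. x0) f, f) \<in> loop_homotopy m Y x0"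
proof (rule loop_homotopy_reparametrize_eq[OF f m, where a = "\<lambda>u. max 0 (2 * u - 1)" and c = id])
  fix x :: "nat \<Rightarrow> real" assume x: "x \<in> topspace (cube m)"
  have "max 0 (2 * x 0 - 1) = (if x 0 \<le> 1 / 2 then 0 else 2 * x 0 - 1)" by auto
  then show "loop_add (\<lambda>_. x0) f x = f (x(0 := max 0 (2 * x 0 - 1)))"
    using loops_value_boundary[OF f cube_boundary_update[OF x, of 0 0]] m
    by (auto simp: loop_add_def)
qed (auto intro!: continuous_intros simp: id_def)

lemma loops_loop_inverse:
  assumes f: "f \<in> loops m Y x0" shows "loop_inverse f \<in> loops m Y x0"
proof -
  have "continuous_on {0..1} (\<lambda>u::real. 1 - u)" by (intro continuous_intros)
  from loops_reparametrize[OF f m this] show ?thesis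
    by (simp add: loop_inverse_def[abs_def])
qed

text \<open>The concatenation is \<open>f\<close> run along the tent
  \<open>min (2 * u) (2 - 2 * u)\<close>. Both ends of the tent are \<open>0\<close>, and it
  contracts linearly to the constant \<open>0\<close>.\<close>

lemma loop_add_inverse_right:
  assumes f: "f \<in> loops m Y x0"
  shows "(loop_add f (loop_inverse f), \<lambda>_. x0) \<in> loop_homotopy m Y x0"
proof (rule loop_homotopy_reparametrize_eq[OF f m, where a = "\<lambda>u. min (2 * u) (2 - 2 * u)" and c = "\<lambda>_. 0"])
  fix x :: "nat \<Rightarrow> real" assume x: "x \<in> topspace (cube m)"
  show "loop_add f (loop_inverse f) x = f (x(0 := min (2 * x 0) (2 - 2 * x 0)))"
    by (auto simp: loop_add_def loop_inverse_def min_def)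
  show "x0 = f (x(0 := 0))"
    using loops_value_boundary[OF f cube_boundary_update[OF x, of 0 0]] m by simp
qed (auto intro!: continuous_intros)

lemma loop_add_inverse_left:
  assumes f: "f \<in> loops m Y x0"
  shows "(loop_add (loop_inverse f) f, \<lambda>_. x0) \<in> loop_homotopy m Y x0"
  using loop_add_inverse_right[OF loops_loop_inverse[OF f]] by simp

end

text \<open>The middle-four exchange is \<open>infinite_sum_add\<close> for the padded sequence of
  \<open>f\<close>, \<open>h\<close> and that of \<open>g\<close>, \<open>k\<close>.\<close>

lemma loop_add_medial:
  assumes m: "m \<ge> 2" and l: "f \<in> loops m Y x0" "g \<in> loops m Y x0" "h \<in> loops m Y x0" "k \<in> loops m Y x0"
  shows "(loop_add (loop_add f h) (loop_add g k), loop_add (loop_add f g) (loop_add h k)) \<in> loop_homotopy m Y x0"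
proof -
  have m1: "m \<ge> 1" using m by simp
  have x0: "x0 \<in> topspace Y" using loops_basepoint[OF l(1) m1] .
  have c: "(\<lambda>_. x0) \<in> loops m (subtopology Y {x0}) x0" using x0 by (auto intro!: const_loop)
  have "(loop_add (loop_add f h) (loop_add g k),
      loop_add (infinite_sum x0 (loop_pair x0 f h)) (infinite_sum x0 (loop_pair x0 g k))) \<in> loop_homotopy m Y x0"
    by (intro loop_homotopy_add loop_add_homotopic_infinite_sum l m1)
  also have "(loop_add (infinite_sum x0 (loop_pair x0 f h)) (infinite_sum x0 (loop_pair x0 g k)),
      infinite_sum x0 (\<lambda>j. loop_add (loop_pair x0 f h j) (loop_pair x0 g k j)))
      \<in> loop_homotopy m (subtopology Y (topspace Y)) x0"
    by (rule infinite_sum_add[OF m x0 x0 _ _ shrinking_sets_two[of _ _ "topspace Y"]])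
      (use l c x0 in \<open>auto simp: loop_pair_def\<close>)
  then have "(loop_add (infinite_sum x0 (loop_pair x0 f h)) (infinite_sum x0 (loop_pair x0 g k)),
      infinite_sum x0 (\<lambda>j. loop_add (loop_pair x0 f h j) (loop_pair x0 g k j)))
      \<in> loop_homotopy m Y x0"
    by simp
  also have "(\<lambda>j. loop_add (loop_pair x0 f h j) (loop_pair x0 g k j)) =
      loop_pair x0 (loop_add f g) (loop_add h k)"
    by (auto simp: fun_eq_iff loop_pair_def loop_add_def)
  also have "(infinite_sum x0 (loop_pair x0 (loop_add f g) (loop_add h k)),
      loop_add (loop_add f g) (loop_add h k)) \<in> loop_homotopy m Y x0"
    by (intro loop_homotopy_sym[OF loop_add_homotopic_infinite_sum] loops_loop_add l m1)
  finally show ?thesis .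
qed

text \<open>The middle-four exchange with zeros inserted compares \<open>(f + g) + (0 + k)\<close>
  with \<open>(f + 0) + (g + k)\<close>. A second coordinate thus replaces the usual three-interval
  reparametrization.\<close>

lemma loop_add_assoc:
  assumes m: "m \<ge> 2" and l: "f \<in> loops m Y x0" "g \<in> loops m Y x0" "k \<in> loops m Y x0"
  shows "(loop_add (loop_add f g) k, loop_add f (loop_add g k)) \<in> loop_homotopy m Y x0"
proof -
  have m1: "m \<ge> 1" using m by simp
  have c: "(\<lambda>_. x0) \<in> loops m Y x0" using loops_basepoint[OF l(1) m1] by (rule const_loop)
  have "(loop_add (loop_add f g) k, loop_add (loop_add f g) (loop_add (\<lambda>_. x0) k)) \<in> loop_homotopy m Y x0"
    by (intro loop_homotopy_add[OF m1] loop_homotopy_refl loops_loop_add l m1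
        loop_homotopy_sym[OF loop_add_const_left])
  also have "(loop_add (loop_add f g) (loop_add (\<lambda>_. x0) k), loop_add (loop_add f (\<lambda>_. x0)) (loop_add g k))
      \<in> loop_homotopy m Y x0"
    by (rule loop_add_medial[OF m l(1) c l(2,3)])
  also have "(loop_add (loop_add f (\<lambda>_. x0)) (loop_add g k), loop_add f (loop_add g k)) \<in> loop_homotopy m Y x0"
    by (intro loop_homotopy_add[OF m1] loop_homotopy_refl loops_loop_add l m1 loop_add_const_right)
  finally show ?thesis .
qed

section \<open>Homotopy classes and the group structure\<close>

lemma loop_class_eq_iff:
  assumes "f \<in> loops m Y x0"
  shows "loop_class m Y x0 f = loop_class m Y x0 g \<longleftrightarrow> (f, g) \<in> loop_homotopy m Y x0"
proof
  assume "loop_class m Y x0 f = loop_class m Y x0 g"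
  moreover have "f \<in> loop_class m Y x0 f"
    using loop_homotopy_refl[OF assms] by (simp add: loop_class_def)
  ultimately show "(f, g) \<in> loop_homotopy m Y x0"
    by (auto simp: loop_class_def intro: loop_homotopy_sym)
next
  assume "(f, g) \<in> loop_homotopy m Y x0"
  then show "loop_class m Y x0 f = loop_class m Y x0 g"
    unfolding loop_class_def by (rule equiv_class_eq[OF equiv_loop_homotopy])
qed

lemma loop_class_eqI: "(f, g) \<in> loop_homotopy m Y x0 \<Longrightarrow> loop_class m Y x0 f = loop_class m Y x0 g"
  unfolding loop_class_def by (rule equiv_class_eq[OF equiv_loop_homotopy])

lemma carrier_homotopy_group: "carrier (homotopy_group m Y x0) = loop_class m Y x0 ` loops m Y x0"
  by (auto simp: homotopy_group_def quotient_def loop_class_def)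

lemma one_homotopy_group: "\<one>\<^bsub>homotopy_group m Y x0\<^esub> = loop_class m Y x0 (\<lambda>_. x0)"
  by (simp add: homotopy_group_def)

lemma mult_homotopy_group:
  assumes m: "m \<ge> 1" and f: "f \<in> loops m Y x0" and g: "g \<in> loops m Y x0"
  shows "loop_class m Y x0 f \<otimes>\<^bsub>homotopy_group m Y x0\<^esub> loop_class m Y x0 g =
    loop_class m Y x0 (loop_add f g)"
proof -
  have "loop_class m Y x0 (loop_add f' g') = loop_class m Y x0 (loop_add f g)"
    if "f' \<in> loop_class m Y x0 f" "g' \<in> loop_class m Y x0 g" for f' g'
    using that loop_homotopy_add[OF m, of f f' Y x0 g g']
    by (intro loop_class_eqI loop_homotopy_sym[of "loop_add f g"]) (simp add: loop_class_def)
  moreover have "f \<in> loop_class m Y x0 f" "g \<in> loop_class m Y x0 g"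
    using f g by (auto simp: loop_class_def intro: loop_homotopy_refl)
  ultimately have "(\<Union>f'\<in>loop_class m Y x0 f. \<Union>g'\<in>loop_class m Y x0 g. loop_class m Y x0 (loop_add f' g')) =
      loop_class m Y x0 (loop_add f g)"
    by blast
  then show ?thesis by (simp add: homotopy_group_def)
qed

lemma group_homotopy_group:
  assumes m: "m \<ge> 2" and x0: "x0 \<in> topspace Y"
  shows "group (homotopy_group m Y x0)"
proof -
  have m1: "m \<ge> 1" using m by simp
  note mult = mult_homotopy_group[OF m1]
  show ?thesis
  proof (rule groupI)
    fix x y z
    assume "x \<in> carrier (homotopy_group m Y x0)" "y \<in> carrier (homotopy_group m Y x0)"
    then obtain f g where f: "f \<in> loops m Y x0" "x = loop_class m Y x0 f"
      and g: "g \<in> loops m Y x0" "y = loop_class m Y x0 g"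
      by (auto simp: carrier_homotopy_group)
    show "x \<otimes>\<^bsub>homotopy_group m Y x0\<^esub> y \<in> carrier (homotopy_group m Y x0)"
      using f g loops_loop_add[OF f(1) g(1) m1] mult[OF f(1) g(1)] by (simp add: carrier_homotopy_group)
    assume "z \<in> carrier (homotopy_group m Y x0)"
    then obtain h where h: "h \<in> loops m Y x0" "z = loop_class m Y x0 h"
      by (auto simp: carrier_homotopy_group)
    have "loop_class m Y x0 (loop_add (loop_add f g) h) = loop_class m Y x0 (loop_add f (loop_add g h))"
      by (rule loop_class_eqI[OF loop_add_assoc[OF m f(1) g(1) h(1)]])
    then show "x \<otimes>\<^bsub>homotopy_group m Y x0\<^esub> y \<otimes>\<^bsub>homotopy_group m Y x0\<^esub> z =
        x \<otimes>\<^bsub>homotopy_group m Y x0\<^esub> (y \<otimes>\<^bsub>homotopy_group m Y x0\<^esub> z)"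
      using f g h by (simp add: mult loops_loop_add[OF _ _ m1])
  next
    show "\<one>\<^bsub>homotopy_group m Y x0\<^esub> \<in> carrier (homotopy_group m Y x0)"
      using const_loop[OF x0] by (simp add: carrier_homotopy_group one_homotopy_group)
  next
    fix x assume "x \<in> carrier (homotopy_group m Y x0)"
    then obtain f where f: "f \<in> loops m Y x0" "x = loop_class m Y x0 f"
      by (auto simp: carrier_homotopy_group)
    show "\<one>\<^bsub>homotopy_group m Y x0\<^esub> \<otimes>\<^bsub>homotopy_group m Y x0\<^esub> x = x"
      using f mult[OF const_loop[OF x0] f(1)] loop_class_eqI[OF loop_add_const_left[OF m1 f(1)]]
      by (simp add: one_homotopy_group)
    have "loop_class m Y x0 (loop_inverse f) \<otimes>\<^bsub>homotopy_group m Y x0\<^esub> x = \<one>\<^bsub>homotopy_group m Y x0\<^esub>"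
      using f mult[OF loops_loop_inverse[OF m1 f(1)] f(1)] loop_class_eqI[OF loop_add_inverse_left[OF m1 f(1)]]
      by (simp add: one_homotopy_group)
    then show "\<exists>y\<in>carrier (homotopy_group m Y x0). y \<otimes>\<^bsub>homotopy_group m Y x0\<^esub> x = \<one>\<^bsub>homotopy_group m Y x0\<^esub>"
      using loops_loop_inverse[OF m1 f(1)] by (auto simp: carrier_homotopy_group)
  qed
qed

lemma inv_homotopy_group:
  assumes m: "m \<ge> 2" and f: "f \<in> loops m Y x0"
  shows "inv\<^bsub>homotopy_group m Y x0\<^esub> loop_class m Y x0 f = loop_class m Y x0 (loop_inverse f)"
proof -
  have m1: "m \<ge> 1" using m by simp
  interpret group "homotopy_group m Y x0"
    using group_homotopy_group[OF m loops_basepoint[OF f m1]] .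
  show ?thesis
  proof (rule inv_equality)
    show "loop_class m Y x0 (loop_inverse f) \<otimes>\<^bsub>homotopy_group m Y x0\<^esub> loop_class m Y x0 f =
        \<one>\<^bsub>homotopy_group m Y x0\<^esub>"
      using mult_homotopy_group[OF m1 loops_loop_inverse[OF m1 f] f] loop_class_eqI[OF loop_add_inverse_left[OF m1 f]]
      by (simp add: one_homotopy_group)
  qed (use f loops_loop_inverse[OF m1 f] in \<open>auto simp: carrier_homotopy_group\<close>)
qed

section \<open>Spans under infinite sums\<close>

text \<open>A bridge from null sequences of maps to loops with shrinking bounds: the images of the
  terms are themselves such bounds.\<close>

lemma null_sequences_iff:
  "f \<in> null_sequences m X x0 \<longleftrightarrow>
    (\<exists>A. shrinking_sets X x0 A \<and> (\<forall>j\<ge>1. f j \<in> loops m (subtopology X (A j)) x0))"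
proof
  assume "f \<in> null_sequences m X x0"
  then have "shrinking_sets X x0 (\<lambda>j. f j ` topspace (cube m)) \<and>
      (\<forall>j\<ge>1. f j \<in> loops m (subtopology X (f j ` topspace (cube m))) x0)"
    by (auto simp: null_sequences_def shrinking_sets_def loops_subtopology)
  then show "\<exists>A. shrinking_sets X x0 A \<and> (\<forall>j\<ge>1. f j \<in> loops m (subtopology X (A j)) x0)"
    by (rule exI[of _ "\<lambda>j. f j ` topspace (cube m)"])
next
  assume "\<exists>A. shrinking_sets X x0 A \<and> (\<forall>j\<ge>1. f j \<in> loops m (subtopology X (A j)) x0)"
  then obtain A where A: "shrinking_sets X x0 A" "\<forall>j\<ge>1. f j \<in> loops m (subtopology X (A j)) x0"
    by (elim exE conjE)
  have "shrinking_sets X x0 (\<lambda>j. f j ` topspace (cube m))"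
    using A(2) by (intro shrinking_sets_mono[OF A(1)]) (simp add: loops_subtopology)
  then show "f \<in> null_sequences m X x0"
    using A(2) by (simp add: null_sequences_def shrinking_sets_def loops_subtopology)
qed

lemma shrinking_sets_Un:
  assumes "shrinking_sets X x0 A" "shrinking_sets X x0 A'"
  shows "shrinking_sets X x0 (\<lambda>j. A j \<union> A' j)"
  unfolding shrinking_sets_def
proof (intro allI impI)
  fix U assume "openin X U \<and> x0 \<in> U"
  then have "finite ({j. 1 \<le> j \<and> \<not> A j \<subseteq> U} \<union> {j. 1 \<le> j \<and> \<not> A' j \<subseteq> U})"
    using assms by (simp add: shrinking_sets_def)
  then show "finite {j. 1 \<le> j \<and> \<not> A j \<union> A' j \<subseteq> U}"
    by (rule rev_finite_subset) auto
qed

text \<open>Up to a homotopy inside \<open>A j\<close>, the term \<open>f j\<close> is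
  \<open>f j + 0\<close> or \<open>0 + f j\<close>, as \<open>P\<close> prescribes; then
  \<open>infinite_sum_add\<close> separates the two parts.\<close>

lemma infinite_sum_split:
  assumes m: "m \<ge> 2" and x0: "x0 \<in> topspace X" "x0 \<in> B"
    and f: "\<And>j. 1 \<le> j \<Longrightarrow> f j \<in> loops m (subtopology X (A j)) x0"
    and null: "shrinking_sets X x0 A" and AB: "\<And>j. 1 \<le> j \<Longrightarrow> A j \<subseteq> B"
  shows "(infinite_sum x0 f, loop_add (infinite_sum x0 (\<lambda>j. if P j then f j else (\<lambda>_. x0)))
      (infinite_sum x0 (\<lambda>j. if P j then (\<lambda>_. x0) else f j))) \<in> loop_homotopy m (subtopology X B) x0"
proof -
  have m1: "m \<ge> 1" using m by simp
  let ?a = "\<lambda>j. if P j then f j else (\<lambda>_. x0)" and ?b = "\<lambda>j. if P j then (\<lambda>_. x0) else f j"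
  have c: "(\<lambda>_. x0) \<in> loops m (subtopology X (A j)) x0" if "1 \<le> j" for j
    using loops_basepoint[OF f[OF that] m1] by (rule const_loop)
  have "(infinite_sum x0 f, infinite_sum x0 (\<lambda>j. loop_add (?a j) (?b j))) \<in> loop_homotopy m (subtopology X B) x0"
  proof (rule loop_homotopy_infinite_sum[OF m1 x0 _ null AB])
    fix j :: nat assume j: "1 \<le> j"
    show "(f j, loop_add (?a j) (?b j)) \<in> loop_homotopy m (subtopology X (A j)) x0"
      using loop_homotopy_sym[OF loop_add_const_left[OF m1 f[OF j]]]
        loop_homotopy_sym[OF loop_add_const_right[OF m1 f[OF j]]] by simp
  qed
  also have "(infinite_sum x0 (\<lambda>j. loop_add (?a j) (?b j)), loop_add (infinite_sum x0 ?a) (infinite_sum x0 ?b))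
      \<in> loop_homotopy m (subtopology X B) x0"
    by (rule loop_homotopy_sym[OF infinite_sum_add[OF m x0 _ _ null AB]]) (use f c in simp_all)
  finally show ?thesis .
qed

text \<open>Splitting off the term with index \<open>N\<close> leaves a shorter sum and a one-term
  sum, so membership reduces to the group operation.\<close>

lemma infinite_sum_finite_support:
  assumes m: "m \<ge> 2" and x0: "x0 \<in> topspace X"
    and H: "subgroup H (homotopy_group m X x0)" and null: "shrinking_sets X x0 A"
    and f: "\<And>j. 1 \<le> j \<Longrightarrow> f j \<in> loops m (subtopology X (A j)) x0"
    and fH: "\<And>j. 1 \<le> j \<Longrightarrow> loop_class m X x0 (f j) \<in> H"
    and supp: "\<And>j. N < j \<Longrightarrow> f j = (\<lambda>_. x0)"
  shows "loop_class m X x0 (infinite_sum x0 f) \<in> H"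
  using f fH supp
proof (induction N arbitrary: f)
  case 0
  have "infinite_sum x0 f = infinite_sum x0 (\<lambda>_ _. x0)"
    by (rule infinite_sum_cong) (use 0 in simp)
  then show ?case
    using subgroup.one_closed[OF H] by (simp add: one_homotopy_group)
next
  case (Suc N)
  have m1: "m \<ge> 1" using m by simp
  let ?a = "\<lambda>j. if j \<noteq> Suc N then f j else (\<lambda>_. x0)" and ?b = "\<lambda>j. if j \<noteq> Suc N then (\<lambda>_. x0) else f j"
  have c: "(\<lambda>_. x0) \<in> loops m (subtopology X (A j)) x0" if "1 \<le> j" for j
    using loops_basepoint[OF Suc.prems(1)[OF that] m1] by (rule const_loop)
  have one: "loop_class m X x0 (\<lambda>_. x0) \<in> H"
    using subgroup.one_closed[OF H] by (simp add: one_homotopy_group)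
  have a: "?a j \<in> loops m (subtopology X (A j)) x0" "loop_class m X x0 (?a j) \<in> H" if "1 \<le> j" for j
    using Suc.prems(1,2)[OF that] c[OF that] one by (cases "j = Suc N"; simp)+
  have aH: "loop_class m X x0 (infinite_sum x0 ?a) \<in> H"
    by (rule Suc.IH) (use a Suc.prems(3) in auto)
  have fN: "f (Suc N) \<in> loops m X x0"
    using loops_full[OF Suc.prems(1)[of "Suc N"]] by simp
  have "?b = (\<lambda>j. if j = Suc N then f (Suc N) else (\<lambda>_. x0))" by auto
  then have b: "(infinite_sum x0 ?b, f (Suc N)) \<in> loop_homotopy m X x0"
    using infinite_sum_single[OF fN m1, of "Suc N"] by simp
  have Sa: "infinite_sum x0 ?a \<in> loops m X x0"
    by (rule loops_full[OF loops_infinite_sum[OF m1 x0 UNIV_I a(1) null]]) auto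
  have "loop_class m X x0 (infinite_sum x0 f) = loop_class m X x0 (loop_add (infinite_sum x0 ?a) (infinite_sum x0 ?b))"
    by (rule loop_class_eqI, rule loop_homotopy_full, rule infinite_sum_split[OF m x0 UNIV_I Suc.prems(1) null]) auto
  also have "\<dots> = loop_class m X x0 (infinite_sum x0 ?a) \<otimes>\<^bsub>homotopy_group m X x0\<^esub> loop_class m X x0 (f (Suc N))"
    using mult_homotopy_group[OF m1 Sa conjunct1[OF loop_homotopy_imp_loops[OF b]]] loop_class_eqI[OF b]
    by simp
  finally show ?case
    using subgroup.m_closed[OF H aH Suc.prems(2)[of "Suc N"]] by simp
qed

context
  fixes m :: nat and X :: "'a topology" and x0 :: 'a and S :: "((nat \<Rightarrow> real) \<Rightarrow> 'a) set set"
  assumes m: "m \<ge> 2" and x0: "x0 \<in> topspace X" and S: "S \<subseteq> carrier (homotopy_group m X x0)"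
begin

lemma generate_subgroup: "subgroup (generate (homotopy_group m X x0) S) (homotopy_group m X x0)"
  using group.generate_is_subgroup[OF group_homotopy_group[OF m x0] S] .

lemma infinite_sum_spanI:
  assumes "\<And>j. 1 \<le> j \<Longrightarrow> f j \<in> loops m (subtopology X (A j)) x0" "shrinking_sets X x0 A"
    and "\<And>j. 1 \<le> j \<Longrightarrow> loop_class m X x0 (f j) \<in> generate (homotopy_group m X x0) S"
  shows "loop_class m X x0 (infinite_sum x0 f) \<in> infinite_sum_span m X x0 S"
proof -
  have "f \<in> null_sequences m X x0"
    unfolding null_sequences_iff using assms(1,2) by (intro exI[of _ A]) simp
  then show ?thesis
    using assms(3) unfolding infinite_sum_span_def by blast
qed

lemma infinite_sum_spanE:
  assumes "x \<in> infinite_sum_span m X x0 S"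
  obtains f A where "x = loop_class m X x0 (infinite_sum x0 f)"
    "\<And>j. 1 \<le> j \<Longrightarrow> f j \<in> loops m (subtopology X (A j)) x0" "shrinking_sets X x0 A"
    "\<And>j. 1 \<le> j \<Longrightarrow> loop_class m X x0 (f j) \<in> generate (homotopy_group m X x0) S"
    "infinite_sum x0 f \<in> loops m X x0"
proof -
  obtain f where f: "x = loop_class m X x0 (infinite_sum x0 f)" "f \<in> null_sequences m X x0"
    "\<forall>j\<ge>1. loop_class m X x0 (f j) \<in> generate (homotopy_group m X x0) S"
    using assms unfolding infinite_sum_span_def by blast
  obtain A where A: "shrinking_sets X x0 A" "\<forall>j\<ge>1. f j \<in> loops m (subtopology X (A j)) x0"
    using f(2) unfolding null_sequences_iff by blast
  have "infinite_sum x0 f \<in> loops m X x0"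
    by (rule loops_full[OF loops_infinite_sum[OF _ x0 UNIV_I _ A(1)]]) (use A(2) m in auto)
  then show ?thesis
    using that[of f A] f A by blast
qed

lemma subset_infinite_sum_span: "S \<subseteq> infinite_sum_span m X x0 S"
proof
  fix x assume x: "x \<in> S"
  then obtain f where f: "f \<in> loops m X x0" "x = loop_class m X x0 f"
    using S by (auto simp: carrier_homotopy_group)
  have one: "loop_class m X x0 (\<lambda>_. x0) \<in> generate (homotopy_group m X x0) S"
    using subgroup.one_closed[OF generate_subgroup] by (simp add: one_homotopy_group)
  have "loop_class m X x0 (infinite_sum x0 (\<lambda>j. if j = 1 then f else (\<lambda>_. x0))) \<in> infinite_sum_span m X x0 S"
  proof (rule infinite_sum_spanI[OF _ shrinking_sets_two[of _ _ "topspace X"]])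
    fix j :: nat assume "1 \<le> j"
    show "(if j = 1 then f else (\<lambda>_. x0)) \<in> loops m (subtopology X (if j \<le> 2 then topspace X else {x0})) x0"
      using f x0 by (auto intro!: const_loop)
    show "loop_class m X x0 (if j = 1 then f else (\<lambda>_. x0)) \<in> generate (homotopy_group m X x0) S"
      using f x one by (auto intro: generate.incl)
  qed
  then show "x \<in> infinite_sum_span m X x0 S"
    using loop_class_eqI[OF infinite_sum_single[OF f(1), of 1]] m f(2) by simp
qed

text \<open>Products and inverses are formed term by term, which \<open>infinite_sum_add\<close>
  justifies and under which \<open>generate\<close> is closed. For a product the bounding sets of
  the two sequences are united.\<close>

lemma subgroup_infinite_sum_span:
  "subgroup (infinite_sum_span m X x0 S) (homotopy_group m X x0)"
proof -
  have m1: "m \<ge> 1" using m by simp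
  interpret group "homotopy_group m X x0" using group_homotopy_group[OF m x0] .
  interpret G: subgroup "generate (homotopy_group m X x0) S" "homotopy_group m X x0" using generate_subgroup .
  show ?thesis
  proof (rule subgroupI)
    show "infinite_sum_span m X x0 S \<subseteq> carrier (homotopy_group m X x0)"
    proof
      fix x assume "x \<in> infinite_sum_span m X x0 S"
      then show "x \<in> carrier (homotopy_group m X x0)"
        by (rule infinite_sum_spanE) (simp add: carrier_homotopy_group)
    qed
    have "loop_class m X x0 (infinite_sum x0 (\<lambda>_ _. x0)) \<in> infinite_sum_span m X x0 S"
    proof (rule infinite_sum_spanI[OF _ shrinking_sets_two[of _ _ "topspace X"]])
      show "(\<lambda>_. x0) \<in> loops m (subtopology X (if j \<le> 2 then topspace X else {x0})) x0" for j :: nat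
        using x0 by (auto intro!: const_loop)
      show "loop_class m X x0 (\<lambda>_. x0) \<in> generate (homotopy_group m X x0) S"
        using G.one_closed by (simp add: one_homotopy_group)
    qed
    then show "infinite_sum_span m X x0 S \<noteq> {}" by blast
  next
    fix x assume "x \<in> infinite_sum_span m X x0 S"
    then obtain f A where f: "x = loop_class m X x0 (infinite_sum x0 f)"
      "\<And>j. 1 \<le> j \<Longrightarrow> f j \<in> loops m (subtopology X (A j)) x0" "shrinking_sets X x0 A"
      "\<And>j. 1 \<le> j \<Longrightarrow> loop_class m X x0 (f j) \<in> generate (homotopy_group m X x0) S"
      "infinite_sum x0 f \<in> loops m X x0"
      by (rule infinite_sum_spanE) (rule that)
    have fX: "f j \<in> loops m X x0" if "1 \<le> j" for j
      by (rule loops_full[OF f(2)[OF that]])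
    have "loop_inverse (infinite_sum x0 f) \<in> loops m X x0"
      by (rule loops_loop_inverse[OF m1 f(5)])
    have inv: "loop_class m X x0 (infinite_sum x0 (\<lambda>j. loop_inverse (f j))) \<in> infinite_sum_span m X x0 S"
    proof (rule infinite_sum_spanI[OF _ f(3)])
      fix j :: nat assume j: "1 \<le> j"
      show "loop_inverse (f j) \<in> loops m (subtopology X (A j)) x0"
        by (rule loops_loop_inverse[OF m1 f(2)[OF j]])
      show "loop_class m X x0 (loop_inverse (f j)) \<in> generate (homotopy_group m X x0) S"
        using G.m_inv_closed[OF f(4)[OF j]] inv_homotopy_group[OF m fX[OF j]] by simp
    qed
    have i: "infinite_sum x0 (\<lambda>j. loop_inverse (f j)) \<in> loops m X x0"
      by (rule loops_full[OF loops_infinite_sum[OF m1 x0 UNIV_I loops_loop_inverse[OF m1 f(2)] f(3)]]) auto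
    have "(loop_add (infinite_sum x0 (\<lambda>j. loop_inverse (f j))) (infinite_sum x0 f),
        infinite_sum x0 (\<lambda>j. loop_add (loop_inverse (f j)) (f j))) \<in> loop_homotopy m (subtopology X UNIV) x0"
      by (rule infinite_sum_add[OF m x0 UNIV_I loops_loop_inverse[OF m1 f(2)] f(2,3)]) auto
    also have "(infinite_sum x0 (\<lambda>j. loop_add (loop_inverse (f j)) (f j)), infinite_sum x0 (\<lambda>_ _. x0))
        \<in> loop_homotopy m (subtopology X UNIV) x0"
      by (rule loop_homotopy_infinite_sum[OF m1 x0 UNIV_I loop_add_inverse_left[OF m1 f(2)] f(3)]) auto
    finally have "loop_class m X x0 (infinite_sum x0 (\<lambda>j. loop_inverse (f j))) \<otimes>\<^bsub>homotopy_group m X x0\<^esub> x =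
        \<one>\<^bsub>homotopy_group m X x0\<^esub>"
      using mult_homotopy_group[OF m1 i f(5)] f(1) loop_class_eqI by (simp add: one_homotopy_group)
    then have "inv\<^bsub>homotopy_group m X x0\<^esub> x = loop_class m X x0 (infinite_sum x0 (\<lambda>j. loop_inverse (f j)))"
      by (rule inv_equality) (use f(1,5) i in \<open>auto simp: carrier_homotopy_group\<close>)
    then show "inv\<^bsub>homotopy_group m X x0\<^esub> x \<in> infinite_sum_span m X x0 S"
      using inv by simp
    fix y assume "y \<in> infinite_sum_span m X x0 S"
    then obtain g A' where g: "y = loop_class m X x0 (infinite_sum x0 g)"
      "\<And>j. 1 \<le> j \<Longrightarrow> g j \<in> loops m (subtopology X (A' j)) x0" "shrinking_sets X x0 A'"
      "\<And>j. 1 \<le> j \<Longrightarrow> loop_class m X x0 (g j) \<in> generate (homotopy_group m X x0) S"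
      "infinite_sum x0 g \<in> loops m X x0"
      by (rule infinite_sum_spanE) (rule that)
    note null = shrinking_sets_Un[OF f(3) g(3)]
    have fA: "f j \<in> loops m (subtopology X (A j \<union> A' j)) x0" if "1 \<le> j" for j
      by (rule loops_mono[OF f(2)[OF that]]) simp
    have gA: "g j \<in> loops m (subtopology X (A j \<union> A' j)) x0" if "1 \<le> j" for j
      by (rule loops_mono[OF g(2)[OF that]]) simp
    have "loop_class m X x0 (infinite_sum x0 (\<lambda>j. loop_add (f j) (g j))) \<in> infinite_sum_span m X x0 S"
    proof (rule infinite_sum_spanI[OF loops_loop_add[OF fA gA m1] null])
      fix j :: nat assume j: "1 \<le> j"
      show "loop_class m X x0 (loop_add (f j) (g j)) \<in> generate (homotopy_group m X x0) S"
        using G.m_closed[OF f(4)[OF j] g(4)[OF j]]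
          mult_homotopy_group[OF m1 fX[OF j] loops_full[OF g(2)[OF j]]] by simp
    qed
    moreover have "(loop_add (infinite_sum x0 f) (infinite_sum x0 g), infinite_sum x0 (\<lambda>j. loop_add (f j) (g j)))
        \<in> loop_homotopy m (subtopology X UNIV) x0"
      by (rule infinite_sum_add[OF m x0 UNIV_I fA gA null]) auto
    ultimately show "x \<otimes>\<^bsub>homotopy_group m X x0\<^esub> y \<in> infinite_sum_span m X x0 S"
      using mult_homotopy_group[OF m1 f(5) g(5)] loop_class_eqI unfolding f(1) g(1) by fastforce
  qed
qed

text \<open>The array is cut along its diagonal.  The part with \<open>i \<le> j\<close> has finite rows, and after an
  interchange the part with \<open>i > j\<close> has finite rows too.\<close>

lemma infinite_sum_span_double:
  assumes g: "\<And>j i. 1 \<le> j \<Longrightarrow> 1 \<le> i \<Longrightarrow> g j i \<in> loops m (subtopology X (A j i)) x0"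
    and null: "shrinking_array X x0 A"
    and gS: "\<And>j i. 1 \<le> j \<Longrightarrow> 1 \<le> i \<Longrightarrow>
      loop_class m X x0 (g j i) \<in> generate (homotopy_group m X x0) S"
  shows "loop_class m X x0 (infinite_sum x0 (\<lambda>j. infinite_sum x0 (g j))) \<in> infinite_sum_span m X x0 S"
proof -
  have m1: "m \<ge> 1" using m by simp
  let ?a = "\<lambda>j i. if i \<le> j then g j i else (\<lambda>_. x0)" and ?b = "\<lambda>j i. if i \<le> j then (\<lambda>_. x0) else g j i"
  let ?R = "\<lambda>j. \<Union>i\<in>{1..}. A j i" and ?C = "\<lambda>i. \<Union>j\<in>{1..}. A j i"
  have x0A: "x0 \<in> A j i" if "1 \<le> j" "1 \<le> i" for j i
    using loops_basepoint[OF g[OF that] m1] by simp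
  have c: "(\<lambda>_. x0) \<in> loops m (subtopology X (A j i)) x0" if "1 \<le> j" "1 \<le> i" for j i
    using x0A[OF that] x0 by (intro const_loop) simp
  have one: "loop_class m X x0 (\<lambda>_. x0) \<in> generate (homotopy_group m X x0) S"
    using subgroup.one_closed[OF generate_subgroup] by (simp add: one_homotopy_group)
  have a: "?a j i \<in> loops m (subtopology X (A j i)) x0"
    and b: "?b j i \<in> loops m (subtopology X (A j i)) x0"
    and aS: "loop_class m X x0 (?a j i) \<in> generate (homotopy_group m X x0) S"
    and bS: "loop_class m X x0 (?b j i) \<in> generate (homotopy_group m X x0) S"
    if "1 \<le> j" "1 \<le> i" for j i
    using g[OF that] c[OF that] gS[OF that] one by simp_all
  have row: "infinite_sum x0 (h j) \<in> loops m (subtopology X (?R j)) x0"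
    if "\<And>j i. 1 \<le> j \<Longrightarrow> 1 \<le> i \<Longrightarrow> h j i \<in> loops m (subtopology X (A j i)) x0" "1 \<le> j" for h j
    by (rule loops_infinite_sum[OF m1 x0 _ that(1) shrinking_array_row[OF null that(2)]])
      (use x0A that(2) in auto)
  have col: "infinite_sum x0 (\<lambda>j. h j i) \<in> loops m (subtopology X (?C i)) x0"
    if "\<And>j i. 1 \<le> j \<Longrightarrow> 1 \<le> i \<Longrightarrow> h j i \<in> loops m (subtopology X (A j i)) x0" "1 \<le> i" for h i
    by (rule loops_infinite_sum[OF m1 x0 _ that(1) shrinking_array_row[OF shrinking_array_transpose[OF null] that(2)]])
      (use x0A that(2) in auto)
  note nullR = shrinking_array_union[OF null]
  note nullC = shrinking_array_union[OF shrinking_array_transpose[OF null]]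
  let ?Sa = "infinite_sum x0 (\<lambda>j. infinite_sum x0 (?a j))" and ?Sb = "infinite_sum x0 (\<lambda>j. infinite_sum x0 (?b j))"
  have Sa: "?Sa \<in> loops m X x0"
    by (rule loops_full[OF loops_infinite_sum[OF m1 x0 UNIV_I row[OF a] nullR]]) auto
  have Sb: "?Sb \<in> loops m X x0"
    by (rule loops_full[OF loops_infinite_sum[OF m1 x0 UNIV_I row[OF b] nullR]]) auto
  \<comment> \<open>Rows of \<open>?a\<close> have finite support, so their sums have classes in
    \<open>generate\<close>. Full rows would only be known to have classes in the span.\<close>
  have SaS: "loop_class m X x0 ?Sa \<in> infinite_sum_span m X x0 S"
  proof (rule infinite_sum_spanI[OF row[OF a] nullR])
    fix j :: nat assume j: "1 \<le> j"
    show "loop_class m X x0 (infinite_sum x0 (?a j)) \<in> generate (homotopy_group m X x0) S"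
      by (rule infinite_sum_finite_support[OF m x0 generate_subgroup shrinking_array_row[OF null j] a[OF j] aS[OF j], of j])
        auto
  qed
  \<comment> \<open>The roles of the indices change: column \<open>i\<close> of \<open>?b\<close> is
    constant from \<open>j = i\<close> on.\<close>
  have "loop_class m X x0 (infinite_sum x0 (\<lambda>i. infinite_sum x0 (\<lambda>j. ?b j i))) \<in> infinite_sum_span m X x0 S"
  proof (rule infinite_sum_spanI[OF col[of ?b, OF b] nullC])
    fix i :: nat assume i: "1 \<le> i"
    show "loop_class m X x0 (infinite_sum x0 (\<lambda>j. ?b j i)) \<in> generate (homotopy_group m X x0) S"
      by (rule infinite_sum_finite_support[OF m x0 generate_subgroup
            shrinking_array_row[OF shrinking_array_transpose[OF null] i] b[OF _ i] bS[OF _ i], of i]) auto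
  qed
  moreover have "(?Sb, infinite_sum x0 (\<lambda>i. infinite_sum x0 (\<lambda>j. ?b j i))) \<in> loop_homotopy m (subtopology X UNIV) x0"
    by (rule infinite_sum_interchange[OF m x0 UNIV_I b null]) auto
  ultimately have SbS: "loop_class m X x0 ?Sb \<in> infinite_sum_span m X x0 S"
    using loop_class_eqI by fastforce
  have "(infinite_sum x0 (\<lambda>j. infinite_sum x0 (g j)),
      infinite_sum x0 (\<lambda>j. loop_add (infinite_sum x0 (?a j)) (infinite_sum x0 (?b j)))) \<in> loop_homotopy m (subtopology X UNIV) x0"
  proof (rule loop_homotopy_infinite_sum[OF m1 x0 UNIV_I _ nullR])
    fix j :: nat assume j: "1 \<le> j"
    show "(infinite_sum x0 (g j), loop_add (infinite_sum x0 (?a j)) (infinite_sum x0 (?b j)))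
        \<in> loop_homotopy m (subtopology X (?R j)) x0"
      by (rule infinite_sum_split[OF m x0 _ g[OF j] shrinking_array_row[OF null j]]) (use x0A j in auto)
  qed auto
  also have "(infinite_sum x0 (\<lambda>j. loop_add (infinite_sum x0 (?a j)) (infinite_sum x0 (?b j))), loop_add ?Sa ?Sb)
      \<in> loop_homotopy m (subtopology X UNIV) x0"
    by (rule loop_homotopy_sym[OF infinite_sum_add[OF m x0 UNIV_I row[OF a] row[OF b] nullR]]) auto
  finally have "(infinite_sum x0 (\<lambda>j. infinite_sum x0 (g j)), loop_add ?Sa ?Sb) \<in> loop_homotopy m X x0"
    by (rule loop_homotopy_full)
  then have "loop_class m X x0 (infinite_sum x0 (\<lambda>j. infinite_sum x0 (g j))) =
      loop_class m X x0 ?Sa \<otimes>\<^bsub>homotopy_group m X x0\<^esub> loop_class m X x0 ?Sb"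
    unfolding mult_homotopy_group[OF m1 Sa Sb] by (rule loop_class_eqI)
  then show ?thesis
    using subgroup.m_closed[OF subgroup_infinite_sum_span SaS SbS] by simp
qed

text \<open>A subgroup containing \<open>S\<close> contains \<open>generate\<close>; if it is closed
  under infinite sums, it therefore contains the span. Once the span is closed itself, it is one of
  the subgroups being intersected.\<close>

lemma cl_Sigma_eq_infinite_sum_span:
  assumes "closed_under_infinite_sums m X x0 (infinite_sum_span m X x0 S)"
  shows "infinite_sum_span m X x0 S = cl_Sigma m X x0 S"
proof
  show "cl_Sigma m X x0 S \<subseteq> infinite_sum_span m X x0 S"
    unfolding cl_Sigma_def
    using assms subgroup_infinite_sum_span subset_infinite_sum_span by blast
  show "infinite_sum_span m X x0 S \<subseteq> cl_Sigma m X x0 S"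
    unfolding cl_Sigma_def
  proof (intro subsetI InterI)
    fix x H assume x: "x \<in> infinite_sum_span m X x0 S"
      and "H \<in> {H. subgroup H (homotopy_group m X x0) \<and> S \<subseteq> H \<and> closed_under_infinite_sums m X x0 H}"
    then have H: "subgroup H (homotopy_group m X x0)" "S \<subseteq> H" "closed_under_infinite_sums m X x0 H"
      by auto
    have "generate (homotopy_group m X x0) S \<subseteq> H"
      by (rule group.generate_subgroup_incl[OF group_homotopy_group[OF m x0] H(2,1)])
    then show "x \<in> H"
      using x H(3) unfolding infinite_sum_span_def closed_under_infinite_sums_def by blast
  qed
qed

end

section \<open>Homotopies on CW-complexes\<close>

text \<open>Compactness of \<open>J\<close> yields one neighbourhood of \<open>y\<close> that serves
  all times in \<open>J\<close>.\<close>

lemma openin_tube: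
  assumes G: "continuous_map (cylinder Y) Z G"
    and J: "compactin unit_interval J" and U: "openin Z U"
  shows "openin Y {y \<in> topspace Y. \<forall>s\<in>J. G (s, y) \<in> U}"
proof (subst openin_subopen, intro ballI)
  fix y assume y: "y \<in> {y \<in> topspace Y. \<forall>s\<in>J. G (s, y) \<in> U}"
  let ?W = "{z \<in> topspace (cylinder Y). G z \<in> U}"
  have W: "openin (cylinder Y) ?W"
    using G U by (rule openin_continuous_map_preimage)
  have JI: "J \<subseteq> {0..1}" using compactin_subset_topspace[OF J] by simp
  have "J \<times> {y} \<subseteq> ?W" using y JI by auto
  then obtain S V where "openin Y V" "J \<subseteq> S" "y \<in> V" "S \<times> V \<subseteq> ?W"
    using tube_lemma_left[OF W J, of y] y by auto
  then show "\<exists>T. openin Y T \<and> y \<in> T \<and> T \<subseteq> {y \<in> topspace Y. \<forall>s\<in>J. G (s, y) \<in> U}"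
    using openin_subset[of Y V] by (intro exI[of _ V]) blast
qed

text \<open>This is the exponential law in another form: the hypotheses express continuity of the
  map from \<open>Y\<close> into the paths in \<open>Z\<close> with the compact-open topology, and
  the interval is locally compact. Only open sets of \<open>Y\<close> remain to be checked, so a
  weak topology or a wedge topology on \<open>Y\<close> can be used although the domain is a
  product.\<close>

lemma continuous_map_tube:
  assumes slice: "\<And>y. y \<in> topspace Y \<Longrightarrow> continuous_map unit_interval Z (\<lambda>s. G (s, y))"
    and tube: "\<And>J U. compactin unit_interval J \<Longrightarrow> openin Z U \<Longrightarrow>
      openin Y {y \<in> topspace Y. \<forall>s\<in>J. G (s, y) \<in> U}"
  shows "continuous_map (cylinder Y) Z G"
  unfolding continuous_map
proof (intro conjI allI impI)
  show "G ` topspace (cylinder Y) \<subseteq> topspace Z"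
  proof
    fix w assume "w \<in> G ` topspace (cylinder Y)"
    then obtain t y where ty: "w = G (t, y)" "t \<in> {0..1}" "y \<in> topspace Y" by auto
    then show "w \<in> topspace Z"
      using continuous_map_image_subset_topspace[OF slice[OF ty(3)]] by auto
  qed
  fix U assume U: "openin Z U"
  show "openin (cylinder Y) {p \<in> topspace (cylinder Y). G p \<in> U}"
    (is "openin _ ?P")
  proof (subst openin_subopen, intro ballI)
    fix p assume "p \<in> ?P"
    then obtain t y where p: "p = (t, y)" "t \<in> {0..1}" "y \<in> topspace Y" "G (t, y) \<in> U" by auto
    have "openin unit_interval {s \<in> topspace unit_interval. G (s, y) \<in> U}"
      by (rule openin_continuous_map_preimage[OF slice[OF p(3)] U])
    then obtain e where e: "e > 0" "\<forall>s\<in>{0..1}. dist s t < e \<longrightarrow> G (s, y) \<in> U"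
      using p unfolding openin_euclidean_subtopology_iff by auto
    \<comment> \<open>Radius \<open>e / 2\<close> leaves room for a closed, hence compact, set of
      times on which the slice stays in \<open>U\<close>; the tube over it contains an open box
      around \<open>p\<close>.\<close>
    define J where "J = {0..1} \<inter> cball t (e / 2)"
    define T where "T = {0..1} \<inter> ball t (e / 2)"
    have J: "compactin unit_interval J"
      by (auto simp: J_def compactin_subtopology intro: closed_Int_compact)
    have T: "openin unit_interval T"
      by (auto simp: T_def openin_open)
    have "G (s, y) \<in> U" if "s \<in> J" for s
      using e that by (auto simp: J_def dist_commute)
    then have "openin (cylinder Y) (T \<times> {y \<in> topspace Y. \<forall>s\<in>J. G (s, y) \<in> U})"
      "p \<in> T \<times> {y \<in> topspace Y. \<forall>s\<in>J. G (s, y) \<in> U}"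
      using T tube[OF J U] p e(1) by (auto simp: openin_prod_Times_iff T_def)
    moreover have "T \<times> {y \<in> topspace Y. \<forall>s\<in>J. G (s, y) \<in> U} \<subseteq> ?P"
      by (auto simp: T_def J_def)
    ultimately show "\<exists>T. openin (cylinder Y) T \<and> p \<in> T \<and> T \<subseteq> ?P"
      by blast
  qed
qed

abbreviation disc :: "nat \<Rightarrow> (nat \<Rightarrow> real) set" where
  "disc n \<equiv> topspace (unit_disc n)"

text \<open>Writing the norm as \<open>L2_set\<close> makes the triangle inequality and homogeneity
  available.\<close>

lemma topspace_unit_disc: "disc n = {x. (\<forall>i\<ge>n. x i = 0) \<and> L2_set x {..<n} \<le> 1}"
  by (auto simp: unit_disc_def topspace_Euclidean_space L2_set_def)

lemma unit_disc_interior_iff: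
  "x \<in> unit_disc_interior n \<longleftrightarrow> x \<in> disc n \<and> L2_set x {..<n} < 1"
  by (auto simp: unit_disc_interior_def L2_set_def)

lemma unit_disc_sphere_iff:
  "x \<in> unit_disc_sphere n \<longleftrightarrow> x \<in> disc n \<and> L2_set x {..<n} = 1"
  by (auto simp: unit_disc_sphere_def L2_set_def)

lemma continuous_map_into_unit_disc:
  "continuous_map Z (unit_disc n) f \<longleftrightarrow>
    (\<forall>i<n. continuous_map Z euclideanreal (\<lambda>z. f z i)) \<and> f \<in> topspace Z \<rightarrow> disc n"
proof -
  have zero: "continuous_map Z euclideanreal (\<lambda>z. f z i)"
    if "f \<in> topspace Z \<rightarrow> disc n" "\<not> i < n" for i
    by (rule continuous_map_eq[of _ _ "\<lambda>_. 0"])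
      (use that in \<open>auto simp: topspace_unit_disc Pi_iff\<close>)
  have "continuous_map Z (unit_disc n) f \<longleftrightarrow>
    (\<forall>i. continuous_map Z euclideanreal (\<lambda>z. f z i)) \<and> f \<in> topspace Z \<rightarrow> disc n"
    unfolding unit_disc_def Euclidean_space_def subtopology_subtopology
    by (auto simp: continuous_map_in_subtopology continuous_map_componentwise_UNIV)
  then show ?thesis using zero by blast
qed

lemma continuous_map_unit_disc_coordinate: "continuous_map (unit_disc n) euclideanreal (\<lambda>x. x i)"
  unfolding unit_disc_def Euclidean_space_def subtopology_subtopology
  by (intro continuous_map_from_subtopology continuous_map_product_projection) simp

lemma continuous_map_L2_set:
  fixes n :: nat
  assumes "\<And>i. i < n \<Longrightarrow> continuous_map Z euclideanreal (\<lambda>z. f z i)"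
  shows "continuous_map Z euclideanreal (\<lambda>z. L2_set (f z) {..<n})"
proof -
  have "continuous_map Z euclideanreal (\<lambda>z. \<Sum>i<n. (f z i)\<^sup>2)"
    by (intro continuous_map_sum continuous_map_real_pow) (use assms in auto)
  moreover have "continuous_map euclideanreal euclideanreal sqrt"
    by (simp add: continuous_on_real_sqrt continuous_on_id)
  ultimately have "continuous_map Z euclideanreal (sqrt \<circ> (\<lambda>z. \<Sum>i<n. (f z i)\<^sup>2))"
    by (rule continuous_map_compose)
  then show ?thesis by (simp add: L2_set_def o_def)
qed

text \<open>The disc is closed in a power of the line and lies in a product of copies of
  \<open>{-1..1}\<close>, which is compact by Tychonoff.\<close>

lemma compact_space_unit_disc: "compact_space (unit_disc n)"
proof -
  let ?P = "powertop_real (UNIV :: nat set)"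
  have "closedin ?P {x \<in> topspace ?P. \<forall>i\<ge>n. x i \<in> {0}}"
  proof -
    have "{x \<in> topspace ?P. \<forall>i\<ge>n. x i \<in> {0}} = topspace (Euclidean_space n)"
      by (auto simp: topspace_Euclidean_space)
    then show ?thesis by (simp add: closedin_Euclidean_space)
  qed
  moreover have "closedin ?P {x \<in> topspace ?P. L2_set x {..<n} \<in> {..1}}"
    by (rule closedin_continuous_map_preimage[of _ euclideanreal])
      (auto intro!: continuous_map_L2_set continuous_map_product_projection)
  ultimately have "closedin ?P ({x \<in> topspace ?P. \<forall>i\<ge>n. x i \<in> {0}} \<inter> {x \<in> topspace ?P. L2_set x {..<n} \<in> {..1}})"
    by (rule closedin_Int)
  moreover have "{x \<in> topspace ?P. \<forall>i\<ge>n. x i \<in> {0}} \<inter> {x \<in> topspace ?P. L2_set x {..<n} \<in> {..1}} = disc n"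
    by (auto simp: topspace_unit_disc)
  ultimately have cl: "closedin ?P (disc n)" by simp
  have "compactin ?P (UNIV \<rightarrow>\<^sub>E {-1..1})"
    by (simp add: compactin_PiE)
  moreover have "disc n \<subseteq> UNIV \<rightarrow>\<^sub>E {-1..1}"
  proof
    fix x assume x: "x \<in> disc n"
    have "x i \<in> {-1..1}" for i
    proof (cases "i < n")
      case True
      then have "\<bar>x i\<bar> \<le> L2_set x {..<n}"
        using member_le_L2_set[of "{..<n}" i "\<lambda>i. \<bar>x i\<bar>"] by (simp add: L2_set_def)
      then show ?thesis using x by (auto simp: topspace_unit_disc)
    qed (use x in \<open>auto simp: topspace_unit_disc\<close>)
    then show "x \<in> UNIV \<rightarrow>\<^sub>E {-1..1}" by auto
  qed
  ultimately have "compactin ?P (disc n)"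
    using cl closed_compactin by blast
  moreover have "disc n = {x. \<forall>i\<ge>n. x i = 0} \<inter> {x. (\<Sum>i<n. (x i)\<^sup>2) \<le> 1}"
    by (auto simp: unit_disc_def topspace_Euclidean_space)
  then have "unit_disc n = subtopology ?P (disc n)"
    by (simp only: unit_disc_def Euclidean_space_def subtopology_subtopology)
  ultimately show ?thesis
    using compact_space_subtopology[of ?P "disc n"] by simp
qed

lemma scale_unit_disc:
  assumes "x \<in> disc n" "0 \<le> c" "c * L2_set x {..<n} \<le> 1"
  shows "(\<lambda>i. c * x i) \<in> disc n"
  using assms by (simp add: topspace_unit_disc L2_set_right_distrib)

section \<open>Continuity on the cylinder over a CW-complex, cell by cell\<close>

locale CW_space =
  fixes X :: "'a topology" and C :: "(nat \<times> ((nat \<Rightarrow> real) \<Rightarrow> 'a)) set"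
  assumes Hausdorff: "Hausdorff_space X" and CW: "CW_structure X C"
begin

lemma char_map:
  assumes "(n, \<phi>) \<in> C"
  shows "continuous_map (unit_disc n) X \<phi>" "inj_on \<phi> (unit_disc_interior n)"
proof -
  have "continuous_map (unit_disc n) X \<phi>" and h: "homeomorphic_map (subtopology (unit_disc n) (unit_disc_interior n))
          (subtopology X (\<phi> ` unit_disc_interior n)) \<phi>"
    using CW assms unfolding CW_structure_def by auto
  then show "continuous_map (unit_disc n) X \<phi>" by simp
  have "unit_disc_interior n \<subseteq> disc n" by (auto simp: unit_disc_interior_iff)
  then show "inj_on \<phi> (unit_disc_interior n)"
    using homeomorphic_imp_injective_map[OF h] by (simp add: inf.absorb2)
qed

lemma cells_disjoint:
  assumes "(n, \<phi>) \<in> C" "(k, \<psi>) \<in> C" "x \<in> unit_disc_interior n" "y \<in> unit_disc_interior k" "\<phi> x = \<psi> y"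
  shows "n = k \<and> \<phi> = \<psi> \<and> x = y"
proof -
  have "(n, \<phi>) = (k, \<psi>)"
  proof (rule ccontr)
    assume "(n, \<phi>) \<noteq> (k, \<psi>)"
    moreover have "\<forall>(n, \<phi>) \<in> C. \<forall>(k, \<psi>) \<in> C. (n, \<phi>) \<noteq> (k, \<psi>) \<longrightarrow>
        disjnt (\<phi> ` unit_disc_interior n) (\<psi> ` unit_disc_interior k)"
      using CW unfolding CW_structure_def by (elim conjE)
    ultimately have "disjnt (\<phi> ` unit_disc_interior n) (\<psi> ` unit_disc_interior k)"
      using assms(1,2) by fast
    then show False using assms(3-5) unfolding disjnt_def by blast
  qed
  then show ?thesis using assms char_map(2)[OF assms(1)] by (auto dest: inj_onD)
qed

lemma cell_exists:
  assumes "z \<in> topspace X"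
  obtains n \<phi> x where "(n, \<phi>) \<in> C" "x \<in> unit_disc_interior n" "\<phi> x = z"
proof -
  have "z \<in> (\<Union>(n, \<phi>) \<in> C. \<phi> ` unit_disc_interior n)"
    using CW assms unfolding CW_structure_def by metis
  then show ?thesis using that by auto
qed

lemma cell_boundary:
  assumes "(n, \<phi>) \<in> C"
  obtains F where "F \<subseteq> C" "finite F" "\<And>k \<psi>. (k, \<psi>) \<in> F \<Longrightarrow> k < n"
    "\<phi> ` unit_disc_sphere n \<subseteq> (\<Union>(k, \<psi>) \<in> F. \<psi> ` unit_disc_interior k)"
proof -
  have "\<forall>(n, \<phi>) \<in> C. \<exists>F \<subseteq> C. finite F \<and> (\<forall>(k, \<psi>) \<in> F. k < n) \<and>
      \<phi> ` unit_disc_sphere n \<subseteq> (\<Union>(k, \<psi>) \<in> F. \<psi> ` unit_disc_interior k)"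
    using CW unfolding CW_structure_def by (elim conjE)
  from bspec[OF this assms] obtain F where "F \<subseteq> C" "finite F" "\<forall>(k, \<psi>) \<in> F. k < n"
    "\<phi> ` unit_disc_sphere n \<subseteq> (\<Union>(k, \<psi>) \<in> F. \<psi> ` unit_disc_interior k)"
    by (simp only: prod.case) (elim exE conjE)
  then show ?thesis using that[of F] by blast
qed

lemma closedin_iff_cells:
  "A \<subseteq> topspace X \<Longrightarrow> closedin X A \<longleftrightarrow> (\<forall>(n, \<phi>) \<in> C. closedin X (A \<inter> \<phi> ` disc n))"
  using CW unfolding CW_structure_def by blast

lemma char_map_in_space: "(n, \<phi>) \<in> C \<Longrightarrow> x \<in> disc n \<Longrightarrow> \<phi> x \<in> topspace X"
  using continuous_map_image_subset_topspace[OF char_map(1)] by blast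

lemma closedin_cell: "(n, \<phi>) \<in> C \<Longrightarrow> closedin X (\<phi> ` disc n)"
  using compact_space_unit_disc[of n]
  by (intro compactin_imp_closedin[OF Hausdorff] image_compactin[OF _ char_map(1)])
    (simp_all add: compact_space_def)

text \<open>The characteristic map times the interval is a continuous surjection from a compact
  space to a Hausdorff space, hence closed, hence a quotient map.\<close>

lemma continuous_map_on_cell:
  assumes c: "(n, \<phi>) \<in> C"
    and G: "continuous_map (cylinder (unit_disc n)) Z (\<lambda>(t, x). G (t, \<phi> x))"
  shows "continuous_map (cylinder (subtopology X (\<phi> ` disc n))) Z G"
proof -
  let ?K = "subtopology X (\<phi> ` disc n)"
  let ?f = "\<lambda>(t, x). (t, \<phi> x)"
  have K: "topspace ?K = \<phi> ` disc n"
    using char_map_in_space[OF c] by auto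
  have cont: "continuous_map (cylinder (unit_disc n)) (cylinder ?K) ?f"
    by (subst continuous_map_prod_top)
      (auto simp: continuous_map_id[unfolded id_def] continuous_map_in_subtopology char_map(1)[OF c])
  have "closed_map (cylinder (unit_disc n)) (cylinder ?K) ?f"
  proof (rule continuous_imp_closed_map[OF cont])
    show "compact_space (cylinder (unit_disc n))"
      by (simp add: compact_space_prod_topology compact_space_unit_disc compact_space_subtopology)
    show "Hausdorff_space (cylinder ?K)"
      by (simp add: Hausdorff_space_prod_topology Hausdorff_space_subtopology Hausdorff)
  qed
  moreover have "?f ` topspace (cylinder (unit_disc n)) = topspace (cylinder ?K)"
    unfolding topspace_prod_topology K by auto
  ultimately have q: "quotient_map (cylinder (unit_disc n)) (cylinder ?K) ?f"
    using cont by (intro continuous_closed_imp_quotient_map)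
  show ?thesis
    by (rule continuous_compose_quotient_map[OF q]) (use G in \<open>simp add: o_def case_prod_unfold\<close>)
qed

text \<open>The weak topology is given for \<open>X\<close>, not for its product with the interval.
  The tube criterion reduces the claim to a subset of \<open>X\<close>, whose complement is shown to
  meet every closed cell in a closed set.\<close>

lemma continuous_map_cellwise:
  assumes G: "\<And>n \<phi>. (n, \<phi>) \<in> C \<Longrightarrow>
      continuous_map (cylinder (unit_disc n)) Z (\<lambda>(t, x). G (t, \<phi> x))"
  shows "continuous_map (cylinder X) Z G"
proof (rule continuous_map_tube)
  fix y assume y: "y \<in> topspace X"
  then obtain n \<phi> x where c: "(n, \<phi>) \<in> C" "x \<in> unit_disc_interior n" "\<phi> x = y"
    by (rule cell_exists)
  have "continuous_map unit_interval (cylinder (unit_disc n)) (\<lambda>s. (s, x))"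
    using c(2) by (intro continuous_map_pairedI) (auto simp: unit_disc_interior_iff)
  from continuous_map_compose[OF this G[OF c(1)]]
  show "continuous_map unit_interval Z (\<lambda>s. G (s, y))" by (simp add: o_def c(3))
next
  fix J U assume J: "compactin unit_interval J" and U: "openin Z U"
  let ?V = "{y \<in> topspace X. \<forall>s\<in>J. G (s, y) \<in> U}"
  have "closedin X ((topspace X - ?V) \<inter> \<phi> ` disc n)" if c: "(n, \<phi>) \<in> C" for n \<phi>
  proof -
    let ?K = "subtopology X (\<phi> ` disc n)"
    have "openin ?K {y \<in> topspace ?K. \<forall>s\<in>J. G (s, y) \<in> U}"
      by (rule openin_tube[OF continuous_map_on_cell[OF c G[OF c]] J U])
    then have "closedin ?K (topspace ?K - {y \<in> topspace ?K. \<forall>s\<in>J. G (s, y) \<in> U})"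
      by (rule closedin_diff[OF closedin_topspace])
    then have "closedin X (topspace ?K - {y \<in> topspace ?K. \<forall>s\<in>J. G (s, y) \<in> U})"
      using closedin_cell[OF c] by (rule closedin_trans_full)
    moreover have "topspace ?K - {y \<in> topspace ?K. \<forall>s\<in>J. G (s, y) \<in> U} =
        (topspace X - ?V) \<inter> \<phi> ` disc n" by auto
    ultimately show ?thesis by simp
  qed
  then have "closedin X (topspace X - ?V)"
    by (subst closedin_iff_cells) auto
  then show "openin X ?V"
    by (simp add: closedin_def double_diff Int_absorb1)
qed

section \<open>Retracting the cylinder onto its bottom and the cylinders of low-dimensional
  cells\<close>

definition locate :: "'a \<Rightarrow> nat \<times> ((nat \<Rightarrow> real) \<Rightarrow> 'a) \<times> (nat \<Rightarrow> real)" where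
  "locate z = (SOME (n, \<phi>, x). (n, \<phi>) \<in> C \<and> x \<in> unit_disc_interior n \<and> \<phi> x = z)"

abbreviation dim :: "'a \<Rightarrow> nat" where "dim z \<equiv> fst (locate z)"

text \<open>Open cells are disjoint and characteristic maps are injective on open discs, so the
  choice in \<open>locate\<close> is forced.\<close>

lemma locate_char_map:
  assumes "(n, \<phi>) \<in> C" "x \<in> unit_disc_interior n"
  shows "locate (\<phi> x) = (n, \<phi>, x)"
  unfolding locate_def
proof (rule some_equality)
  fix c assume "case c of (k, \<psi>, y) \<Rightarrow> (k, \<psi>) \<in> C \<and> y \<in> unit_disc_interior k \<and> \<psi> y = \<phi> x"
  then obtain k \<psi> y where c: "c = (k, \<psi>, y)" "(k, \<psi>) \<in> C" "y \<in> unit_disc_interior k" "\<phi> x = \<psi> y"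
    by (cases c) auto
  then show "c = (n, \<phi>, x)"
    using cells_disjoint[OF assms(1) c(2) assms(2) c(3,4)] by simp
qed (use assms in simp)

text \<open>Closure-finiteness covers the image of the sphere by open cells of smaller
  dimension.\<close>

lemma dim_char_map_sphere:
  assumes "(n, \<phi>) \<in> C" "x \<in> unit_disc_sphere n"
  shows "dim (\<phi> x) < n"
proof -
  obtain F where F: "F \<subseteq> C" "\<And>k \<psi>. (k, \<psi>) \<in> F \<Longrightarrow> k < n"
    "\<phi> ` unit_disc_sphere n \<subseteq> (\<Union>(k, \<psi>) \<in> F. \<psi> ` unit_disc_interior k)"
    using cell_boundary[OF assms(1)] by metis
  then obtain k \<psi> y where "(k, \<psi>) \<in> F" "y \<in> unit_disc_interior k" "\<phi> x = \<psi> y"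
    using assms(2) by blast
  then show ?thesis using locate_char_map[of k \<psi> y] F by auto
qed

lemma unit_disc_cases:
  assumes "x \<in> disc n"
  obtains "x \<in> unit_disc_interior n" | "x \<in> unit_disc_sphere n" "x \<notin> unit_disc_interior n"
  using assms by (force simp: unit_disc_interior_iff unit_disc_sphere_iff topspace_unit_disc)

lemma dim_char_map_le: "(n, \<phi>) \<in> C \<Longrightarrow> x \<in> disc n \<Longrightarrow> dim (\<phi> x) \<le> n"
  using locate_char_map[of n \<phi> x] dim_char_map_sphere[of n \<phi> x] unit_disc_cases[of x n]
  by (metis fst_conv less_imp_le order_refl)

text \<open>The retraction of \<open>D\<^sup>n \<times> I\<close> onto \<open>D\<^sup>n \<times> 0 \<union> S\<^sup>n\<^sup>-\<^sup>1 \<times> I\<close> by projection from the point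
  \<open>(0, 2)\<close>, transported to the cells of dimension greater than \<open>d\<close>.\<close>

definition push :: "nat \<Rightarrow> real \<times> 'a \<Rightarrow> real \<times> 'a" where
  "push d = (\<lambda>(t, z). if dim z \<le> d then (t, z)
     else case locate z of (n, \<phi>, x) \<Rightarrow>
       if L2_set x {..<n} \<le> 1 - t / 2 then (0, \<phi> (\<lambda>i. 1 / (1 - t / 2) * x i))
       else (2 - (2 - t) / L2_set x {..<n}, \<phi> (\<lambda>i. 1 / L2_set x {..<n} * x i)))"

text \<open>Iterating \<open>push\<close> replaces the usual induction over skeleta. As many pushes
  as the dimension of the cell suffice, because a push that moves a point takes it to the bottom or
  into a cell of smaller dimension.\<close>

definition retract :: "nat \<Rightarrow> real \<times> 'a \<Rightarrow> real \<times> 'a" where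
  "retract d p = (push d ^^ dim (snd p)) p"

lemma push_low: "dim z \<le> d \<Longrightarrow> push d (t, z) = (t, z)"
  by (simp add: push_def)

lemma push_char_map:
  assumes "(n, \<phi>) \<in> C" "x \<in> unit_disc_interior n" "d < n"
  shows "push d (t, \<phi> x) = (if L2_set x {..<n} \<le> 1 - t / 2 then (0, \<phi> (\<lambda>i. 1 / (1 - t / 2) * x i))
       else (2 - (2 - t) / L2_set x {..<n}, \<phi> (\<lambda>i. 1 / L2_set x {..<n} * x i)))"
  using locate_char_map[OF assms(1,2)] assms(3) by (simp add: push_def)

lemma push_0: "z \<in> topspace X \<Longrightarrow> push d (0, z) = (0, z)"
proof -
  assume "z \<in> topspace X"
  then obtain n \<phi> x where c: "(n, \<phi>) \<in> C" "x \<in> unit_disc_interior n" "\<phi> x = z"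
    by (rule cell_exists)
  show ?thesis
    using push_char_map[OF c(1,2), of d 0] push_low[of z d 0] locate_char_map[OF c(1,2)] c(2,3)
    by (cases "d < n") (auto simp: unit_disc_interior_iff)
qed

text \<open>The line from height \<open>2\<close> above the origin of the disc through
  \<open>x\<close> at height \<open>t\<close> meets the bottom plane at
  \<open>x / (1 - t / 2)\<close>; the bound puts this point inside the disc.\<close>

lemma inner_scale:
  assumes "x \<in> disc n" "L2_set x {..<n} \<le> 1 - t / 2" "t \<in> {0..1}"
  shows "(\<lambda>i. 1 / (1 - t / 2) * x i) \<in> disc n"
  by (rule scale_unit_disc) (use assms in \<open>auto simp: field_simps\<close>)

text \<open>From the bound on, the same line meets the side wall over \<open>x / |x|\<close>, at
  height \<open>2 - (2 - t) / |x|\<close>.\<close>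

lemma outer_scale:
  assumes "x \<in> disc n" "L2_set x {..<n} \<ge> 1 - t / 2" "t \<in> {0..1}"
  shows "(\<lambda>i. 1 / L2_set x {..<n} * x i) \<in> unit_disc_sphere n"
    "2 - (2 - t) / L2_set x {..<n} \<in> {0..1}"
proof -
  have pos: "L2_set x {..<n} > 0" using assms(2,3) by auto
  have "(\<lambda>i. 1 / L2_set x {..<n} * x i) \<in> disc n"
    by (rule scale_unit_disc[OF assms(1)]) (use pos in auto)
  moreover have "L2_set (\<lambda>i. 1 / L2_set x {..<n} * x i) {..<n} = 1 / L2_set x {..<n} * L2_set x {..<n}"
    using pos by (subst L2_set_right_distrib) auto
  ultimately show "(\<lambda>i. 1 / L2_set x {..<n} * x i) \<in> unit_disc_sphere n"
    using pos by (simp add: unit_disc_sphere_iff)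
  have "L2_set x {..<n} \<le> 1" using assms(1) by (simp add: topspace_unit_disc)
  then show "2 - (2 - t) / L2_set x {..<n} \<in> {0..1}"
    using pos assms(2,3) by (auto simp: field_simps)
qed

text \<open>The three outcomes make the iteration terminate: nothing moves, or the bottom is
  reached, where later pushes are trivial, or the dimension drops.\<close>

lemma push_cases:
  assumes "t \<in> {0..1}" "z \<in> topspace X"
  shows "fst (push d (t, z)) \<in> {0..1} \<and> snd (push d (t, z)) \<in> topspace X \<and>
    (push d (t, z) = (t, z) \<or> fst (push d (t, z)) = 0 \<and> dim (snd (push d (t, z))) \<le> dim z \<or>
      dim (snd (push d (t, z))) < dim z)"
proof (cases "dim z \<le> d")
  case False
  obtain n \<phi> x where c: "(n, \<phi>) \<in> C" "x \<in> unit_disc_interior n" "\<phi> x = z"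
    using assms(2) by (rule cell_exists)
  have x: "x \<in> disc n" using c(2) by (simp add: unit_disc_interior_iff)
  have dim: "dim z = n" using locate_char_map[OF c(1,2)] c(3) by simp
  have p: "push d (t, z) = (if L2_set x {..<n} \<le> 1 - t / 2 then (0, \<phi> (\<lambda>i. 1 / (1 - t / 2) * x i))
       else (2 - (2 - t) / L2_set x {..<n}, \<phi> (\<lambda>i. 1 / L2_set x {..<n} * x i)))"
    using push_char_map[OF c(1,2), of d t] False dim c(3) by simp
  show ?thesis
  proof (cases "L2_set x {..<n} \<le> 1 - t / 2")
    case True
    note s = inner_scale[OF x True assms(1)]
    show ?thesis
      using char_map_in_space[OF c(1) s] dim_char_map_le[OF c(1) s] p True dim by simp
  next
    case F: False
    note s = outer_scale[OF x _ assms(1)]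
    have "(\<lambda>i. 1 / L2_set x {..<n} * x i) \<in> disc n"
      using s(1) F by (simp add: unit_disc_sphere_iff)
    then show ?thesis
      using char_map_in_space[OF c(1)] dim_char_map_sphere[OF c(1) s(1)] s(2) p F dim by simp
  qed
qed (use assms push_low[of z d t] in simp)

text \<open>Induction on the bound for \<open>dim z\<close>, along the three outcomes in
  \<open>push_cases\<close>.\<close>

lemma push_funpow_fixed:
  assumes "t \<in> {0..1}" "z \<in> topspace X" "dim z \<le> k"
  shows "push d ((push d ^^ k) (t, z)) = (push d ^^ k) (t, z)"
  using assms
proof (induction k arbitrary: t z)
  case 0
  then show ?case by (simp add: push_low)
next
  case (Suc k)
  obtain t' z' where p: "push d (t, z) = (t', z')" by fastforce
  have z': "t' \<in> {0..1}" "z' \<in> topspace X"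
    and or: "(t', z') = (t, z) \<or> t' = 0 \<and> dim z' \<le> dim z \<or> dim z' < dim z"
    using push_cases[OF Suc.prems(1,2), of d] p by auto
  have fixed: "(push d ^^ j) q = q" if "push d q = q" for j q
    using that by (induction j) auto
  have "push d ((push d ^^ k) (t', z')) = (push d ^^ k) (t', z')"
    using or
  proof (elim disjE)
    assume "(t', z') = (t, z)"
    then show ?thesis using p fixed[of "(t, z)"] by simp
  next
    assume "t' = 0 \<and> dim z' \<le> dim z"
    then show ?thesis using push_0[OF z'(2)] fixed[of "(0, z')"] by simp
  next
    assume "dim z' < dim z"
    then show ?thesis using Suc.IH[OF z'] Suc.prems(3) by simp
  qed
  then show ?case by (simp only: funpow_Suc_right o_apply p)
qed

text \<open>Pushes beyond the required number change nothing. Hence a point and its push can be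
  compared although their dimensions may differ.\<close>

lemma push_funpow_eq_retract:
  assumes "t \<in> {0..1}" "z \<in> topspace X" "dim z \<le> k"
  shows "(push d ^^ k) (t, z) = retract d (t, z)"
proof -
  have "(push d ^^ (dim z + j)) (t, z) = retract d (t, z)" for j
  proof (induction j)
    case (Suc j)
    then show ?case
      using push_funpow_fixed[OF assms(1,2) order_refl, of d] by (simp add: retract_def)
  qed (simp add: retract_def)
  from this[of "k - dim z"] show ?thesis using assms(3) by simp
qed

lemma retract_push:
  assumes "t \<in> {0..1}" "z \<in> topspace X"
  shows "retract d (push d (t, z)) = retract d (t, z)"
proof -
  obtain t' z' where p: "push d (t, z) = (t', z')" by fastforce
  have z': "t' \<in> {0..1}" "z' \<in> topspace X" "dim z' \<le> dim z"
    using push_cases[OF assms, of d] p by auto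
  have "retract d (push d (t, z)) = (push d ^^ dim z) (push d (t, z))"
    using push_funpow_eq_retract[OF z', of d] p by simp
  also have "\<dots> = (push d ^^ Suc (dim z)) (t, z)" by (simp add: funpow_swap1)
  also have "\<dots> = retract d (t, z)" by (rule push_funpow_eq_retract[OF assms]) simp
  finally show ?thesis .
qed

lemma retract_fixed: "push d p = p \<Longrightarrow> retract d p = p"
proof -
  assume "push d p = p"
  then have "(push d ^^ j) p = p" for j by (induction j) auto
  then show ?thesis by (simp add: retract_def)
qed

lemma retract_low: "dim z \<le> d \<Longrightarrow> retract d (t, z) = (t, z)"
  by (simp add: retract_fixed push_low)

lemma retract_0: "z \<in> topspace X \<Longrightarrow> retract d (0, z) = (0, z)"
  by (simp add: retract_fixed push_0)

text \<open>On the closed disc, unlike the open one used by \<open>push\<close>, the two formulas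
  hold on closed regions that overlap in the seam \<open>|x| = 1 - t / 2\<close>, as closed pasting
  requires.\<close>

lemma retract_char_map:
  assumes c: "(n, \<phi>) \<in> C" and x: "x \<in> disc n" and n: "d < n" and t: "t \<in> {0..1}"
  shows "L2_set x {..<n} \<le> 1 - t / 2 \<Longrightarrow> retract d (t, \<phi> x) = (0, \<phi> (\<lambda>i. 1 / (1 - t / 2) * x i))"
    "L2_set x {..<n} \<ge> 1 - t / 2 \<Longrightarrow> retract d (t, \<phi> x) =
      retract d (2 - (2 - t) / L2_set x {..<n}, \<phi> (\<lambda>i. 1 / L2_set x {..<n} * x i))"
proof -
  have X: "\<phi> x \<in> topspace X" by (rule char_map_in_space[OF c x])
  show 1: "retract d (t, \<phi> x) = (0, \<phi> (\<lambda>i. 1 / (1 - t / 2) * x i))" if L: "L2_set x {..<n} \<le> 1 - t / 2"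
    using x
  proof (cases rule: unit_disc_cases)
    case 1
    then have "push d (t, \<phi> x) = (0, \<phi> (\<lambda>i. 1 / (1 - t / 2) * x i))"
      using push_char_map[OF c 1 n, of t] L by simp
    then show ?thesis
      using retract_push[OF t X, of d] retract_0[OF char_map_in_space[OF c inner_scale[OF x L t]]] by simp
  next
    case 2
    \<comment> \<open>A point of the sphere satisfies the inner bound only at time
      \<open>0\<close>.\<close>
    then have "t = 0" using L t by (simp add: unit_disc_sphere_iff)
    then show ?thesis using retract_0[OF X] by simp
  qed
  show "retract d (t, \<phi> x) =
      retract d (2 - (2 - t) / L2_set x {..<n}, \<phi> (\<lambda>i. 1 / L2_set x {..<n} * x i))"
    if L: "L2_set x {..<n} \<ge> 1 - t / 2"
    using x
  proof (cases rule: unit_disc_cases)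
    case int: 1
    show ?thesis
    proof (cases "L2_set x {..<n} = 1 - t / 2")
      case True
      \<comment> \<open>On the seam the side wall is met at height \<open>0\<close>, so both
        formulas give the same bottom point.\<close>
      have "1 - t / 2 \<noteq> 0" "(2 - t) / (1 - t / 2) = 2" using t by (auto simp: field_simps)
      moreover have "\<phi> (\<lambda>i. 1 / L2_set x {..<n} * x i) \<in> topspace X"
        using outer_scale(1)[OF x L t] char_map_in_space[OF c] by (simp add: unit_disc_sphere_iff)
      ultimately show ?thesis
        using 1 True retract_0 by simp
    next
      case False
      then have "push d (t, \<phi> x) = (2 - (2 - t) / L2_set x {..<n}, \<phi> (\<lambda>i. 1 / L2_set x {..<n} * x i))"
        using push_char_map[OF c int n, of t] L by simp
      then show ?thesis using retract_push[OF t X, of d] by simp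
    qed
  next
    case 2
    then show ?thesis by (simp add: unit_disc_sphere_iff)
  qed
qed

text \<open>The homotopy extension property, with \<open>G\<close> required to be continuous only
  where the retraction lands. By induction on the dimension of the cell, the inner part of its
  cylinder is projected to the bottom and the outer part to the cylinder over finitely many lower
  cells.\<close>

lemma continuous_map_retract:
  assumes G0: "continuous_map X Z (\<lambda>z. G (0, z))"
    and low: "\<And>n \<phi>. (n, \<phi>) \<in> C \<Longrightarrow> n \<le> d \<Longrightarrow>
      continuous_map (cylinder (unit_disc n)) Z (\<lambda>(t, x). G (t, \<phi> x))"
  shows "continuous_map (cylinder X) Z (\<lambda>p. G (retract d p))"
proof (rule continuous_map_cellwise)
  fix n \<phi> assume "(n, \<phi>) \<in> C"
  then show "continuous_map (cylinder (unit_disc n)) Z (\<lambda>(t, x). G (retract d (t, \<phi> x)))"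
  proof (induction n arbitrary: \<phi> rule: less_induct)
    case (less n)
    note c = less.prems
    let ?Z = "cylinder (unit_disc n)"
    show ?case
    proof (cases "n \<le> d")
      case True
      show ?thesis
      proof (rule continuous_map_eq[OF low[OF c True]], safe)
        fix t x assume "(t, x) \<in> topspace ?Z"
        then show "G (t, \<phi> x) = G (retract d (t, \<phi> x))"
          using dim_char_map_le[OF c, of x] True retract_low[of "\<phi> x" d t] by simp
      qed
    next
      case False
      then have n: "d < n" by simp
      have t: "continuous_map ?Z euclideanreal fst"
        using continuous_map_fst continuous_map_into_fulltopology by blast
      have co: "continuous_map ?Z euclideanreal (\<lambda>z. snd z i)" for i
        using continuous_map_compose[OF continuous_map_snd continuous_map_unit_disc_coordinate] by (simp add: o_def)
      have L: "continuous_map ?Z euclideanreal (\<lambda>z. L2_set (snd z) {..<n})"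
        by (intro continuous_map_L2_set co)
      let ?inner = "{z \<in> topspace ?Z. L2_set (snd z) {..<n} - (1 - fst z / 2) \<in> {..0}}"
      let ?outer = "{z \<in> topspace ?Z. L2_set (snd z) {..<n} - (1 - fst z / 2) \<in> {0..}}"
      have D: "continuous_map ?Z euclideanreal (\<lambda>z. L2_set (snd z) {..<n} - (1 - fst z / 2))"
        by (intro continuous_intros L t) simp
      have cl: "closedin ?Z ?inner" "closedin ?Z ?outer"
        by (rule closedin_continuous_map_preimage[OF D]; simp)+
      have "continuous_map (subtopology ?Z ?inner) (unit_disc n) (\<lambda>z i. 1 / (1 - fst z / 2) * snd z i)"
        unfolding continuous_map_into_unit_disc
      proof (intro conjI allI impI)
        show "continuous_map (subtopology ?Z ?inner) euclideanreal (\<lambda>z. 1 / (1 - fst z / 2) * snd z i)" for i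
          by (intro continuous_intros continuous_map_from_subtopology[OF t] continuous_map_from_subtopology[OF co]) auto
        show "(\<lambda>z i. 1 / (1 - fst z / 2) * snd z i) \<in> topspace (subtopology ?Z ?inner) \<rightarrow> disc n"
          using inner_scale[of _ n] by auto
      qed
      from continuous_map_compose[OF continuous_map_compose[OF this char_map(1)[OF c]] G0]
      have "continuous_map (subtopology ?Z ?inner) Z (\<lambda>z. G (0, \<phi> (\<lambda>i. 1 / (1 - fst z / 2) * snd z i)))"
        by (simp add: o_def)
      then have cin: "continuous_map (subtopology ?Z ?inner) Z (\<lambda>(t, x). G (retract d (t, \<phi> x)))"
        by (rule continuous_map_eq) (use retract_char_map(1)[OF c _ n] in auto)
      obtain F where F: "F \<subseteq> C" "finite F" "\<And>k \<psi>. (k, \<psi>) \<in> F \<Longrightarrow> k < n"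
        "\<phi> ` unit_disc_sphere n \<subseteq> (\<Union>(k, \<psi>) \<in> F. \<psi> ` unit_disc_interior k)"
        using cell_boundary[OF c] by metis
      let ?K = "\<lambda>(k, \<psi>). \<psi> ` disc k"
      let ?S = "\<Union>f\<in>F. ?K f"
      \<comment> \<open>Over the boundary, continuity is known one closed cell at a time, from the
        induction hypothesis. Closure-finiteness makes the family finite, as closed pasting
        demands.\<close>
      have cS: "continuous_map (cylinder (subtopology X ?S)) Z (\<lambda>p. G (retract d p))"
      proof (rule pasting_lemma_closed[OF F(2), where T = "\<lambda>f. {0..1} \<times> ?K f" and f = "\<lambda>_ p. G (retract d p)"])
        fix f assume f: "f \<in> F"
        then obtain k \<psi> where k: "f = (k, \<psi>)" "(k, \<psi>) \<in> C" "k < n" "(k, \<psi>) \<in> F"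
          using F(1,3) by (cases f) auto
        have sub: "?K f \<subseteq> ?S" using f by blast
        have "closedin (subtopology X ?S) (?K f)"
          using closedin_cell[OF k(2)] sub k(1) by (simp add: closedin_subset_topspace)
        then show "closedin (cylinder (subtopology X ?S)) ({0..1} \<times> ?K f)"
          by (simp add: closedin_prod_Times_iff)
        have "subtopology (cylinder (subtopology X ?S)) ({0..1} \<times> ?K f) =
            cylinder (subtopology X (?K f))"
          using sub by (simp add: subtopology_Times subtopology_subtopology inf.absorb2)
        then show "continuous_map (subtopology (cylinder (subtopology X ?S)) ({0..1} \<times> ?K f)) Z
            (\<lambda>p. G (retract d p))"
          using continuous_map_on_cell[OF k(2) less.IH[OF k(3,2)]] k(1) by simp
      qed auto
      have "continuous_map (subtopology ?Z ?outer) (unit_disc n) (\<lambda>z i. 1 / L2_set (snd z) {..<n} * snd z i)"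
        unfolding continuous_map_into_unit_disc
      proof (intro conjI allI impI)
        show "continuous_map (subtopology ?Z ?outer) euclideanreal (\<lambda>z. 1 / L2_set (snd z) {..<n} * snd z i)" for i
          by (intro continuous_intros continuous_map_from_subtopology[OF L] continuous_map_from_subtopology[OF co]) auto
        show "(\<lambda>z i. 1 / L2_set (snd z) {..<n} * snd z i) \<in> topspace (subtopology ?Z ?outer) \<rightarrow> disc n"
          using outer_scale(1)[of _ n] by (auto simp: unit_disc_sphere_iff)
      qed
      from continuous_map_compose[OF this char_map(1)[OF c]]
      have "continuous_map (subtopology ?Z ?outer) X (\<lambda>z. \<phi> (\<lambda>i. 1 / L2_set (snd z) {..<n} * snd z i))"
        by (simp add: o_def)
      moreover have "\<phi> (\<lambda>i. 1 / L2_set (snd z) {..<n} * snd z i) \<in> ?S" if "z \<in> topspace (subtopology ?Z ?outer)" for z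
      proof -
        have "(\<lambda>i. 1 / L2_set (snd z) {..<n} * snd z i) \<in> unit_disc_sphere n"
          by (rule outer_scale(1)[of _ n "fst z"]) (use that in auto)
        then show ?thesis using F(4) by (force simp: unit_disc_interior_iff)
      qed
      ultimately have p: "continuous_map (subtopology ?Z ?outer) (subtopology X ?S) (\<lambda>z. \<phi> (\<lambda>i. 1 / L2_set (snd z) {..<n} * snd z i))"
        by (intro continuous_map_into_subtopology) auto
      have s: "continuous_map (subtopology ?Z ?outer) unit_interval (\<lambda>z. 2 - (2 - fst z) / L2_set (snd z) {..<n})"
        unfolding continuous_map_in_subtopology
      proof
        show "continuous_map (subtopology ?Z ?outer) euclideanreal (\<lambda>z. 2 - (2 - fst z) / L2_set (snd z) {..<n})"
          by (intro continuous_intros continuous_map_from_subtopology[OF L] continuous_map_from_subtopology[OF t]) auto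
        show "(\<lambda>z. 2 - (2 - fst z) / L2_set (snd z) {..<n}) \<in> topspace (subtopology ?Z ?outer) \<rightarrow> {0..1}"
          using outer_scale(2)[of _ n] by auto
      qed
      from continuous_map_compose[OF continuous_map_pairedI[OF s p] cS]
      have "continuous_map (subtopology ?Z ?outer) Z (\<lambda>z. G (retract d (2 - (2 - fst z) / L2_set (snd z) {..<n},
          \<phi> (\<lambda>i. 1 / L2_set (snd z) {..<n} * snd z i))))" by (simp add: o_def)
      then have cout: "continuous_map (subtopology ?Z ?outer) Z (\<lambda>(t, x). G (retract d (t, \<phi> x)))"
        by (rule continuous_map_eq) (use retract_char_map(2)[OF c _ n] in auto)
      show ?thesis
      proof (rule pasting_lemma_closed[where I = UNIV and T = "\<lambda>b. if b then ?inner else ?outer"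
            and f = "\<lambda>_. \<lambda>(t, x). G (retract d (t, \<phi> x))"])
        fix z assume "z \<in> topspace ?Z"
        then show "\<exists>b. b \<in> UNIV \<and> z \<in> (if b then ?inner else ?outer) \<and>
            (case z of (t, x) \<Rightarrow> G (retract d (t, \<phi> x))) = (case z of (t, x) \<Rightarrow> G (retract d (t, \<phi> x)))"
          by (intro exI[of _ "L2_set (snd z) {..<n} - (1 - fst z / 2) \<le> 0"]) auto
      qed (use cl cin cout in auto)
    qed
  qed
qed

end

text \<open>In the open cell of \<open>b\<close> a bump function drives points straight towards the
  disc point \<open>c\<close> representing \<open>b\<close>; the other cells of dimension at most
  \<open>d\<close> stay fixed, and \<open>retract\<close> extends this to higher cells. As higher
  cells may accumulate at \<open>b\<close>, the neighbourhood is cut out by the bump function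
  extended in the same way.\<close>

lemma CW_complex_contractible_neighbourhood:
  assumes "CW_complex X" and b: "b \<in> topspace X"
  obtains H N where "continuous_map (cylinder X) X H"
    "\<And>z. z \<in> topspace X \<Longrightarrow> H (0, z) = z" "\<And>t. H (t, b) = b"
    "openin X N" "b \<in> N" "\<And>z. z \<in> N \<Longrightarrow> H (1, z) = b"
proof -
  obtain C where "CW_space X C"
    using assms(1) by (auto simp: CW_complex_def CW_space_def)
  then interpret CW_space X C .
  obtain d \<phi> c where c: "(d, \<phi>) \<in> C" "c \<in> unit_disc_interior d" "\<phi> c = b"
    using b by (rule cell_exists)
  have cD: "c \<in> disc d" using c(2) by (simp add: unit_disc_interior_iff)
  \<comment> \<open>\<open>e\<close> is the distance from \<open>c\<close> to the sphere when
    \<open>d > 0\<close>; a bump of this radius vanishes on the sphere, where the motion must match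
    the identity.\<close>
  define e where "e = 1 - L2_set c {..<d}"
  have e: "e > 0" using c(2) by (simp add: e_def unit_disc_interior_iff)
  define \<beta> where "\<beta> = (\<lambda>x. max 0 (1 - L2_set (\<lambda>i. x i - c i) {..<d} / e))"
  have \<beta>_sphere: "\<beta> x = 0" if "x \<in> unit_disc_sphere d" for x
  proof -
    have "L2_set x {..<d} \<le> L2_set (\<lambda>i. x i - c i) {..<d} + L2_set c {..<d}"
      using L2_set_triangle_ineq[of "\<lambda>i. x i - c i" c "{..<d}"] by simp
    then have "e \<le> L2_set (\<lambda>i. x i - c i) {..<d}"
      using that by (simp add: e_def unit_disc_sphere_iff)
    then show ?thesis using e by (simp add: \<beta>_def)
  qed
  have \<beta>_c: "\<beta> c = 1" by (simp add: \<beta>_def L2_set_0')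
  \<comment> \<open>The factor \<open>2\<close> and the cut-off at \<open>1\<close> let every point
    with \<open>t * \<beta> x \<ge> 1/2\<close> arrive at \<open>c\<close>, so that a whole
    neighbourhood is collapsed.\<close>
  define m where "m = (\<lambda>t x i. x i + min 1 (2 * (t * \<beta> x)) * (c i - x i))"
  define bump where "bump = (\<lambda>z. case locate z of (n, \<psi>, x) \<Rightarrow> if (n, \<psi>) = (d, \<phi>) then \<beta> x else 0)"
  define h where "h = (\<lambda>(t, z). case locate z of (n, \<psi>, x) \<Rightarrow> if (n, \<psi>) = (d, \<phi>) then \<phi> (m t x) else z)"
  have low: "bump z = 0" "h (t, z) = z" if "dim z < d" for t z
    using that by (auto simp: bump_def h_def split: prod.splits)
  have own: "bump (\<phi> x) = \<beta> x \<and> h (t, \<phi> x) = \<phi> (m t x)" if "x \<in> disc d" for t x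
    using that
  proof (cases rule: unit_disc_cases)
    case 1
    then show ?thesis by (simp add: bump_def h_def locate_char_map[OF c(1)])
  next
    case 2
    then show ?thesis
      using low[OF dim_char_map_sphere[OF c(1) 2(1)]] \<beta>_sphere[OF 2(1)] by (simp add: m_def)
  qed
  have other: "bump (\<psi> x) = 0 \<and> h (t, \<psi> x) = \<psi> x"
    if "(n, \<psi>) \<in> C" "n \<le> d" "(n, \<psi>) \<noteq> (d, \<phi>)" "x \<in> disc n" for n \<psi> t x
    using that(4)
  proof (cases rule: unit_disc_cases)
    case 1
    then show ?thesis using that(3) by (auto simp: bump_def h_def locate_char_map[OF that(1)])
  next
    case 2
    then show ?thesis using low dim_char_map_sphere[OF that(1) 2(1)] that(2) by simp
  qed
  have h0: "h (0, z) = z" if "z \<in> topspace X" for z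
  proof -
    obtain n \<psi> x where "(n, \<psi>) \<in> C" "x \<in> unit_disc_interior n" "\<psi> x = z"
      using \<open>z \<in> topspace X\<close> by (rule cell_exists)
    then show ?thesis using locate_char_map[of n \<psi> x] by (auto simp: h_def m_def)
  qed
  have coord: "continuous_map (cylinder (unit_disc n)) euclideanreal (\<lambda>z. snd z i)" for n i
    using continuous_map_compose[OF continuous_map_snd continuous_map_unit_disc_coordinate] by (simp add: o_def)
  have time: "continuous_map (cylinder (unit_disc n)) euclideanreal fst" for n
    using continuous_map_fst continuous_map_into_fulltopology by blast
  have \<beta>_cont: "continuous_map (cylinder (unit_disc d)) euclideanreal (\<lambda>z. fst z * \<beta> (snd z))"
    unfolding \<beta>_def using e
    by (intro continuous_intros continuous_map_L2_set coord time) auto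
  have m_disc: "m t x \<in> disc d" if "t \<in> {0..1}" "x \<in> disc d" for t x
  proof -
    define l where "l = min 1 (2 * (t * \<beta> x))"
    have l: "0 \<le> l" "l \<le> 1" using that by (auto simp: l_def \<beta>_def)
    have "m t x = (\<lambda>i. (1 - l) * x i + l * c i)" by (auto simp: m_def l_def algebra_simps)
    moreover have "L2_set (\<lambda>i. (1 - l) * x i + l * c i) {..<d} \<le> (1 - l) * L2_set x {..<d} + l * L2_set c {..<d}"
      using L2_set_triangle_ineq[of "\<lambda>i. (1 - l) * x i" "\<lambda>i. l * c i" "{..<d}"] l
      by (simp add: L2_set_right_distrib)
    moreover have "\<dots> \<le> 1"
      using l that(2) cD convex_bound_le[of "L2_set x {..<d}" 1 "L2_set c {..<d}" "1 - l" l]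
      by (simp add: topspace_unit_disc)
    ultimately show ?thesis using that(2) cD by (simp add: topspace_unit_disc)
  qed
  have m_cont: "continuous_map (cylinder (unit_disc d)) (unit_disc d) (\<lambda>z. m (fst z) (snd z))"
    unfolding continuous_map_into_unit_disc
  proof (intro conjI allI impI)
    show "continuous_map (cylinder (unit_disc d)) euclideanreal (\<lambda>z. m (fst z) (snd z) i)" for i
      unfolding m_def by (intro continuous_intros coord \<beta>_cont) auto
    show "(\<lambda>z. m (fst z) (snd z)) \<in> topspace (cylinder (unit_disc d)) \<rightarrow> disc d"
      using m_disc by auto
  qed
  have H: "continuous_map (cylinder X) X (\<lambda>p. h (retract d p))"
  proof (rule continuous_map_retract)
    show "continuous_map X X (\<lambda>z. h (0, z))"
      by (rule continuous_map_eq[OF continuous_map_id]) (simp add: h0)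
    fix n \<psi> assume n: "(n, \<psi>) \<in> C" "n \<le> d"
    show "continuous_map (cylinder (unit_disc n)) X (\<lambda>(t, x). h (t, \<psi> x))"
    proof (cases "(n, \<psi>) = (d, \<phi>)")
      case True
      have "continuous_map (cylinder (unit_disc d)) X (\<lambda>(t, x). h (t, \<phi> x))"
        by (rule continuous_map_eq[OF continuous_map_compose[OF m_cont char_map(1)[OF c(1)]]])
          (use own in auto)
      then show ?thesis using True by simp
    next
      case False
      show ?thesis
        by (rule continuous_map_eq[OF continuous_map_compose[OF continuous_map_snd char_map(1)[OF n(1)]]])
          (use other[OF n False] in auto)
    qed
  qed
  \<comment> \<open>The extension applied to \<open>t * bump z\<close> gives a continuous function
    over all cells; the neighbourhood consists of the points where it exceeds \<open>1/2\<close> at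
    time \<open>1\<close>.\<close>
  have V: "continuous_map (cylinder X) euclideanreal (\<lambda>p. (\<lambda>(t, z). t * bump z) (retract d p))"
  proof (rule continuous_map_retract)
    show "continuous_map X euclideanreal (\<lambda>z. case (0, z) of (t, z) \<Rightarrow> t * bump z)" by simp
    fix n \<psi> assume n: "(n, \<psi>) \<in> C" "n \<le> d"
    show "continuous_map (cylinder (unit_disc n)) euclideanreal
        (\<lambda>(t, x). case (t, \<psi> x) of (t, z) \<Rightarrow> t * bump z)"
    proof (cases "(n, \<psi>) = (d, \<phi>)")
      case True
      have "continuous_map (cylinder (unit_disc d)) euclideanreal
          (\<lambda>(t, x). case (t, \<phi> x) of (t, z) \<Rightarrow> t * bump z)"
        by (rule continuous_map_eq[OF \<beta>_cont]) (use own in auto)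
      then show ?thesis using True by simp
    next
      case False
      show ?thesis
        by (rule continuous_map_eq[of _ _ "\<lambda>_. 0"]) (use other[OF n False] in auto)
    qed
  qed
  let ?v = "\<lambda>z. (\<lambda>(t, z). t * bump z) (retract d (1, z))"
  have "continuous_map X (cylinder X) (\<lambda>z. (1, z))"
    by (intro continuous_map_pairedI) (auto simp: continuous_map_id[unfolded id_def])
  from continuous_map_compose[OF this V]
  have v: "continuous_map X euclideanreal ?v" by (simp add: o_def)
  have db: "dim b = d" using locate_char_map[OF c(1,2)] c(3) by simp
  show ?thesis
  proof (rule that[of "\<lambda>p. h (retract d p)" "{z \<in> topspace X. ?v z \<in> {1/2<..}}"])
    show "h (retract d (0, z)) = z" if "z \<in> topspace X" for z
      using retract_0[OF that] h0[OF that] by simp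
    show "h (retract d (t, b)) = b" for t
      using retract_low[of b d t] db own[OF cD, of t] c(3) by (simp add: m_def)
    show "openin X {z \<in> topspace X. ?v z \<in> {1/2<..}}"
      by (rule openin_continuous_map_preimage[OF v]) auto
    show "b \<in> {z \<in> topspace X. ?v z \<in> {1/2<..}}"
      using b retract_low[of b d 1] db own[OF cD] c(3) \<beta>_c by simp
    show "h (retract d (1, z)) = b" if z: "z \<in> {z \<in> topspace X. ?v z \<in> {1/2<..}}" for z
    proof -
      obtain t' z' where r: "retract d (1, z) = (t', z')" by fastforce
      obtain n \<psi> x where l: "locate z' = (n, \<psi>, x)" by (cases "locate z'") auto
      have big: "t' * bump z' > 1 / 2" using z r by simp
      then have eq: "(n, \<psi>) = (d, \<phi>)" using l by (auto simp: bump_def split: if_splits)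
      then have "t' * \<beta> x > 1 / 2" using big l by (simp add: bump_def)
      then have "m t' x = c" by (auto simp: m_def)
      then show ?thesis using r l eq c(3) by (simp add: h_def)
    qed
  qed (rule H)
qed

section \<open>Whitehead products\<close>

lemma continuous_map_Max:
  fixes f :: "'z \<Rightarrow> 'i \<Rightarrow> real"
  assumes "finite I" "I \<noteq> {}" "\<And>i. i \<in> I \<Longrightarrow> continuous_map Z euclideanreal (\<lambda>z. f z i)"
  shows "continuous_map Z euclideanreal (\<lambda>z. Max (f z ` I))"
  using assms
proof (induction I rule: finite_ne_induct)
  case (insert i I)
  then have "continuous_map Z euclideanreal (\<lambda>z. max (f z i) (Max (f z ` I)))"
    by (intro continuous_map_real_max) auto
  then show ?case using insert.hyps by simp
qed simp

lemma continuous_map_Min: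
  fixes f :: "'z \<Rightarrow> 'i \<Rightarrow> real"
  assumes "finite I" "I \<noteq> {}" "\<And>i. i \<in> I \<Longrightarrow> continuous_map Z euclideanreal (\<lambda>z. f z i)"
  shows "continuous_map Z euclideanreal (\<lambda>z. Min (f z ` I))"
  using assms
proof (induction I rule: finite_ne_induct)
  case (insert i I)
  then have "continuous_map Z euclideanreal (\<lambda>z. min (f z i) (Min (f z ` I)))"
    by (intro continuous_map_real_min) auto
  then show ?case using insert.hyps by simp
qed simp

section \<open>The identification of the collapsed cube with the boundary of the next cube\<close>

context
  fixes m :: nat
begin

definition centred :: "(nat \<Rightarrow> real) \<Rightarrow> nat \<Rightarrow> real" where
  "centred x i = (if i < m then 2 * x i - 1 else 0)"

definition centred_norm :: "(nat \<Rightarrow> real) \<Rightarrow> real" where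
  "centred_norm x = Max ((\<lambda>i. \<bar>centred x i\<bar>) ` {..m})"

definition centred_max :: "(nat \<Rightarrow> real) \<Rightarrow> real" where
  "centred_max x = Max (centred x ` {..m})"

definition centred_min :: "(nat \<Rightarrow> real) \<Rightarrow> real" where
  "centred_min x = Min (centred x ` {..m})"

lemma cube_collapse_eq:
  "cube_collapse m x = (\<lambda>i\<in>{..m}. min 1 (2 - 2 * centred_norm x) *
    (1 + min 1 (2 * centred_norm x) * ((centred x i - centred_max x) / (centred_max x - centred_min x))))"
proof -
  have "(\<lambda>i. if i < m then 2 * x i - 1 else 0) = centred x"
    by (auto simp: centred_def)
  then show ?thesis
    by (simp add: cube_collapse_def Let_def centred_norm_def centred_max_def centred_min_def)
qed

lemma centred_bounds:
  assumes "i \<le> m"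
  shows "centred x i \<le> centred_max x" "centred_min x \<le> centred x i" "\<bar>centred x i\<bar> \<le> centred_norm x"
  using assms by (auto simp: centred_max_def centred_min_def centred_norm_def)

lemma centred_norm_nonneg: "0 \<le> centred_norm x"
  using centred_bounds(3)[of 0 x] by linarith

text \<open>Coordinate \<open>m\<close> of \<open>centred x\<close> is \<open>0\<close>, so the
  maximum is nonnegative and the minimum nonpositive. Consequently the denominator in
  \<open>cube_collapse\<close> can vanish only where \<open>centred_norm\<close> does.\<close>

lemma centred_norm_le: "centred_norm x \<le> centred_max x - centred_min x"
proof -
  have "centred_norm x \<in> (\<lambda>i. \<bar>centred x i\<bar>) ` {..m}"
    unfolding centred_norm_def by (rule Max_in) auto
  then obtain k where k: "k \<le> m" "centred_norm x = \<bar>centred x k\<bar>" by auto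
  have "centred x m = 0" by (simp add: centred_def)
  then show ?thesis
    using centred_bounds(1,2)[OF k(1), of x] centred_bounds(1,2)[of m x] k(2) by auto
qed

lemma centred_quotient:
  assumes "i \<le> m"
  shows "(centred x i - centred_max x) / (centred_max x - centred_min x) \<in> {-1..0}"
proof (cases "centred_max x = centred_min x")
  case False
  then have "centred_max x - centred_min x > 0"
    using centred_bounds(1,2)[OF assms, of x] by linarith
  then show ?thesis
    using centred_bounds(1,2)[OF assms, of x] by (simp add: field_simps)
qed simp

lemma centred_norm_le_1:
  assumes "x \<in> topspace (cube m)" shows "centred_norm x \<le> 1"
proof -
  have "\<bar>centred x i\<bar> \<le> 1" for i
    using cube_coordinate[OF assms, of i] by (auto simp: centred_def)
  then show ?thesis unfolding centred_norm_def by (subst Max_le_iff) auto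
qed

text \<open>Up to norm \<open>1/2\<close> a largest coordinate of \<open>centred x\<close> produces
  the value \<open>1\<close>; beyond it a smallest one has quotient \<open>-1\<close> and produces
  \<open>0\<close>.\<close>

lemma cube_collapse_boundary:
  assumes x: "x \<in> topspace (cube m)"
  shows "cube_collapse m x \<in> cube_boundary (Suc m)"
proof -
  let ?r = "centred_norm x" and ?q = "\<lambda>i. (centred x i - centred_max x) / (centred_max x - centred_min x)"
  have r: "0 \<le> ?r" "?r \<le> 1" using centred_norm_nonneg centred_norm_le_1[OF x] by auto
  have y: "cube_collapse m x i = min 1 (2 - 2 * ?r) * (1 + min 1 (2 * ?r) * ?q i)" if "i \<le> m" for i
    using that by (simp add: cube_collapse_eq)
  have "cube_collapse m x i \<in> {0..1}" if i: "i \<le> m" for i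
  proof -
    define s where "s = min 1 (2 * ?r)"
    define a where "a = min 1 (2 - 2 * ?r)"
    define q where "q = ?q i"
    have s: "0 \<le> s" "s \<le> 1" and a: "0 \<le> a" "a \<le> 1" using r by (auto simp: s_def a_def)
    have q: "0 \<le> - q" "- q \<le> 1" using centred_quotient[OF i, of x] by (auto simp: q_def)
    have "0 \<le> s * - q" "s * - q \<le> 1"
      by (rule mult_nonneg_nonneg[OF s(1) q(1)], rule mult_le_one[OF s(2) q])
    then have "0 \<le> 1 + s * q" "1 + s * q \<le> 1" by auto
    then have "0 \<le> a * (1 + s * q)" "a * (1 + s * q) \<le> 1"
      using a mult_le_one[of a "1 + s * q"] by auto
    then show ?thesis unfolding y[OF i] s_def a_def q_def by simp
  qed
  then have top: "cube_collapse m x \<in> topspace (cube (Suc m))"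
    unfolding topspace_cube lessThan_Suc_atMost by (auto simp: cube_collapse_eq)
  have "\<exists>i\<le>m. cube_collapse m x i = 0 \<or> cube_collapse m x i = 1"
  proof (cases "?r \<le> 1 / 2")
    case True
    have "centred_max x \<in> centred x ` {..m}" unfolding centred_max_def by (rule Max_in) auto
    then obtain k where k: "k \<le> m" "centred x k = centred_max x" by auto
    then have "cube_collapse m x k = 1" using y[OF k(1)] True by simp
    then show ?thesis using k(1) by blast
  next
    case False
    have "centred_min x \<in> centred x ` {..m}" unfolding centred_min_def by (rule Min_in) auto
    then obtain k where k: "k \<le> m" "centred x k = centred_min x" by auto
    have "?q k = -1" using k(2) centred_norm_le[of x] False by (simp add: field_simps)
    then have "cube_collapse m x k = 0" using y[OF k(1)] False by simp
    then show ?thesis using k(1) by blast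
  qed
  with top show ?thesis by (auto simp: cube_boundary_def less_Suc_eq_le)
qed

lemma cube_collapse_on_boundary:
  assumes x: "x \<in> cube_boundary m"
  shows "cube_collapse m x = (\<lambda>i\<in>{..m}. 0)"
proof -
  have xc: "x \<in> topspace (cube m)" using x cube_boundary_subset by blast
  obtain i where i: "i < m" "x i = 0 \<or> x i = 1" using x unfolding cube_boundary_def by blast
  then have "\<bar>centred x i\<bar> = 1" by (auto simp: centred_def)
  then have "centred_norm x = 1"
    using centred_bounds(3)[of i x] centred_norm_le_1[OF xc] i(1) by simp
  then show ?thesis by (simp add: cube_collapse_eq)
qed

lemma continuous_map_cube_collapse: "continuous_map (cube m) (cube (Suc m)) (cube_collapse m)"
proof -
  have c: "continuous_map (cube m) euclideanreal (\<lambda>x. centred x i)" for i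
  proof (cases "i < m")
    case True
    have "continuous_map (cube m) euclideanreal (\<lambda>x. x i)"
      using continuous_map_cube_coordinate[OF True] continuous_map_into_fulltopology by blast
    then have "continuous_map (cube m) euclideanreal (\<lambda>x. 2 * x i - 1)"
      by (intro continuous_intros) auto
    then show ?thesis using True by (simp add: centred_def)
  qed (simp add: centred_def)
  have r: "continuous_map (cube m) euclideanreal centred_norm"
    unfolding centred_norm_def[abs_def] by (intro continuous_map_Max continuous_map_real_abs c) auto
  have M: "continuous_map (cube m) euclideanreal centred_max"
    unfolding centred_max_def[abs_def] by (intro continuous_map_Max c) auto
  have L: "continuous_map (cube m) euclideanreal centred_min"
    unfolding centred_min_def[abs_def] by (intro continuous_map_Min c) auto
  define w where "w = (\<lambda>i x. min 1 (2 * centred_norm x) *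
      ((centred x i - centred_max x) / (centred_max x - centred_min x)))"
  have w: "continuous_map (cube m) euclideanreal (w i)" if i: "i \<le> m" for i
    unfolding continuous_map_atin
  proof
    fix x assume x: "x \<in> topspace (cube m)"
    have lim: "(f \<longlongrightarrow> f x) (atin (cube m) x)" if "continuous_map (cube m) euclideanreal f" for f :: "_ \<Rightarrow> real"
      using that x unfolding continuous_map_atin by simp
    have "(w i \<longlongrightarrow> w i x) (atin (cube m) x)"
    proof (cases "centred_norm x = 0")
      case False
      then have "centred_max x - centred_min x \<noteq> 0"
        using centred_norm_le[of x] centred_norm_nonneg[of x] by linarith
      then show ?thesis
        unfolding w_def by (intro tendsto_intros lim c r M L) auto
    next
      case True
      \<comment> \<open>At the centre the quotient may jump, but it is bounded by \<open>1\<close>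
        in absolute value and its factor \<open>min 1 (2 * centred_norm z)\<close> tends to
        \<open>0\<close>.\<close>
      have "\<bar>w i z\<bar> \<le> 2 * centred_norm z" for z
      proof -
        define q where "q = (centred z i - centred_max z) / (centred_max z - centred_min z)"
        have "\<bar>w i z\<bar> = min 1 (2 * centred_norm z) * \<bar>q\<bar>"
          using centred_norm_nonneg[of z] by (simp add: w_def abs_mult q_def)
        also have "\<dots> \<le> min 1 (2 * centred_norm z) * 1"
          using centred_quotient[OF i, of z] centred_norm_nonneg[of z]
          by (intro mult_left_mono) (auto simp: q_def[symmetric])
        finally show ?thesis by simp
      qed
      moreover have "((\<lambda>z. 2 * centred_norm z) \<longlongrightarrow> 0) (atin (cube m) x)"
        using tendsto_mult_left[OF lim[OF r], of 2] True by simp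
      ultimately have "(w i \<longlongrightarrow> 0) (atin (cube m) x)"
        by (intro Lim_null_comparison[of "w i" "\<lambda>z. 2 * centred_norm z"]) (auto intro: always_eventually)
      then show ?thesis using True by (simp add: w_def)
    qed
    then show "limitin euclideanreal (w i) (w i x) (atin (cube m) x)" by simp
  qed
  show ?thesis
    unfolding continuous_map_into_cube
  proof (intro conjI allI impI)
    show "cube_collapse m \<in> topspace (cube m) \<rightarrow> extensional {..<Suc m}"
      by (auto simp: cube_collapse_eq lessThan_Suc_atMost)
    fix i assume "i < Suc m"
    then have i: "i \<le> m" by simp
    have "continuous_map (cube m) euclideanreal (\<lambda>x. min 1 (2 - 2 * centred_norm x) * (1 + w i x))"
      by (intro continuous_intros r w[OF i]) auto
    then have "continuous_map (cube m) euclideanreal (\<lambda>x. cube_collapse m x i)"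
      by (rule continuous_map_eq) (use i in \<open>simp add: cube_collapse_eq w_def\<close>)
    moreover have "cube_collapse m x i \<in> {0..1}" if "x \<in> topspace (cube m)" for x
      using cube_collapse_boundary[OF that] cube_boundary_subset[of "Suc m"] i
        cube_coordinate[of "cube_collapse m x" "Suc m" i] by auto
    ultimately show "continuous_map (cube m) unit_interval (\<lambda>x. cube_collapse m x i)"
      by (auto simp: continuous_map_in_subtopology)
  qed
qed

end

section \<open>Whitehead products of homotopic loops\<close>

lemma continuous_map_cube_fst: "continuous_map (cube (p + q)) (cube p) (cube_fst p)"
  unfolding continuous_map_into_cube by (auto simp: cube_fst_def intro!: continuous_map_cube_coordinate)

lemma continuous_map_cube_snd: "continuous_map (cube (p + q)) (cube q) (cube_snd p q)"
  unfolding continuous_map_into_cube by (auto simp: cube_snd_def intro!: continuous_map_cube_coordinate)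

lemma cube_boundary_fst_or_snd:
  assumes "y \<in> cube_boundary (p + q)"
  shows "cube_fst p y \<in> cube_boundary p \<or> cube_snd p q y \<in> cube_boundary q"
proof -
  obtain i where i: "i < p + q" "y i = 0 \<or> y i = 1" and y: "y \<in> topspace (cube (p + q))"
    using assms unfolding cube_boundary_def by blast
  have f: "cube_fst p y \<in> topspace (cube p)" and s: "cube_snd p q y \<in> topspace (cube q)"
    using continuous_map_image_subset_topspace[OF continuous_map_cube_fst]
      continuous_map_image_subset_topspace[OF continuous_map_cube_snd] y by blast+
  show ?thesis
  proof (cases "i < p")
    case True
    then show ?thesis using f i unfolding cube_boundary_def by (auto simp: cube_fst_def)
  next
    case False
    then have "i - p < q" "cube_snd p q y (i - p) = y i" using i(1) by (auto simp: cube_snd_def)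
    then show ?thesis using s i unfolding cube_boundary_def by auto
  qed
qed

lemma closedin_cube_boundary: "closedin (cube m) (cube_boundary m)"
proof -
  have "cube_boundary m = (\<Union>i\<in>{..<m}. {x \<in> topspace (cube m). x i \<in> {0, 1}})"
    by (auto simp: cube_boundary_def)
  moreover have "closedin (cube m) {x \<in> topspace (cube m). x i \<in> {0, 1}}" if "i < m" for i
    using continuous_map_cube_coordinate[OF that] continuous_map_into_fulltopology
    by (intro closedin_continuous_map_preimage[of _ euclideanreal]) auto
  then have "closedin (cube m) (\<Union>i\<in>{..<m}. {x \<in> topspace (cube m). x i \<in> {0, 1}})"
    by (intro closedin_Union) auto
  ultimately show ?thesis by simp
qed

text \<open>The boundary of a product of cubes is the union of two closed parts, one with second and
  one with first component on the boundary. Where they overlap, both homotopies have the value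
  \<open>y0\<close>, so the pieces paste.\<close>

lemma loop_homotopy_whitehead:
  assumes p: "p \<ge> 1" "q \<ge> 1"
    and f: "(f, f') \<in> loop_homotopy p Y y0" and g: "(g, g') \<in> loop_homotopy q Y y0"
  shows "(whitehead p q f g, whitehead p q f' g') \<in> loop_homotopy (p + q - 1) Y y0"
proof -
  obtain h where h: "continuous_map (cylinder (cube p)) Y h"
    "\<And>x. h (0, x) = f x" "\<And>x. h (1, x) = f' x"
    "\<And>t x. t \<in> {0..1} \<Longrightarrow> x \<in> cube_boundary p \<Longrightarrow> h (t, x) = y0"
    using loop_homotopyE[OF f] by metis
  obtain k where k: "continuous_map (cylinder (cube q)) Y k"
    "\<And>x. k (0, x) = g x" "\<And>x. k (1, x) = g' x"
    "\<And>t x. t \<in> {0..1} \<Longrightarrow> x \<in> cube_boundary q \<Longrightarrow> k (t, x) = y0"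
    using loop_homotopyE[OF g] by metis
  define m where "m = p + q - 1"
  have m: "Suc m = p + q" using p by (simp add: m_def)
  let ?Z = "cylinder (cube m)"
  define H where "H = (\<lambda>(t, x). whitehead p q (\<lambda>y. h (t, y)) (\<lambda>y. k (t, y)) x)"
  have H: "H z = (if cube_snd p q (cube_collapse m (snd z)) \<in> cube_boundary q
      then h (fst z, cube_fst p (cube_collapse m (snd z)))
      else k (fst z, cube_snd p q (cube_collapse m (snd z))))" for z
    by (simp add: H_def whitehead_def Let_def m_def case_prod_unfold)
  have col: "continuous_map ?Z (cube (p + q)) (\<lambda>z. cube_collapse m (snd z))"
    using continuous_map_compose[OF continuous_map_snd continuous_map_cube_collapse, of unit_interval m] m
    by (simp add: o_def)
  have F: "continuous_map ?Z (cube p) (\<lambda>z. cube_fst p (cube_collapse m (snd z)))"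
    and S: "continuous_map ?Z (cube q) (\<lambda>z. cube_snd p q (cube_collapse m (snd z)))"
    using continuous_map_compose[OF col continuous_map_cube_fst]
      continuous_map_compose[OF col continuous_map_cube_snd] by (simp_all add: o_def)
  let ?A = "{z \<in> topspace ?Z. cube_snd p q (cube_collapse m (snd z)) \<in> cube_boundary q}"
  let ?B = "{z \<in> topspace ?Z. cube_fst p (cube_collapse m (snd z)) \<in> cube_boundary p}"
  have cl: "closedin ?Z ?A" "closedin ?Z ?B"
    by (rule closedin_continuous_map_preimage[OF S closedin_cube_boundary])
      (rule closedin_continuous_map_preimage[OF F closedin_cube_boundary])
  have HB: "H z = k (fst z, cube_snd p q (cube_collapse m (snd z)))" if "z \<in> ?B" for z
    using that h(4) k(4) by (auto simp: H)
  have "continuous_map ?Z Y (\<lambda>z. h (fst z, cube_fst p (cube_collapse m (snd z))))"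
    using continuous_map_compose[OF continuous_map_pairedI[OF continuous_map_fst F] h(1)] by (simp add: o_def)
  then have cA: "continuous_map (subtopology ?Z ?A) Y H"
    by (rule continuous_map_eq[OF continuous_map_from_subtopology]) (simp add: H)
  have "continuous_map ?Z Y (\<lambda>z. k (fst z, cube_snd p q (cube_collapse m (snd z))))"
    using continuous_map_compose[OF continuous_map_pairedI[OF continuous_map_fst S] k(1)] by (simp add: o_def)
  then have cB: "continuous_map (subtopology ?Z ?B) Y H"
    by (rule continuous_map_eq[OF continuous_map_from_subtopology]) (use HB in auto)
  have cover: "z \<in> ?A \<or> z \<in> ?B" if "z \<in> topspace ?Z" for z
    using cube_boundary_fst_or_snd[of "cube_collapse m (snd z)" p q] cube_collapse_boundary[of "snd z" m] m that
    by auto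
  have "continuous_map ?Z Y H"
  proof (rule pasting_lemma_closed[where I = UNIV and T = "\<lambda>b. if b then ?A else ?B" and f = "\<lambda>_. H"])
    fix z assume "z \<in> topspace ?Z"
    then show "\<exists>b. b \<in> UNIV \<and> z \<in> (if b then ?A else ?B) \<and> H z = H z"
      using cover[of z] by (intro exI[of _ "z \<in> ?A"]) auto
  qed (use cl cA cB in auto)
  then show ?thesis
    unfolding m_def[symmetric]
  proof (rule loop_homotopyI)
    fix t :: real and x assume t: "t \<in> {0..1}" and x: "x \<in> cube_boundary m"
    \<comment> \<open>The boundary of the cube goes to the origin, which is a boundary point in both
      factors.\<close>
    have y: "cube_collapse m x = (\<lambda>i\<in>{..m}. 0)" by (rule cube_collapse_on_boundary[OF x])
    have xc: "x \<in> topspace (cube m)" using x cube_boundary_subset by blast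
    have "cube_fst p (cube_collapse m x) \<in> topspace (cube p)" "cube_snd p q (cube_collapse m x) \<in> topspace (cube q)"
      using continuous_map_image_subset_topspace[OF F] continuous_map_image_subset_topspace[OF S] t xc by force+
    moreover have "cube_fst p (cube_collapse m x) 0 = 0" "cube_snd p q (cube_collapse m x) 0 = 0"
      using p by (auto simp: y cube_fst_def cube_snd_def) (simp add: m_def)
    ultimately have "cube_fst p (cube_collapse m x) \<in> cube_boundary p" "cube_snd p q (cube_collapse m x) \<in> cube_boundary q"
      using p unfolding cube_boundary_def by (auto intro: exI[of _ 0])
    then show "H (t, x) = y0" using h(4)[OF t] by (simp add: H)
  qed (simp_all add: H_def h k)
qed

lemma loops_whitehead:
  "p \<ge> 1 \<Longrightarrow> q \<ge> 1 \<Longrightarrow> f \<in> loops p Y y0 \<Longrightarrow> g \<in> loops q Y y0 \<Longrightarrow>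
    whitehead p q f g \<in> loops (p + q - 1) Y y0"
  unfolding loops_iff_homotopy by (rule loop_homotopy_whitehead)

lemma whitehead_class_loop_class:
  assumes p: "p \<ge> 1" "q \<ge> 1" and f: "f \<in> loops p Y y0" and g: "g \<in> loops q Y y0"
  shows "whitehead_class p q Y y0 (loop_class p Y y0 f) (loop_class q Y y0 g) =
    loop_class (p + q - 1) Y y0 (whitehead p q f g)"
proof -
  have "loop_class (p + q - 1) Y y0 (whitehead p q f' g') = loop_class (p + q - 1) Y y0 (whitehead p q f g)"
    if "f' \<in> loop_class p Y y0 f" "g' \<in> loop_class q Y y0 g" for f' g'
    using that loop_homotopy_whitehead[OF p, of f f' Y y0 g g']
    by (intro loop_class_eqI loop_homotopy_sym[of "whitehead p q f g"]) (simp add: loop_class_def)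
  moreover have "f \<in> loop_class p Y y0 f" "g \<in> loop_class q Y y0 g"
    using loop_homotopy_refl[OF f] loop_homotopy_refl[OF g] by (simp_all add: loop_class_def)
  ultimately show ?thesis unfolding whitehead_class_def by blast
qed

section \<open>Deformations and retractions of shrinking wedges\<close>

lemma topspace_shrinking_wedge: "topspace (shrinking_wedge J X b) = (\<Union>j\<in>J. wedge_summand X b j)"
proof
  show "topspace (shrinking_wedge J X b) \<subseteq> (\<Union>j\<in>J. wedge_summand X b j)"
    using openin_topspace[of "shrinking_wedge J X b"] unfolding openin_shrinking_wedge by blast
  have "openin (shrinking_wedge J X b) (\<Union>j\<in>J. wedge_summand X b j)"
    unfolding openin_shrinking_wedge
  proof (intro conjI ballI impI)
    fix j assume j: "j \<in> J"
    then have "{y \<in> topspace (X j). wedge_in b j y \<in> (\<Union>j\<in>J. wedge_summand X b j)} = topspace (X j)"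
      by (auto simp: wedge_summand_def)
    then show "openin (X j) {y \<in> topspace (X j). wedge_in b j y \<in> (\<Union>j\<in>J. wedge_summand X b j)}" by simp
  next
    have "{j \<in> J. \<not> wedge_summand X b j \<subseteq> (\<Union>j\<in>J. wedge_summand X b j)} = {}" by blast
    then show "finite {j \<in> J. \<not> wedge_summand X b j \<subseteq> (\<Union>j\<in>J. wedge_summand X b j)}"
      by (simp only: finite.emptyI)
  qed simp
  then show "(\<Union>j\<in>J. wedge_summand X b j) \<subseteq> topspace (shrinking_wedge J X b)"
    by (rule openin_subset)
qed

lemma continuous_map_wedge_in:
  assumes "j \<in> J" shows "continuous_map (X j) (shrinking_wedge J X b) (wedge_in b j)"
  unfolding continuous_map
  using assms by (auto simp: topspace_shrinking_wedge openin_shrinking_wedge wedge_summand_def)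

lemma continuous_map_from_wedge:
  assumes summand: "\<And>j. j \<in> J \<Longrightarrow> continuous_map (X j) Z (\<lambda>y. r (wedge_in b j y))"
    and null: "\<And>U. openin Z U \<Longrightarrow> r None \<in> U \<Longrightarrow> finite {j \<in> J. \<not> r ` wedge_summand X b j \<subseteq> U}"
  shows "continuous_map (shrinking_wedge J X b) Z r"
  unfolding continuous_map
proof (intro conjI allI impI)
  show "r ` topspace (shrinking_wedge J X b) \<subseteq> topspace Z"
    using continuous_map_image_subset_topspace[OF summand]
    by (fastforce simp: topspace_shrinking_wedge wedge_summand_def)
  fix U assume U: "openin Z U"
  let ?V = "{p \<in> topspace (shrinking_wedge J X b). r p \<in> U}"
  show "openin (shrinking_wedge J X b) ?V"
    unfolding openin_shrinking_wedge
  proof (intro conjI ballI impI)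
    show "?V \<subseteq> (\<Union>j\<in>J. wedge_summand X b j)" by (auto simp: topspace_shrinking_wedge)
    fix j assume j: "j \<in> J"
    have "{y \<in> topspace (X j). wedge_in b j y \<in> ?V} = {y \<in> topspace (X j). r (wedge_in b j y) \<in> U}"
      using j by (auto simp: topspace_shrinking_wedge wedge_summand_def)
    then show "openin (X j) {y \<in> topspace (X j). wedge_in b j y \<in> ?V}"
      using openin_continuous_map_preimage[OF summand[OF j] U] by simp
  next
    assume "None \<in> ?V"
    then have "finite {j \<in> J. \<not> r ` wedge_summand X b j \<subseteq> U}" using null U by simp
    then show "finite {j \<in> J. \<not> wedge_summand X b j \<subseteq> ?V}"
      by (rule rev_finite_subset) (auto simp: topspace_shrinking_wedge)
  qed
qed

text \<open>By the tube criterion only the topology of the wedge itself is involved; almost all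
  summands must then be small for all times in \<open>K\<close> at once.\<close>

lemma continuous_map_from_wedge_homotopy:
  assumes summand: "\<And>j. j \<in> J \<Longrightarrow>
      continuous_map (cylinder (X j)) Z (\<lambda>(t, y). G (t, wedge_in b j y))"
    and null: "\<And>K U. K \<subseteq> {0..1} \<Longrightarrow> openin Z U \<Longrightarrow> \<forall>s\<in>K. G (s, None) \<in> U \<Longrightarrow>
      finite {j \<in> J. \<not> (\<forall>s\<in>K. \<forall>p\<in>wedge_summand X b j. G (s, p) \<in> U)}"
  shows "continuous_map (cylinder (shrinking_wedge J X b)) Z G"
proof (rule continuous_map_tube)
  fix p assume "p \<in> topspace (shrinking_wedge J X b)"
  then obtain j y where j: "j \<in> J" "y \<in> topspace (X j)" "p = wedge_in b j y"
    by (auto simp: topspace_shrinking_wedge wedge_summand_def)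
  have "continuous_map unit_interval (cylinder (X j)) (\<lambda>s. (s, y))"
    using j(2) by (intro continuous_map_pairedI) auto
  from continuous_map_compose[OF this summand[OF j(1)]]
  show "continuous_map unit_interval Z (\<lambda>s. G (s, p))" by (simp add: o_def j(3))
next
  fix K U assume K: "compactin unit_interval K" and U: "openin Z U"
  let ?V = "{p \<in> topspace (shrinking_wedge J X b). \<forall>s\<in>K. G (s, p) \<in> U}"
  show "openin (shrinking_wedge J X b) ?V"
    unfolding openin_shrinking_wedge
  proof (intro conjI ballI impI)
    show "?V \<subseteq> (\<Union>j\<in>J. wedge_summand X b j)" by (auto simp: topspace_shrinking_wedge)
    fix j assume j: "j \<in> J"
    have "{y \<in> topspace (X j). wedge_in b j y \<in> ?V} =
        {y \<in> topspace (X j). \<forall>s\<in>K. (\<lambda>(t, y). G (t, wedge_in b j y)) (s, y) \<in> U}"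
      using j by (auto simp: topspace_shrinking_wedge wedge_summand_def)
    then show "openin (X j) {y \<in> topspace (X j). wedge_in b j y \<in> ?V}"
      using openin_tube[OF summand[OF j] K U] by simp
  next
    assume "None \<in> ?V"
    then have "finite {j \<in> J. \<not> (\<forall>s\<in>K. \<forall>p\<in>wedge_summand X b j. G (s, p) \<in> U)}"
      using null[OF _ U, of K] compactin_subset_topspace[OF K] by simp
    then show "finite {j \<in> J. \<not> wedge_summand X b j \<subseteq> ?V}"
      by (rule rev_finite_subset) (auto simp: topspace_shrinking_wedge)
  qed
qed

section \<open>Tails of the wedge and the collapses onto them\<close>

definition wedge_tail :: "(nat \<Rightarrow> 'a topology) \<Rightarrow> (nat \<Rightarrow> 'a) \<Rightarrow> nat \<Rightarrow> (nat \<times> 'a) option set" where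
  "wedge_tail X b k = (\<Union>j\<in>{k..}. wedge_summand X b j)"

definition wedge_collapse :: "nat \<Rightarrow> (nat \<times> 'a) option \<Rightarrow> (nat \<times> 'a) option" where
  "wedge_collapse k p = (case p of None \<Rightarrow> None | Some (j, y) \<Rightarrow> if k \<le> j then p else None)"

lemma wedge_collapse_in: "wedge_collapse k (wedge_in b j y) = (if k \<le> j then wedge_in b j y else None)"
  by (simp add: wedge_collapse_def wedge_in_def)

lemma wedge_collapse_None [simp]: "wedge_collapse k None = None"
  by (simp add: wedge_collapse_def)

locale pointed_wedge =
  fixes X :: "nat \<Rightarrow> 'a topology" and b :: "nat \<Rightarrow> 'a"
  assumes base: "\<And>j. j \<ge> 1 \<Longrightarrow> b j \<in> topspace (X j)"
begin

abbreviation W :: "(nat \<times> 'a) option topology" where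
  "W \<equiv> shrinking_wedge {1..} X b"

lemma None_in_summand: "1 \<le> j \<Longrightarrow> None \<in> wedge_summand X b j"
  using base[of j] by (force simp: wedge_summand_def wedge_in_def)

lemma None_in_wedge: "None \<in> topspace W"
  using None_in_summand[of 1] by (auto simp: topspace_shrinking_wedge)

lemma wedge_collapse_summand:
  "1 \<le> j \<Longrightarrow> wedge_collapse k ` wedge_summand X b j \<subseteq> wedge_summand X b j"
  using None_in_summand[of j] by (auto simp: wedge_summand_def wedge_collapse_in)

lemma continuous_map_wedge_collapse:
  assumes k: "1 \<le> k" shows "continuous_map W (subtopology W (wedge_tail X b k)) (wedge_collapse k)"
proof (rule continuous_map_into_subtopology)
  show "continuous_map W W (wedge_collapse k)"
  proof (rule continuous_map_from_wedge)
    fix j :: nat assume j: "j \<in> {1..}"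
    show "continuous_map (X j) W (\<lambda>y. wedge_collapse k (wedge_in b j y))"
      using continuous_map_wedge_in[OF j, of X b] None_in_wedge by (simp add: wedge_collapse_in)
  next
    fix U assume "openin W U" "wedge_collapse k None \<in> U"
    then have "finite {j \<in> {1..}. \<not> wedge_summand X b j \<subseteq> U}"
      by (simp add: openin_shrinking_wedge)
    then show "finite {j \<in> {1..}. \<not> wedge_collapse k ` wedge_summand X b j \<subseteq> U}"
      by (rule rev_finite_subset) (use wedge_collapse_summand in fastforce)
  qed
  show "wedge_collapse k \<in> topspace W \<rightarrow> wedge_tail X b k"
  proof
    fix p assume "p \<in> topspace W"
    then obtain j y where j: "1 \<le> j" "y \<in> topspace (X j)" "p = wedge_in b j y"
      by (auto simp: topspace_shrinking_wedge wedge_summand_def)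
    have "None \<in> wedge_tail X b k"
      using None_in_summand[OF k] by (auto simp: wedge_tail_def)
    moreover have "p \<in> wedge_tail X b k" if "k \<le> j"
      using j that by (auto simp: wedge_tail_def wedge_summand_def)
    ultimately show "wedge_collapse k p \<in> wedge_tail X b k"
      using j(3) by (simp add: wedge_collapse_in)
  qed
qed

lemma wedge_collapse_tail: "p \<in> wedge_tail X b k \<Longrightarrow> wedge_collapse k p = p"
  by (auto simp: wedge_tail_def wedge_summand_def wedge_collapse_in)

lemma wedge_tail_subset_open:
  assumes "openin W U" "None \<in> U"
  obtains k where "1 \<le> k" "wedge_tail X b k \<subseteq> U"
proof -
  have "finite {j \<in> {1..}. \<not> wedge_summand X b j \<subseteq> U}"
    using assms by (simp add: openin_shrinking_wedge)
  then obtain k where k: "\<And>j. 1 \<le> j \<Longrightarrow> \<not> wedge_summand X b j \<subseteq> U \<Longrightarrow> j \<le> k"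
    unfolding finite_nat_set_iff_bounded_le by auto
  have "wedge_tail X b (Suc k) \<subseteq> U"
    unfolding wedge_tail_def
  proof (rule UN_least)
    fix j assume "j \<in> {Suc k..}"
    then show "wedge_summand X b j \<subseteq> U" using k[of j] by (cases "wedge_summand X b j \<subseteq> U") auto
  qed
  then show ?thesis using that[of "Suc k"] by simp
qed

text \<open>The collapse maps each summand into itself, so the index sets \<open>F\<close> and
  \<open>G\<close> of the given pair still serve.\<close>

lemma wedge_disjoint_maps_collapse:
  assumes k: "1 \<le> k" and fg: "wedge_disjoint_maps n X b f g"
  shows "wedge_disjoint_maps n X b (\<lambda>x. wedge_collapse k (f x)) (\<lambda>x. wedge_collapse k (g x))"
proof -
  have r: "continuous_map W W (wedge_collapse k)"
    using continuous_map_wedge_collapse[OF k] continuous_map_into_fulltopology by blast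
  have f: "f \<in> loops n W None" and g: "g \<in> loops n W None"
    using fg by (auto simp: wedge_disjoint_maps_def)
  have "\<exists>F G. F \<subseteq> {1..} \<and> G \<subseteq> {1..} \<and> F \<inter> G = {} \<and>
        f ` topspace (cube n) \<subseteq> (\<Union>j\<in>F. wedge_summand X b j) \<and>
        g ` topspace (cube n) \<subseteq> (\<Union>j\<in>G. wedge_summand X b j)"
    using fg unfolding wedge_disjoint_maps_def by (elim conjE)
  then obtain F G where FG: "F \<subseteq> {1..}" "G \<subseteq> {1..}" "F \<inter> G = {}"
      "f ` topspace (cube n) \<subseteq> (\<Union>j\<in>F. wedge_summand X b j)"
      "g ` topspace (cube n) \<subseteq> (\<Union>j\<in>G. wedge_summand X b j)"
    by (elim exE conjE)
  have image: "(\<lambda>x. wedge_collapse k (h x)) ` topspace (cube n) \<subseteq> (\<Union>j\<in>E. wedge_summand X b j)"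
    if "h ` topspace (cube n) \<subseteq> (\<Union>j\<in>E. wedge_summand X b j)" "E \<subseteq> {1..}" for h E
  proof
    fix p assume "p \<in> (\<lambda>x. wedge_collapse k (h x)) ` topspace (cube n)"
    then obtain x where x: "x \<in> topspace (cube n)" "p = wedge_collapse k (h x)" by auto
    then have "h x \<in> (\<Union>j\<in>E. wedge_summand X b j)" using that(1) by auto
    then obtain j where j: "j \<in> E" "h x \<in> wedge_summand X b j" by auto
    then have "p \<in> wedge_summand X b j"
      using wedge_collapse_summand[of j k] that(2) x(2) by auto
    then show "p \<in> (\<Union>j\<in>E. wedge_summand X b j)" using j(1) by blast
  qed
  show ?thesis
    unfolding wedge_disjoint_maps_def
    using loops_postcompose[OF f r, of None] loops_postcompose[OF g r, of None]
      image[OF FG(4,1)] image[OF FG(5,2)] FG(1-3) by (intro conjI exI[of _ F] exI[of _ G]) simp_all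
qed

text \<open>The product of classes can be computed from any representatives, in particular from
  wedge-disjoint ones.\<close>

lemma wedge_disjoint_products_eq:
  assumes "n \<ge> 1"
  shows "wedge_disjoint_products n X b =
    {loop_class (2 * n - 1) W None (whitehead n n f g) | f g. wedge_disjoint_maps n X b f g}"
proof -
  have eq: "whitehead_class n n W None (loop_class n W None f) (loop_class n W None g) =
      loop_class (2 * n - 1) W None (whitehead n n f g)" if "wedge_disjoint_maps n X b f g" for f g
    using whitehead_class_loop_class[OF assms assms, of f W None g] that
    by (simp add: wedge_disjoint_maps_def mult_2)
  show ?thesis
  proof (intro equalityI subsetI)
    fix x assume "x \<in> wedge_disjoint_products n X b"
    then obtain f g where "wedge_disjoint_maps n X b f g"
      "x = whitehead_class n n W None (loop_class n W None f) (loop_class n W None g)"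
      unfolding wedge_disjoint_products_def wedge_disjoint_def by blast
    then show "x \<in> {loop_class (2 * n - 1) W None (whitehead n n f g) | f g. wedge_disjoint_maps n X b f g}"
      using eq by blast
  next
    fix x assume "x \<in> {loop_class (2 * n - 1) W None (whitehead n n f g) | f g. wedge_disjoint_maps n X b f g}"
    then obtain f g where fg: "wedge_disjoint_maps n X b f g"
      "x = whitehead_class n n W None (loop_class n W None f) (loop_class n W None g)"
      using eq by auto
    then have "loop_class n W None f \<in> carrier (homotopy_group n W None)"
      "loop_class n W None g \<in> carrier (homotopy_group n W None)"
      "wedge_disjoint n X b (loop_class n W None f) (loop_class n W None g)"
      by (auto simp: wedge_disjoint_maps_def carrier_homotopy_group wedge_disjoint_def)
    then show "x \<in> wedge_disjoint_products n X b"
      unfolding wedge_disjoint_products_def using fg(2) by blast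
  qed
qed

lemma wedge_disjoint_products_carrier:
  assumes "n \<ge> 1"
  shows "wedge_disjoint_products n X b \<subseteq> carrier (homotopy_group (2 * n - 1) W None)"
  unfolding wedge_disjoint_products_eq[OF assms] carrier_homotopy_group
  using loops_whitehead[OF assms assms, of _ W None] by (auto simp: wedge_disjoint_maps_def mult_2)

text \<open>The collapse induces an endomorphism of the homotopy group that takes generators to
  generators. The induction over \<open>generate\<close> is carried out for all representatives
  \<open>f\<close> of a class.\<close>

lemma generate_wedge_collapse:
  assumes n: "n \<ge> 2" and k: "1 \<le> k"
    and x: "x \<in> generate (homotopy_group (2 * n - 1) W None) (wedge_disjoint_products n X b)"
    and f: "f \<in> loops (2 * n - 1) W None" "x = loop_class (2 * n - 1) W None f"
  shows "loop_class (2 * n - 1) W None (\<lambda>y. wedge_collapse k (f y))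
    \<in> generate (homotopy_group (2 * n - 1) W None) (wedge_disjoint_products n X b)"
proof -
  let ?m = "2 * n - 1" and ?c = "loop_class (2 * n - 1) W None" and ?r = "\<lambda>f y. wedge_collapse k (f y)" and ?S = "wedge_disjoint_products n X b"
  let ?G = "homotopy_group ?m W None"
  have m: "?m \<ge> 2" "?m \<ge> 1" and n1: "n \<ge> 1" using n by auto
  have S: "?S \<subseteq> carrier ?G" by (rule wedge_disjoint_products_carrier[OF n1])
  have r: "continuous_map W W (wedge_collapse k)"
    using continuous_map_wedge_collapse[OF k] continuous_map_into_fulltopology by blast
  have rl: "?r f \<in> loops ?m W None" if "f \<in> loops ?m W None" for f
    using loops_postcompose[OF that r] by simp
  have rc: "?c (?r f) = ?c (?r g)"
    if "f \<in> loops ?m W None" "?c f = ?c g" for f g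
  proof (rule loop_class_eqI)
    have "(f, g) \<in> loop_homotopy ?m W None" using loop_class_eq_iff[OF that(1)] that(2) by simp
    then show "(?r f, ?r g) \<in> loop_homotopy ?m W None"
      using loop_homotopy_postcompose[OF _ r] by simp
  qed
  have rS: "?c (?r f) \<in> ?S" if f: "?c f \<in> ?S" "f \<in> loops ?m W None" for f
  proof -
    obtain g h where gh: "wedge_disjoint_maps n X b g h"
      "?c f = ?c (whitehead n n g h)"
      using f(1) unfolding wedge_disjoint_products_eq[OF n1] by (elim CollectE exE conjE)
    \<comment> \<open>This is strict: the case distinction in \<open>whitehead\<close> depends on
      the point alone, and the collapse acts on the values.\<close>
    have "?r (whitehead n n g h) = whitehead n n (?r g) (?r h)"
      by (auto simp: fun_eq_iff whitehead_def Let_def)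
    then have "?c (?r f) = ?c (whitehead n n (?r g) (?r h))"
      using rc[OF f(2) gh(2)] by simp
    then show ?thesis
      unfolding wedge_disjoint_products_eq[OF n1] using wedge_disjoint_maps_collapse[OF k gh(1)] by blast
  qed
  interpret group ?G by (rule group_homotopy_group[OF m(1) None_in_wedge])
  have sub: "subgroup (generate ?G ?S) ?G" by (rule generate_is_subgroup[OF S])
  from x f show ?thesis
  proof (induction arbitrary: f rule: generate.induct)
    case one
    have "?c (?r f) = ?c (?r (\<lambda>_. None))"
      by (rule rc[OF one(1)]) (use one(2) in \<open>simp add: one_homotopy_group\<close>)
    then show ?case
      using subgroup.one_closed[OF sub] by (simp add: one_homotopy_group)
  next
    case (incl h)
    then show ?case using rS[of f] by (auto intro: generate.incl)
  next
    case (inv h)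
    obtain g where g: "g \<in> loops ?m W None" "h = ?c g"
      using inv(1) S by (auto simp: carrier_homotopy_group)
    have "?c f = ?c (loop_inverse g)"
      using inv(3) inv_homotopy_group[OF m(1) g(1)] g(2) by simp
    then have "?c (?r f) = ?c (?r (loop_inverse g))"
      by (rule rc[OF inv(2)])
    also have "?r (loop_inverse g) = loop_inverse (?r g)"
      by (simp add: fun_eq_iff loop_inverse_def)
    also have "?c (loop_inverse (?r g)) = inv\<^bsub>?G\<^esub> ?c (?r g)"
      by (rule inv_homotopy_group[OF m(1) rl[OF g(1)], symmetric])
    finally show ?case
      using generate.inv[OF rS[of g]] inv(1) g by simp
  next
    case (eng h1 h2)
    have "h1 \<in> carrier ?G" "h2 \<in> carrier ?G"
      using eng(1,2) generate_incl[OF S] by auto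
    then obtain g1 g2 where g: "g1 \<in> loops ?m W None" "h1 = ?c g1"
        "g2 \<in> loops ?m W None" "h2 = ?c g2"
      by (auto simp: carrier_homotopy_group)
    have "?c f = ?c (loop_add g1 g2)"
      using eng.prems(2) mult_homotopy_group[OF m(2) g(1,3)] g(2,4) by simp
    then have "?c (?r f) = ?c (?r (loop_add g1 g2))"
      by (rule rc[OF eng.prems(1)])
    also have "?r (loop_add g1 g2) = loop_add (?r g1) (?r g2)"
      by (simp add: fun_eq_iff loop_add_def)
    also have "?c (loop_add (?r g1) (?r g2)) =
        ?c (?r g1) \<otimes>\<^bsub>?G\<^esub> ?c (?r g2)"
      by (rule mult_homotopy_group[OF m(2) rl[OF g(1)] rl[OF g(3)], symmetric])
    finally show ?case
      using generate.eng[OF eng.IH(1)[OF g(1,2)] eng.IH(2)[OF g(3,4)]] by simp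
  qed
qed

text \<open>The deformations of the summands fit together because each fixes its basepoint;
  continuity at the common point holds because each preserves its summand.\<close>

lemma wedge_deformation:
  assumes CW: "\<And>j. j \<ge> 1 \<Longrightarrow> CW_complex (X j)"
  obtains G where "continuous_map (cylinder W) W G"
    "\<And>p. p \<in> topspace W \<Longrightarrow> G (0, p) = p" "\<And>t. G (t, None) = None"
    "\<And>k. 1 \<le> k \<Longrightarrow> \<exists>U. openin W U \<and> None \<in> U \<and> (\<forall>p\<in>U. G (1, p) \<in> wedge_tail X b k)"
proof -
  define good where "good = (\<lambda>j H N. continuous_map (cylinder (X j)) (X j) H \<and>
      (\<forall>z\<in>topspace (X j). H (0, z) = z) \<and> (\<forall>t. H (t, b j) = b j) \<and>
      openin (X j) N \<and> b j \<in> N \<and> (\<forall>z\<in>N. H (1, z) = b j))"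
  have "\<exists>H N. good j H N" if j: "1 \<le> j" for j
  proof -
    obtain H N where "continuous_map (cylinder (X j)) (X j) H"
      "\<And>z. z \<in> topspace (X j) \<Longrightarrow> H (0, z) = z" "\<And>t. H (t, b j) = b j"
      "openin (X j) N" "b j \<in> N" "\<And>z. z \<in> N \<Longrightarrow> H (1, z) = b j"
      using CW_complex_contractible_neighbourhood[OF CW[OF j] base[OF j]] by blast
    then have "good j H N" unfolding good_def by blast
    then show ?thesis by blast
  qed
  then have "\<forall>j\<in>{1..}. \<exists>H. \<exists>N. good j H N" by simp
  from bchoice[OF this] obtain H where "\<forall>j\<in>{1..}. \<exists>N. good j (H j) N" ..
  from bchoice[OF this] obtain N where "\<forall>j\<in>{1..}. good j (H j) (N j)" ..
  then have good: "good j (H j) (N j)" if "1 \<le> j" for j using that by simp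
  have H: "\<And>j. 1 \<le> j \<Longrightarrow> continuous_map (cylinder (X j)) (X j) (H j)"
      "\<And>j z. 1 \<le> j \<Longrightarrow> z \<in> topspace (X j) \<Longrightarrow> H j (0, z) = z" "\<And>j t. 1 \<le> j \<Longrightarrow> H j (t, b j) = b j"
      "\<And>j. 1 \<le> j \<Longrightarrow> openin (X j) (N j)" "\<And>j. 1 \<le> j \<Longrightarrow> b j \<in> N j"
      "\<And>j z. 1 \<le> j \<Longrightarrow> z \<in> N j \<Longrightarrow> H j (1, z) = b j"
    using good unfolding good_def by blast+
  define G where "G = (\<lambda>(t, p). case p of None \<Rightarrow> None | Some (j, y) \<Rightarrow> wedge_in b j (H j (t, y)))"
  have G_in: "G (t, wedge_in b j y) = wedge_in b j (H j (t, y))" if "1 \<le> j" for t j y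
    using H(3)[OF that] by (simp add: G_def wedge_in_def)
  have G_None: "G (t, None) = None" for t by (simp add: G_def)
  have G_summand: "G (t, p) \<in> wedge_summand X b j" if "1 \<le> j" "t \<in> {0..1}" "p \<in> wedge_summand X b j" for t p j
  proof -
    obtain y where y: "y \<in> topspace (X j)" "p = wedge_in b j y"
      using \<open>p \<in> wedge_summand X b j\<close> by (auto simp: wedge_summand_def)
    have "H j (t, y) \<in> topspace (X j)"
      using continuous_map_image_subset_topspace[OF H(1)[OF that(1)]] y(1) that(2) by auto
    then show ?thesis using G_in[OF that(1)] y(2) by (simp add: wedge_summand_def)
  qed
  show ?thesis
  proof (rule that[of G])
    show "continuous_map (cylinder W) W G"
    proof (rule continuous_map_from_wedge_homotopy)
      fix j :: nat assume j: "j \<in> {1..}"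
      show "continuous_map (cylinder (X j)) W (\<lambda>(t, y). G (t, wedge_in b j y))"
        by (rule continuous_map_eq[OF continuous_map_compose[OF H(1) continuous_map_wedge_in[OF j]]])
          (use j G_in in auto)
    next
      fix K :: "real set" and U assume K: "K \<subseteq> {0..1}" and U: "openin W U" "\<forall>s\<in>K. G (s, None) \<in> U"
      show "finite {j \<in> {1..}. \<not> (\<forall>s\<in>K. \<forall>p\<in>wedge_summand X b j. G (s, p) \<in> U)}"
      proof (cases "K = {}")
        case False
        then have "None \<in> U" using U(2) G_None by auto
        then have fin: "finite {j \<in> {1..}. \<not> wedge_summand X b j \<subseteq> U}"
          using U(1) by (simp add: openin_shrinking_wedge)
        show ?thesis
        proof (rule rev_finite_subset[OF fin], rule subsetI)
          fix j assume j: "j \<in> {j \<in> {1..}. \<not> (\<forall>s\<in>K. \<forall>p\<in>wedge_summand X b j. G (s, p) \<in> U)}"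
          then obtain s p where sp: "s \<in> K" "p \<in> wedge_summand X b j" "G (s, p) \<notin> U" by auto
          have "G (s, p) \<in> wedge_summand X b j"
            by (rule G_summand) (use j sp K in auto)
          then show "j \<in> {j \<in> {1..}. \<not> wedge_summand X b j \<subseteq> U}" using j sp(3) by auto
        qed
      qed simp
    qed
    show "G (0, p) = p" if "p \<in> topspace W" for p
      using that H(2) by (auto simp: topspace_shrinking_wedge wedge_summand_def G_in)
    show "\<exists>U. openin W U \<and> None \<in> U \<and> (\<forall>p\<in>U. G (1, p) \<in> wedge_tail X b k)" if k: "1 \<le> k" for k
    proof -
      \<comment> \<open>In the summands before \<open>k\<close> only the collapsed neighbourhood is
        kept, while later summands are kept whole. So only finitely many are restricted and
        \<open>U\<close> is open.\<close>
      define D where "D = (\<lambda>j. if j < k then N j else topspace (X j))"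
      define U where "U = (\<Union>j\<in>{1..}. wedge_in b j ` D j)"
      have D: "openin (X j) (D j)" "D j \<subseteq> topspace (X j)" "b j \<in> D j" if "1 \<le> j" for j
        using H(4,5)[OF that] base[OF that] openin_subset[OF H(4)[OF that]] by (auto simp: D_def)
      have None: "None \<in> U"
        unfolding U_def
      proof (rule UN_I[of 1])
        show "None \<in> wedge_in b 1 ` D 1"
          using D(3)[of 1] by (intro image_eqI[of _ _ "b 1"]) (auto simp: wedge_in_def)
      qed simp
      have in_U: "wedge_in b j y \<in> U \<longleftrightarrow> y \<in> D j" if "1 \<le> j" for j y
      proof (cases "y = b j")
        case True
        then show ?thesis using None D(3)[OF that] by (simp add: wedge_in_def)
      next
        case False
        then show ?thesis using that by (auto simp: U_def wedge_in_def split: if_splits)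
      qed
      have "openin W U"
        unfolding openin_shrinking_wedge
      proof (intro conjI ballI impI)
        show "U \<subseteq> (\<Union>j\<in>{1..}. wedge_summand X b j)"
          unfolding U_def wedge_summand_def by (intro UN_mono image_mono D(2)) auto
        fix j :: nat assume "j \<in> {1..}"
        then have j: "1 \<le> j" by simp
        have "{y \<in> topspace (X j). wedge_in b j y \<in> U} = D j"
          using in_U[OF j] D(2)[OF j] by auto
        then show "openin (X j) {y \<in> topspace (X j). wedge_in b j y \<in> U}"
          using D(1)[OF j] by simp
      next
        have "wedge_summand X b j \<subseteq> U" if "1 \<le> j" "k \<le> j" for j
          using that by (auto simp: wedge_summand_def in_U D_def)
        then have "{j \<in> {1..}. \<not> wedge_summand X b j \<subseteq> U} \<subseteq> {..<k}"
          by (metis (no_types, lifting) atLeast_iff lessThan_iff linorder_not_le mem_Collect_eq subsetI)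
        then show "finite {j \<in> {1..}. \<not> wedge_summand X b j \<subseteq> U}"
          by (rule finite_subset) simp
      qed
      moreover have "G (1, p) \<in> wedge_tail X b k" if p: "p \<in> U" for p
      proof -
        obtain j y where j: "1 \<le> j" "p = wedge_in b j y" "y \<in> D j"
          using p by (auto simp: U_def)
        show ?thesis
        proof (cases "j < k")
          case True
          then have "G (1, p) = None"
            using j G_in[OF j(1)] H(6)[OF j(1)] by (simp add: wedge_in_def D_def)
          then show ?thesis using None_in_summand[OF k] by (auto simp: wedge_tail_def)
        next
          case False
          then have "p \<in> wedge_summand X b j" using j by (simp add: wedge_summand_def D_def)
          then show ?thesis using G_summand[OF j(1), of 1 p] False by (auto simp: wedge_tail_def)
        qed
      qed
      ultimately show ?thesis using None by blast
    qed
  qed (rule G_None)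
qed

text \<open>A null sequence can be deformed so that its terms lie in smaller and smaller tails of the
  wedge.  Collapsing the \<open>j\<close>-th expansion to the tail that contains the \<open>j\<close>-th term does not
  change that term, and makes the resulting array of loops null.\<close>

lemma closed_under_infinite_sums_whitehead_span:
  assumes CW: "\<And>j. j \<ge> 1 \<Longrightarrow> CW_complex (X j)" and n: "n \<ge> 2"
  shows "closed_under_infinite_sums (2 * n - 1) W None (whitehead_span n X b)"
  unfolding closed_under_infinite_sums_def
proof (intro ballI impI)
  let ?m = "2 * n - 1" and ?c = "loop_class (2 * n - 1) W None" and ?S = "wedge_disjoint_products n X b"
  let ?G = "homotopy_group ?m W None"
  have m: "?m \<ge> 2" "?m \<ge> 1" and n1: "n \<ge> 1" using n by auto
  note S = wedge_disjoint_products_carrier[OF n1]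
  fix f assume f: "f \<in> null_sequences ?m W None"
    and fW: "\<forall>j\<ge>1. ?c (f j) \<in> whitehead_span n X b"
  obtain G where G: "continuous_map (cylinder W) W G"
    "\<And>p. p \<in> topspace W \<Longrightarrow> G (0, p) = p" "\<And>t. G (t, None) = None"
    "\<And>k. 1 \<le> k \<Longrightarrow> \<exists>U. openin W U \<and> None \<in> U \<and> (\<forall>p\<in>U. G (1, p) \<in> wedge_tail X b k)"
    using wedge_deformation[OF CW] by metis
  define h where "h = (\<lambda>j x. G (1, f j x))"
  have fl: "f j \<in> loops ?m W None" if "1 \<le> j" for j
    using f that by (simp add: null_sequences_def)
  have deform: "(g, \<lambda>x. G (1, g x)) \<in> loop_homotopy ?m W None" if g: "g \<in> loops ?m W None" for g
  proof (rule loop_homotopyI[where h = "\<lambda>(t, x). G (t, g x)"])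
    have "continuous_map (cylinder (cube ?m)) (cylinder W) (\<lambda>z. (fst z, g (snd z)))"
      using continuous_map_compose[OF continuous_map_snd, of "cube ?m" W g] g
      by (intro continuous_map_pairedI continuous_map_fst) (simp add: loops_def o_def)
    from continuous_map_compose[OF this G(1)]
    show "continuous_map (cylinder (cube ?m)) W (\<lambda>(t, x). G (t, g x))"
      by (simp add: o_def case_prod_unfold)
    show "(case (0, x) of (t, x) \<Rightarrow> G (t, g x)) = g x" if "x \<in> topspace (cube ?m)" for x
      using G(2)[of "g x"] continuous_map_image_subset_topspace[of "cube ?m" W g] g that by (auto simp: loops_def)
  qed (use loops_value_boundary[OF g] G(3) in auto)
  have hl: "h j \<in> loops ?m W None" if "1 \<le> j" for j
    using loop_homotopy_imp_loops[OF deform[OF fl[OF that]]] by (simp add: h_def)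
  have tail1: "wedge_tail X b 1 = topspace W"
    by (simp add: wedge_tail_def topspace_shrinking_wedge)
  have tail_fin: "finite {j. 1 \<le> j \<and> \<not> h j ` topspace (cube ?m) \<subseteq> wedge_tail X b k}" if k: "1 \<le> k" for k
  proof -
    obtain U where U: "openin W U" "None \<in> U" "\<forall>p\<in>U. G (1, p) \<in> wedge_tail X b k" using G(4)[OF k] by blast
    then have "finite {j. 1 \<le> j \<and> \<not> f j ` topspace (cube ?m) \<subseteq> U}"
      using f by (simp add: null_sequences_def)
    then show ?thesis by (rule rev_finite_subset) (use U(3) in \<open>auto simp: h_def\<close>)
  qed
  \<comment> \<open>The smallest tail of index at most \<open>j\<close> that holds the deformed
    term. The cap \<open>j\<close> makes the maximum exist even for a term lying in every tail, such
    as a constant one; still \<open>\<kappa> j\<close> tends to infinity.\<close>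
  define \<kappa> where "\<kappa> = (\<lambda>j. Max {k \<in> {1..j}. h j ` topspace (cube ?m) \<subseteq> wedge_tail X b k})"
  have \<kappa>_in: "1 \<le> \<kappa> j \<and> h j ` topspace (cube ?m) \<subseteq> wedge_tail X b (\<kappa> j)" if j: "1 \<le> j" for j
  proof -
    have "h j ` topspace (cube ?m) \<subseteq> wedge_tail X b 1"
      unfolding tail1 using hl[OF j] continuous_map_image_subset_topspace[of "cube ?m" W "h j"]
      by (simp add: loops_def)
    then have "1 \<in> {k \<in> {1..j}. h j ` topspace (cube ?m) \<subseteq> wedge_tail X b k}" using j by simp
    then have "\<kappa> j \<in> {k \<in> {1..j}. h j ` topspace (cube ?m) \<subseteq> wedge_tail X b k}"
      unfolding \<kappa>_def by (intro Max_in) auto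
    then show ?thesis by simp
  qed
  have \<kappa>_fin: "finite {j. 1 \<le> j \<and> \<kappa> j < k}" if k: "1 \<le> k" for k
  proof (rule finite_subset)
    show "{j. 1 \<le> j \<and> \<kappa> j < k} \<subseteq> {..<k} \<union> {j. 1 \<le> j \<and> \<not> h j ` topspace (cube ?m) \<subseteq> wedge_tail X b k}"
    proof
      fix j assume j: "j \<in> {j. 1 \<le> j \<and> \<kappa> j < k}"
      have "k \<le> \<kappa> j" if "k \<le> j" "h j ` topspace (cube ?m) \<subseteq> wedge_tail X b k"
        unfolding \<kappa>_def by (rule Max_ge) (use that k in auto)
      then show "j \<in> {..<k} \<union> {j. 1 \<le> j \<and> \<not> h j ` topspace (cube ?m) \<subseteq> wedge_tail X b k}"
        using j by force
    qed
  qed (use tail_fin[OF k] in simp)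
  have tail_mono: "wedge_tail X b k \<subseteq> wedge_tail X b l" if "l \<le> k" for k l
    unfolding wedge_tail_def using that by (intro UN_mono) auto
  have tails_null: "finite {j. 1 \<le> j \<and> \<not> wedge_tail X b (\<kappa> j) \<subseteq> U}" if U: "openin W U" "None \<in> U" for U
  proof -
    obtain k where k: "1 \<le> k" "wedge_tail X b k \<subseteq> U" using U by (rule wedge_tail_subset_open)
    have "{j. 1 \<le> j \<and> \<not> wedge_tail X b (\<kappa> j) \<subseteq> U} \<subseteq> {j. 1 \<le> j \<and> \<kappa> j < k}"
      using k(2) tail_mono by (auto simp: not_le[symmetric])
    then show ?thesis using \<kappa>_fin[OF k(1)] by (rule finite_subset)
  qed
  define good where "good = (\<lambda>j e A. ?c (f j) = ?c (infinite_sum None e) \<and>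
      (\<forall>i\<ge>1. e i \<in> loops ?m (subtopology W (A i)) None) \<and> shrinking_sets W None A \<and>
      (\<forall>i\<ge>1. ?c (e i) \<in> generate ?G ?S))"
  have "\<exists>e A. good j e A" if j: "1 \<le> j" for j
  proof -
    have "?c (f j) \<in> infinite_sum_span ?m W None ?S"
      using fW j by (simp add: whitehead_span_def)
    then obtain e A where "?c (f j) = ?c (infinite_sum None e)"
      "\<And>i. 1 \<le> i \<Longrightarrow> e i \<in> loops ?m (subtopology W (A i)) None" "shrinking_sets W None A"
      "\<And>i. 1 \<le> i \<Longrightarrow> ?c (e i) \<in> generate ?G ?S"
      by (rule infinite_sum_spanE[OF m(1) None_in_wedge S]) (rule that)
    then have "good j e A" unfolding good_def by (intro conjI allI impI)
    then show ?thesis by blast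
  qed
  then have "\<forall>j\<in>{1..}. \<exists>e. \<exists>A. good j e A" by simp
  from bchoice[OF this] obtain e where "\<forall>j\<in>{1..}. \<exists>A. good j (e j) A" ..
  from bchoice[OF this] obtain A where "\<forall>j\<in>{1..}. good j (e j) (A j)" ..
  then have good: "good j (e j) (A j)" if "1 \<le> j" for j using that by simp
  have e: "\<And>j. 1 \<le> j \<Longrightarrow> ?c (f j) = ?c (infinite_sum None (e j))"
      "\<And>j i. 1 \<le> j \<Longrightarrow> 1 \<le> i \<Longrightarrow> e j i \<in> loops ?m (subtopology W (A j i)) None"
      "\<And>j. 1 \<le> j \<Longrightarrow> shrinking_sets W None (A j)"
      "\<And>j i. 1 \<le> j \<Longrightarrow> 1 \<le> i \<Longrightarrow> ?c (e j i) \<in> generate ?G ?S"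
    using good unfolding good_def by blast+
  define g where "g = (\<lambda>j i x. wedge_collapse (\<kappa> j) (e j i x))"
  define B where "B = (\<lambda>j i. wedge_collapse (\<kappa> j) ` (topspace W \<inter> A j i))"
  have r: "continuous_map W (subtopology W (wedge_tail X b (\<kappa> j))) (wedge_collapse (\<kappa> j))" if "1 \<le> j" for j
    using continuous_map_wedge_collapse \<kappa>_in[OF that] by simp
  have rW: "continuous_map W W (wedge_collapse (\<kappa> j))" if "1 \<le> j" for j
    using r[OF that] continuous_map_into_fulltopology by blast
  have g_loops: "g j i \<in> loops ?m (subtopology W (B j i)) None" if j: "1 \<le> j" "1 \<le> i" for j i
  proof -
    have "continuous_map (subtopology W (A j i)) (subtopology W (B j i)) (wedge_collapse (\<kappa> j))"
      using continuous_map_from_subtopology[OF rW[OF j(1)]] by (auto simp: continuous_map_in_subtopology B_def)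
    from loops_postcompose[OF e(2)[OF j] this, of None] show ?thesis by (simp add: g_def)
  qed
  have g_gen: "?c (g j i) \<in> generate ?G ?S" if j: "1 \<le> j" "1 \<le> i" for j i
    unfolding g_def
    by (rule generate_wedge_collapse[OF n _ e(4)[OF j] loops_full[OF e(2)[OF j]]]) (use \<kappa>_in j in auto)
  have B_null: "shrinking_array W None B"
    unfolding shrinking_array_def
  proof (intro allI impI)
    fix U assume U: "openin W U \<and> None \<in> U"
    \<comment> \<open>Outside the finite set \<open>?J\<close> a whole row lies in \<open>U\<close>.
      A row with index in \<open>?J\<close> is null because the collapse is continuous and its
      expansion was null.\<close>
    let ?J = "{j. 1 \<le> j \<and> \<not> wedge_tail X b (\<kappa> j) \<subseteq> U}"
    have fin: "finite {i. 1 \<le> i \<and> \<not> B j i \<subseteq> U}" if j: "1 \<le> j" for j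
    proof -
      have "openin W {p \<in> topspace W. wedge_collapse (\<kappa> j) p \<in> U}"
        using rW[OF j] U by (intro openin_continuous_map_preimage) auto
      then have "finite {i. 1 \<le> i \<and> \<not> A j i \<subseteq> {p \<in> topspace W. wedge_collapse (\<kappa> j) p \<in> U}}"
        using e(3)[OF j] U None_in_wedge by (simp add: shrinking_sets_def)
      then show ?thesis by (rule rev_finite_subset) (auto simp: B_def)
    qed
    have "finite (SIGMA j:?J. {i. 1 \<le> i \<and> \<not> B j i \<subseteq> U})"
      by (rule finite_SigmaI[OF tails_null]) (use U fin in auto)
    moreover have "B j i \<subseteq> wedge_tail X b (\<kappa> j)" if "1 \<le> j" for j i
      using continuous_map_image_subset_topspace[OF r[OF that]] by (auto simp: B_def)
    then have "{(j, i). 1 \<le> j \<and> 1 \<le> i \<and> \<not> B j i \<subseteq> U} \<subseteq> (SIGMA j:?J. {i. 1 \<le> i \<and> \<not> B j i \<subseteq> U})"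
      by blast
    ultimately show "finite {(j, i). 1 \<le> j \<and> 1 \<le> i \<and> \<not> B j i \<subseteq> U}"
      by (rule rev_finite_subset)
  qed
  \<comment> \<open>This is strict, since the collapse fixes the common point that fills the end of
    an infinite sum.\<close>
  have collapse_sum: "(\<lambda>x. wedge_collapse (\<kappa> j) (infinite_sum None (e j) x)) = infinite_sum None (g j)" for j
    by (auto simp: fun_eq_iff infinite_sum_def Let_def g_def)
  have hom: "(h j, infinite_sum None (g j)) \<in> loop_homotopy ?m (subtopology W (wedge_tail X b (\<kappa> j))) None"
    if j: "1 \<le> j" for j
  proof -
    have "(h j, f j) \<in> loop_homotopy ?m W None"
      using loop_homotopy_sym[OF deform[OF fl[OF j]]] by (simp add: h_def)
    also have "(f j, infinite_sum None (e j)) \<in> loop_homotopy ?m W None"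
      using loop_class_eq_iff[OF fl[OF j]] e(1)[OF j] by simp
    finally have he: "(h j, infinite_sum None (e j)) \<in> loop_homotopy ?m W None" .
    \<comment> \<open>The homotopy \<open>he\<close> may run anywhere in the wedge. Its collapse is
      confined to the tail, which is what allows these homotopies to be summed over
      \<open>j\<close>.\<close>
    have "(\<lambda>x. wedge_collapse (\<kappa> j) (h j x), \<lambda>x. wedge_collapse (\<kappa> j) (infinite_sum None (e j) x))
        \<in> loop_homotopy ?m (subtopology W (wedge_tail X b (\<kappa> j))) None"
      by (rule loop_homotopy_postcompose[OF he r[OF j]]) simp
    then have c: "(\<lambda>x. wedge_collapse (\<kappa> j) (h j x), infinite_sum None (g j))
        \<in> loop_homotopy ?m (subtopology W (wedge_tail X b (\<kappa> j))) None"
      unfolding collapse_sum .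
    have "(\<lambda>x. wedge_collapse (\<kappa> j) (h j x), h j)
        \<in> loop_homotopy ?m (subtopology W (wedge_tail X b (\<kappa> j))) None"
      using loop_homotopy_imp_loops[OF c] \<kappa>_in[OF j] wedge_collapse_tail
      by (intro loop_homotopy_eq_on_cube) auto
    from loop_homotopy_sym[OF this] c show ?thesis by (rule loop_homotopy_trans)
  qed
  have "(infinite_sum None h, infinite_sum None (\<lambda>j. infinite_sum None (g j)))
      \<in> loop_homotopy ?m (subtopology W UNIV) None"
    by (rule loop_homotopy_infinite_sum[OF m(2) None_in_wedge UNIV_I hom])
      (use tails_null in \<open>auto simp: shrinking_sets_def\<close>)
  then have h_sum: "?c (infinite_sum None h) =
      ?c (infinite_sum None (\<lambda>j. infinite_sum None (g j)))"
    by (intro loop_class_eqI) simp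
  obtain D where D: "shrinking_sets W None D" "\<forall>j\<ge>1. f j \<in> loops ?m (subtopology W (D j)) None"
    using f unfolding null_sequences_iff by (elim exE conjE)
  have "infinite_sum None f \<in> loops ?m W None"
    by (rule loops_full[OF loops_infinite_sum[OF m(2) None_in_wedge UNIV_I _ D(1)]]) (use D(2) in auto)
  \<comment> \<open>The sum of the \<open>f j\<close> is deformed as a whole. As \<open>G\<close>
    fixes the common point, the result is the sum of the deformed terms.\<close>
  from deform[OF this] have "(infinite_sum None f, \<lambda>x. G (1, infinite_sum None f x)) \<in> loop_homotopy ?m W None" .
  moreover have "(\<lambda>x. G (1, infinite_sum None f x)) = infinite_sum None h"
    by (auto simp: fun_eq_iff infinite_sum_def Let_def h_def G(3))
  ultimately have "?c (infinite_sum None f) = ?c (infinite_sum None h)"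
    by (intro loop_class_eqI) simp
  then show "?c (infinite_sum None f) \<in> whitehead_span n X b"
    using infinite_sum_span_double[OF m(1) None_in_wedge S g_loops B_null g_gen] h_sum
    by (simp add: whitehead_span_def)
qed

end

theorem lemma4p15:
  fixes X :: "nat \<Rightarrow> 'a topology" and b :: "nat \<Rightarrow> 'a" and n :: nat
  assumes "\<And>j. j \<ge> 1 \<Longrightarrow> CW_complex (X j)"
    and "\<And>j. j \<ge> 1 \<Longrightarrow> b j \<in> topspace (X j)"
    and "n \<ge> 2"
  shows "subgroup (whitehead_span n X b)
        (homotopy_group (2 * n - 1) (shrinking_wedge {1..} X b) None) \<and>
      closed_under_infinite_sums (2 * n - 1) (shrinking_wedge {1..} X b) None
        (whitehead_span n X b) \<and>
      whitehead_span n X b =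
        cl_Sigma (2 * n - 1) (shrinking_wedge {1..} X b) None (wedge_disjoint_products n X b)"
proof -
  interpret pointed_wedge X b by standard (rule assms(2))
  \<comment> \<open>Summation in two coordinates, on which the interchange rests, needs a cube of
    dimension at least \<open>2\<close>.\<close>
  have m: "2 * n - 1 \<ge> 2" and n1: "n \<ge> 1" using assms(3) by auto
  note S = wedge_disjoint_products_carrier[OF n1]
  note closed = closed_under_infinite_sums_whitehead_span[OF assms(1,3)]
  show ?thesis
    using subgroup_infinite_sum_span[OF m None_in_wedge S] closed
      cl_Sigma_eq_infinite_sum_span[OF m None_in_wedge S] unfolding whitehead_span_def by simp
qed

end
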